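(* Let $\mathcal{W}_n$ denote one of the families $S_n$ or $B_n$ and let $\k$ be a subfield of $\mathbb{C}$. For nonnegative integers $b,c$, let $V \cong M_{\mathcal{W}}(\mathbf{0})^{\oplus b} \oplus M_{\mathcal{W}}(\mathbf{1})^{\oplus c}$ be a graded $\mathrm{FI}_{\mathcal{W}}$-module over $\k$ in which each summand is placed in some positive graded degree. Let $\Gamma^*$ denote the free symmetric, exterior, or graded-commutative $\mathrm{FI}_{\mathcal{W}}$-algebra generated by $V$, and let $A^*$ be any $\mathrm{FI}_{\mathcal{W}}$-algebra subquotient of $\Gamma^*$. Then for any $\mathcal W_n$ character polynomial $P$ and any $q>1$ the series $$ \sum_{d=0}^{\infty} \frac{ \lim_{n \to \infty} \langle P_n, A^d_n \rangle_{\mathcal{W}_n}}{q^d} $$ converges absolutely (in particular each limit exists). More generally, this series converges absolutely for any collection $\{A^d_n : d, n \geq 0\}$ of $\mathcal{W}_n$-representations such that $A^d_n$ is a $\mathcal{W}_n$-equivariant subquotient of $\Gamma^d_n$ for all $d,n$ (provided the limits exist).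
   Context: $B_n$ is the group of permutations of $\{1,\bar1,\dots,n,\bar n\}$ commuting with $a\mapsto \bar a$. $\mathrm{FI}_{\mathcal W}$ is the category FI of sets $\{1,\dots,n\}$ with injections (when $\mathcal W_n=S_n$) or the category $\mathrm{FI}_{BC}$ of sets $\{1,\bar1,\dots,n,\bar n\}$ with injections commuting with negation (when $\mathcal W_n=B_n$); an $\mathrm{FI}_{\mathcal W}$-module/algebra is a functor from it to $\k$-vector spaces/graded $\k$-algebras, with value $V_n$ at $\mathbf n$ a $\mathcal W_n$-representation. Concretely: $M_{\mathcal W}(\mathbf 0)_n$ is the one-dimensional space spanned by $y$ with trivial action (all morphisms act by the identity on $y$). In type A, $M(\mathbf 1)_n$ has basis $x_1,\dots,x_n$ and an injection $f$ sends $x_i\mapsto x_{f(i)}$; in type B/C, $M_{BC}(\mathbf 1)_n$ has basis $x_1,x_{\bar1},\dots,x_n,x_{\bar n}$ with $f$ sending $x_i\mapsto x_{f(i)}$. Thus $\Gamma^*_n$ is the symmetric, exterior, or graded-commutative algebra on $b$ copies of $y$ and $c$ copies of the variables $x_i$, each copy in its given positive degree, with $\mathcal W_n$ and the morphisms acting diagonally on monomials by acting on subscripts. $\Gamma^d_n$ is its degree-$d$ part. Character polynomials: for $\sigma\in B_n$, $X_r(\sigma)$ counts positive $r$-cycles $(s_1\cdots s_r)(\bar s_1\cdots\bar s_r)$ and $Y_r(\sigma)$ counts negative $r$-cycles $(s_1\cdots s_r\bar s_1\cdots \bar s_r)$ in its unique cycle decomposition; for $\sigma\in S_n$, $X_r$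 counts $r$-cycles. A $\mathcal W_n$ character polynomial is a polynomial $P$ in these with coefficients in $\k$, $P_n$ its restriction to $\mathcal W_n$. $\langle-,-\rangle_{\mathcal W_n}$ is the standard inner product of class functions, a representation standing for its character. *)

theory Defs
  imports
    Complex_Main
    "HOL-Library.FuncSet"
    "HOL-Library.Countable"
    "HOL-Library.Poly_Mapping"
    "HOL-Combinatorics.Orbits"
begin

section \<open>The categories FI and FI_BC, and the groups S_n and B_n\<close>

datatype family = TypeA | TypeBC

text \<open>The element $\bar a$ is encoded as the integer $-a$, so the object $\mathbf n$ is
  $\{1,\dots,n\}$ in type A and $\{\pm 1,\dots,\pm n\}$ in type B/C.\<close>

definition fiw_obj :: "family \<Rightarrow> nat \<Rightarrow> int set" where
  "fiw_obj W n = (case W of TypeA \<Rightarrow> {1..int n} | TypeBC \<Rightarrow> {-int n..int n} - {0})"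

text \<open>Morphisms are extensional functions, so that equal morphisms are equal as functions;
  they compose by \<^const>\<open>compose\<close>.\<close>

definition fiw_hom :: "family \<Rightarrow> nat \<Rightarrow> nat \<Rightarrow> (int \<Rightarrow> int) set" where
  "fiw_hom W m n = {f \<in> fiw_obj W m \<rightarrow>\<^sub>E fiw_obj W n. inj_on f (fiw_obj W m) \<and>
     (W = TypeBC \<longrightarrow> (\<forall>a\<in>fiw_obj W m. f (- a) = - f a))}"

definition fiw_id :: "family \<Rightarrow> nat \<Rightarrow> int \<Rightarrow> int" where
  "fiw_id W n = (\<lambda>a\<in>fiw_obj W n. a)"

definition weyl :: "family \<Rightarrow> nat \<Rightarrow> (int \<Rightarrow> int) set" where
  "weyl W n = {\<sigma> \<in> fiw_hom W n n. bij_betw \<sigma> (fiw_obj W n) (fiw_obj W n)}"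


section \<open>Graded FI_W-algebras and their subquotients\<close>

definition linear_map_on ::
  "('k \<Rightarrow> 'a \<Rightarrow> 'a) \<Rightarrow> ('k \<Rightarrow> 'b \<Rightarrow> 'b) \<Rightarrow> 'a::plus set \<Rightarrow> ('a \<Rightarrow> 'b::plus) \<Rightarrow> bool" where
  "linear_map_on s t V f \<longleftrightarrow>
     (\<forall>x\<in>V. \<forall>y\<in>V. f (x + y) = f x + f y) \<and> (\<forall>r. \<forall>x\<in>V. f (s r x) = t r (f x))"

text \<open>\<open>alg_piece A n d\<close> is $A^d_n$, a subspace of one ambient vector space. The pieces need not be
  independent inside it: the grading is external, which is why the multiplication and
  the induced maps carry the degrees as arguments. \<open>alg_mult A n d e\<close> is the product
  $A^d_n \times A^e_n \to A^{d+e}_n$, \<open>alg_unit A n\<close> lies in $A^0_n$, and \<open>alg_map A d m n f\<close> is the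
  degree-$d$ part of $A(f)$ for $f : \mathbf m \to \mathbf n$.\<close>

record ('k, 'a) fiw_alg =
  alg_scale :: "'k \<Rightarrow> 'a \<Rightarrow> 'a"
  alg_piece :: "nat \<Rightarrow> nat \<Rightarrow> 'a set"
  alg_mult :: "nat \<Rightarrow> nat \<Rightarrow> nat \<Rightarrow> 'a \<Rightarrow> 'a \<Rightarrow> 'a"
  alg_unit :: "nat \<Rightarrow> 'a"
  alg_map :: "nat \<Rightarrow> nat \<Rightarrow> nat \<Rightarrow> (int \<Rightarrow> int) \<Rightarrow> 'a \<Rightarrow> 'a"

locale fiw_algebra = vector_space "alg_scale A"
  for W :: family and A :: "('k::field, 'a::ab_group_add) fiw_alg" +
  assumes subspace_piece: "subspace (alg_piece A n d)"
    and mult_closed: "\<lbrakk>x \<in> alg_piece A n d; y \<in> alg_piece A n e\<rbrakk> \<Longrightarrow> alg_mult A n d e x y \<in> alg_piece A n (d + e)"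
    and mult_linear_left: "y \<in> alg_piece A n e \<Longrightarrow>
          linear_map_on (alg_scale A) (alg_scale A) (alg_piece A n d) (\<lambda>x. alg_mult A n d e x y)"
    and mult_linear_right: "x \<in> alg_piece A n d \<Longrightarrow>
          linear_map_on (alg_scale A) (alg_scale A) (alg_piece A n e) (alg_mult A n d e x)"
    and mult_assoc: "\<lbrakk>x \<in> alg_piece A n d; y \<in> alg_piece A n e; z \<in> alg_piece A n k\<rbrakk> \<Longrightarrow>
          alg_mult A n (d + e) k (alg_mult A n d e x y) z = alg_mult A n d (e + k) x (alg_mult A n e k y z)"
    and unit_closed: "alg_unit A n \<in> alg_piece A n 0"
    and mult_unit_left: "x \<in> alg_piece A n d \<Longrightarrow> alg_mult A n 0 d (alg_unit A n) x = x"
    and mult_unit_right: "x \<in> alg_piece A n d \<Longrightarrow> alg_mult A n d 0 x (alg_unit A n) = x"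
    and map_closed: "\<lbrakk>f \<in> fiw_hom W m n; x \<in> alg_piece A m d\<rbrakk> \<Longrightarrow> alg_map A d m n f x \<in> alg_piece A n d"
    and map_linear: "f \<in> fiw_hom W m n \<Longrightarrow>
          linear_map_on (alg_scale A) (alg_scale A) (alg_piece A m d) (alg_map A d m n f)"
    and map_mult: "\<lbrakk>f \<in> fiw_hom W m n; x \<in> alg_piece A m d; y \<in> alg_piece A m e\<rbrakk> \<Longrightarrow>
          alg_map A (d + e) m n f (alg_mult A m d e x y) =
            alg_mult A n d e (alg_map A d m n f x) (alg_map A e m n f y)"
    and map_unit: "f \<in> fiw_hom W m n \<Longrightarrow> alg_map A 0 m n f (alg_unit A m) = alg_unit A n"
    and map_id: "x \<in> alg_piece A n d \<Longrightarrow> alg_map A d n n (fiw_id W n) x = x"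
    and map_compose: "\<lbrakk>f \<in> fiw_hom W l m; g \<in> fiw_hom W m n; x \<in> alg_piece A l d\<rbrakk> \<Longrightarrow>
          alg_map A d l n (compose (fiw_obj W l) g f) x = alg_map A d m n g (alg_map A d l m f x)"

definition fiw_subalgebra ::
  "family \<Rightarrow> ('k::field, 'a::ab_group_add) fiw_alg \<Rightarrow> (nat \<Rightarrow> nat \<Rightarrow> 'a set) \<Rightarrow> bool" where
  "fiw_subalgebra W G U \<longleftrightarrow>
     (\<forall>n d. U n d \<subseteq> alg_piece G n d \<and> module.subspace (alg_scale G) (U n d)) \<and>
     (\<forall>n d e. \<forall>x\<in>U n d. \<forall>y\<in>U n e. alg_mult G n d e x y \<in> U n (d + e)) \<and>
     (\<forall>n. alg_unit G n \<in> U n 0) \<and>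
     (\<forall>m n d. \<forall>f\<in>fiw_hom W m n. \<forall>x\<in>U m d. alg_map G d m n f x \<in> U n d)"

text \<open>\<open>A\<close> is (isomorphic to) a quotient of a subobject \<open>U\<close> of \<open>G\<close>, the projection being \<open>\<phi>\<close>.\<close>

definition fiw_subquotient ::
  "family \<Rightarrow> ('k::field, 'a::ab_group_add) fiw_alg \<Rightarrow> ('k, 'b::ab_group_add) fiw_alg \<Rightarrow> bool" where
  "fiw_subquotient W A G \<longleftrightarrow> fiw_algebra W A \<and> (\<exists>U \<phi>. fiw_subalgebra W G U \<and>
     (\<forall>n d. linear_map_on (alg_scale G) (alg_scale A) (U n d) (\<phi> n d) \<and> \<phi> n d ` U n d = alg_piece A n d) \<and>
     (\<forall>n d e. \<forall>x\<in>U n d. \<forall>y\<in>U n e.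
        \<phi> n (d + e) (alg_mult G n d e x y) = alg_mult A n d e (\<phi> n d x) (\<phi> n e y)) \<and>
     (\<forall>n. \<phi> n 0 (alg_unit G n) = alg_unit A n) \<and>
     (\<forall>m n d. \<forall>f\<in>fiw_hom W m n. \<forall>x\<in>U m d.
        \<phi> n d (alg_map G d m n f x) = alg_map A d m n f (\<phi> m d x)))"

definition weyl_rep ::
  "family \<Rightarrow> nat \<Rightarrow> ('k::field \<Rightarrow> 'a \<Rightarrow> 'a::ab_group_add) \<Rightarrow> 'a set \<Rightarrow>
     ((int \<Rightarrow> int) \<Rightarrow> 'a \<Rightarrow> 'a) \<Rightarrow> bool" where
  "weyl_rep W n s V \<rho> \<longleftrightarrow> vector_space s \<and> module.subspace s V \<and>
     (\<forall>\<sigma>\<in>weyl W n. \<rho> \<sigma> ` V \<subseteq> V \<and> linear_map_on s s V (\<rho> \<sigma>)) \<and>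
     (\<forall>x\<in>V. \<rho> (fiw_id W n) x = x) \<and>
     (\<forall>\<sigma>\<in>weyl W n. \<forall>\<tau>\<in>weyl W n. \<forall>x\<in>V. \<rho> (compose (fiw_obj W n) \<sigma> \<tau>) x = \<rho> \<sigma> (\<rho> \<tau> x))"

definition weyl_subquotient ::
  "family \<Rightarrow> nat \<Rightarrow> ('k::field \<Rightarrow> 'a \<Rightarrow> 'a::ab_group_add) \<Rightarrow> 'a set \<Rightarrow>
     ((int \<Rightarrow> int) \<Rightarrow> 'a \<Rightarrow> 'a) \<Rightarrow> ('k \<Rightarrow> 'b \<Rightarrow> 'b::ab_group_add) \<Rightarrow> 'b set \<Rightarrow>
     ((int \<Rightarrow> int) \<Rightarrow> 'b \<Rightarrow> 'b) \<Rightarrow> bool" where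
  "weyl_subquotient W n s V \<rho> t G \<gamma> \<longleftrightarrow> weyl_rep W n s V \<rho> \<and> (\<exists>U \<phi>.
     U \<subseteq> G \<and> module.subspace t U \<and> (\<forall>\<sigma>\<in>weyl W n. \<gamma> \<sigma> ` U \<subseteq> U) \<and>
     linear_map_on t s U \<phi> \<and> \<phi> ` U = V \<and>
     (\<forall>\<sigma>\<in>weyl W n. \<forall>x\<in>U. \<phi> (\<gamma> \<sigma> x) = \<rho> \<sigma> (\<phi> x)))"


section \<open>The free FI_W-algebras\<close>

text \<open>The basis of $V_n = M(\mathbf 0)_n^{\oplus b} \oplus M(\mathbf 1)_n^{\oplus c}$:
  \<open>Yvar j\<close> is the vector $y$ of the $j$-th copy of $M(\mathbf 0)$ and \<open>Xvar j a\<close> is the vector $x_a$ of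
  the $j$-th copy of $M(\mathbf 1)$. These copies sit in degrees \<open>dy j\<close> and \<open>dx j\<close>.\<close>

datatype gen = Yvar nat | Xvar nat int

instance gen :: countable
  by countable_datatype

definition gens :: "family \<Rightarrow> nat \<Rightarrow> nat \<Rightarrow> nat \<Rightarrow> gen set" where
  "gens W b c n = Yvar ` {..<b} \<union> (\<lambda>(j, a). Xvar j a) ` ({..<c} \<times> fiw_obj W n)"

primrec gen_deg :: "(nat \<Rightarrow> nat) \<Rightarrow> (nat \<Rightarrow> nat) \<Rightarrow> gen \<Rightarrow> nat" where
  "gen_deg dy dx (Yvar j) = dy j"
| "gen_deg dy dx (Xvar j a) = dx j"

primrec gen_map :: "(int \<Rightarrow> int) \<Rightarrow> gen \<Rightarrow> gen" where
  "gen_map f (Yvar j) = Yvar j"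
| "gen_map f (Xvar j a) = Xvar j (f a)"

datatype algebra_kind = Symmetric | Exterior | Graded_Commutative

text \<open>All three free algebras are the quotient of the tensor algebra by the relations
  $gh = \varepsilon hg$, where $\varepsilon = -1$ if the generators $g$ and $h$ are both odd and
  $\varepsilon = 1$ otherwise, and $g^2 = 0$ for $g$ odd. The three kinds differ in which
  generators are odd.\<close>

definition odd_gen :: "algebra_kind \<Rightarrow> (gen \<Rightarrow> nat) \<Rightarrow> gen \<Rightarrow> bool" where
  "odd_gen \<kappa> dg g = (case \<kappa> of Symmetric \<Rightarrow> False | Exterior \<Rightarrow> True | Graded_Commutative \<Rightarrow> odd (dg g))"

text \<open>The algebra is modelled on its monomial basis, the words that are sorted (for an arbitrary
  fixed ordering of the generators, here the one given by \<^const>\<open>to_nat\<close>) and contain no odd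
  generator twice. \<open>monomial od w\<close> is the product of an arbitrary word \<open>w\<close> of generators,
  expressed in this basis; \<open>od\<close> tells which generators are odd.\<close>

definition reduced :: "(gen \<Rightarrow> bool) \<Rightarrow> gen list \<Rightarrow> bool" where
  "reduced od w \<longleftrightarrow> distinct (filter od w)"

primrec inversions :: "(gen \<Rightarrow> bool) \<Rightarrow> gen list \<Rightarrow> nat" where
  "inversions od [] = 0"
| "inversions od (g # w) =
     (if od g then length (filter (\<lambda>h. od h \<and> to_nat h < to_nat g) w) else 0) + inversions od w"

definition monomial :: "(gen \<Rightarrow> bool) \<Rightarrow> gen list \<Rightarrow> (gen list \<Rightarrow>\<^sub>0 'k::field)" where
  "monomial od w =
     (if reduced od w then Poly_Mapping.single (sort_key to_nat w) ((- 1) ^ inversions od w) else 0)"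

definition pm_scale :: "'k::field \<Rightarrow> ('i \<Rightarrow>\<^sub>0 'k) \<Rightarrow> ('i \<Rightarrow>\<^sub>0 'k)" where
  "pm_scale r = Poly_Mapping.map ((*) r)"

definition lin_ext :: "('k::field \<Rightarrow> 'a \<Rightarrow> 'a) \<Rightarrow> ('i \<Rightarrow> 'a::ab_group_add) \<Rightarrow> ('i \<Rightarrow>\<^sub>0 'k) \<Rightarrow> 'a" where
  "lin_ext s F a = (\<Sum>w\<in>Poly_Mapping.keys a. s (Poly_Mapping.lookup a w) (F w))"

definition free_fiw_algebra ::
  "family \<Rightarrow> algebra_kind \<Rightarrow> nat \<Rightarrow> nat \<Rightarrow> (nat \<Rightarrow> nat) \<Rightarrow> (nat \<Rightarrow> nat) \<Rightarrow>
     ('k::field, gen list \<Rightarrow>\<^sub>0 'k) fiw_alg" where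
  "free_fiw_algebra W \<kappa> b c dy dx = (let dg = gen_deg dy dx; od = odd_gen \<kappa> dg in
     \<lparr> alg_scale = pm_scale,
       alg_piece = (\<lambda>n d. {a. \<forall>w\<in>Poly_Mapping.keys a. sorted (map to_nat w) \<and> reduced od w \<and>
                          set w \<subseteq> gens W b c n \<and> sum_list (map dg w) = d}),
       alg_mult = (\<lambda>n d e x y. lin_ext pm_scale (\<lambda>u. lin_ext pm_scale (\<lambda>v. monomial od (u @ v)) y) x),
       alg_unit = (\<lambda>n. monomial od []),
       alg_map = (\<lambda>d m n f. lin_ext pm_scale (\<lambda>w. monomial od (map (gen_map f) w))) \<rparr>)"


subsection \<open>Universal property and FI_W-algebra structure\<close>

lemma lookup_pm_scale [simp]:
  "Poly_Mapping.lookup (pm_scale r a) i = r * Poly_Mapping.lookup a i"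
  by (simp add: pm_scale_def Poly_Mapping.map.rep_eq when_def)

lemma vector_space_pm_scale: "vector_space pm_scale"
  by unfold_locales (auto intro!: poly_mapping_eqI simp: lookup_add algebra_simps)

lemma pm_scale_0 [simp]: "pm_scale r 0 = 0"
  by (rule poly_mapping_eqI) simp

lemma pm_scale_1: "pm_scale 1 x = x"
  by (rule poly_mapping_eqI) simp

lemma pm_scale_single [simp]: "pm_scale r (Poly_Mapping.single i x) = Poly_Mapping.single i (r * x)"
  by (rule poly_mapping_eqI) (simp add: lookup_single when_def)

text \<open>\<open>supercomm\<close> says that a function on words respects the defining relations, and
  \<open>supercomm_monomial\<close> that these relations hold in the algebra above. By \<open>lin_ext_monomial\<close>
  every function respecting them factors, necessarily uniquely, through \<^const>\<open>monomial\<close>; this is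
  the universal property of the quotient of the tensor algebra.\<close>

definition supercomm ::
  "('k::field \<Rightarrow> 'a \<Rightarrow> 'a::ab_group_add) \<Rightarrow> (gen \<Rightarrow> bool) \<Rightarrow> (gen list \<Rightarrow> 'a) \<Rightarrow> bool" where
  "supercomm s od F \<longleftrightarrow>
    (\<forall>u v g h. F (u @ g # h # v) = s (if od g \<and> od h then -1 else 1) (F (u @ h # g # v))) \<and>
    (\<forall>u v g. od g \<longrightarrow> F (u @ g # g # v) = 0)"

context
  fixes scale :: "'k::field \<Rightarrow> 'b \<Rightarrow> 'b::ab_group_add"
  assumes vs: "vector_space scale"
begin

interpretation vector_space scale by (rule vs)

lemma lin_ext_superset:
  assumes "finite K" "Poly_Mapping.keys a \<subseteq> K"
  shows "lin_ext scale F a = (\<Sum>w\<in>K. scale (Poly_Mapping.lookup a w) (F w))"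
  unfolding lin_ext_def using assms
  by (intro sum.mono_neutral_left) (auto simp: in_keys_iff)

lemma lin_ext_add: "lin_ext scale F (a + b) = lin_ext scale F a + lin_ext scale F b"
proof -
  let ?K = "Poly_Mapping.keys a \<union> Poly_Mapping.keys b"
  have "Poly_Mapping.keys (a + b) \<subseteq> ?K" by (rule Poly_Mapping.keys_add)
  then show ?thesis
    by (simp add: lin_ext_superset[of ?K] lookup_add scale_left_distrib sum.distrib)
qed

lemma lin_ext_scale: "lin_ext scale F (pm_scale r a) = scale r (lin_ext scale F a)"
proof -
  have "Poly_Mapping.keys (pm_scale r a) \<subseteq> Poly_Mapping.keys a" by (auto simp: in_keys_iff)
  then show ?thesis
    by (simp add: lin_ext_superset[of "Poly_Mapping.keys a"] scale_sum_right)
qed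

lemma lin_ext_0 [simp]: "lin_ext scale F 0 = 0"
  by (simp add: lin_ext_def)

lemma lin_ext_sum: "lin_ext scale F (\<Sum>i\<in>I. a i) = (\<Sum>i\<in>I. lin_ext scale F (a i))"
  by (induction I rule: infinite_finite_induct) (auto simp: lin_ext_add)

lemma lin_ext_single [simp]: "lin_ext scale F (Poly_Mapping.single w r) = scale r (F w)"
  by (cases "r = 0") (auto simp: lin_ext_def)

lemma lin_ext_cong: "(\<And>w. w \<in> Poly_Mapping.keys a \<Longrightarrow> F w = G w) \<Longrightarrow> lin_ext scale F a = lin_ext scale G a"
  by (simp add: lin_ext_def)

lemma supercommD:
  fixes F :: "gen list \<Rightarrow> 'b"
  assumes "supercomm scale od F"
  shows "F (u @ g # h # v) = scale (if od g \<and> od h then -1 else 1) (F (u @ h # g # v))"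
    and "od g \<Longrightarrow> F (u @ g # g # v) = 0"
  using assms[unfolded supercomm_def, THEN conjunct1, THEN spec, THEN spec, THEN spec, THEN spec]
    assms[unfolded supercomm_def, THEN conjunct2, THEN spec, THEN spec, THEN spec, THEN mp] by this+

lemma supercomm_context:
  fixes F :: "gen list \<Rightarrow> 'b"
  assumes "supercomm scale od F"
  shows "supercomm scale od (\<lambda>w. F (u @ w @ v))"
  unfolding supercomm_def
proof (intro conjI allI impI)
  fix u' v' g h
  show "F (u @ (u' @ g # h # v') @ v) = scale (if od g \<and> od h then -1 else 1) (F (u @ (u' @ h # g # v') @ v))"
    using supercommD(1)[OF assms, of "u @ u'" g h "v' @ v"] by simp
next
  fix u' v' g assume "od g"
  then show "F (u @ (u' @ g # g # v') @ v) = 0"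
    using supercommD(2)[OF assms, of g "u @ u'" "v' @ v"] by simp
qed

lemma supercomm_Cons: "supercomm scale od (F :: gen list \<Rightarrow> 'b) \<Longrightarrow> supercomm scale od (\<lambda>w. F (g # w))"
  using supercomm_context[of od F "[g]" "[]"] by simp

lemma supercomm_insort:
  fixes F :: "gen list \<Rightarrow> 'b"
  assumes "supercomm scale od F" "sorted (map to_nat w)"
  shows "F (g # w) = scale ((-1) ^ (if od g then length (filter (\<lambda>h. od h \<and> to_nat h < to_nat g) w) else 0))
     (F (insort_key to_nat g w))"
  using assms
proof (induction w arbitrary: F)
  case Nil then show ?case by simp
next
  case (Cons h w)
  show ?case
  proof (cases "to_nat g \<le> to_nat h")
    case True
    then have "filter (\<lambda>h. od h \<and> to_nat h < to_nat g) (h # w) = []"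
      using Cons.prems by (auto simp: filter_empty_conv)
    with True show ?thesis by simp
  next
    case False
    have "F (g # h # w) = scale (if od g \<and> od h then -1 else 1) (F (h # g # w))"
      using supercommD(1)[OF Cons.prems(1), of "[]" g h w] by simp
    also have "F (h # g # w) = scale ((-1) ^ (if od g then length (filter (\<lambda>h. od h \<and> to_nat h < to_nat g) w) else 0))
       (F (h # insort_key to_nat g w))"
      using Cons.IH[OF supercomm_Cons[OF Cons.prems(1)]] Cons.prems(2) by simp
    finally show ?thesis using False by auto
  qed
qed

lemma supercomm_sort:
  fixes F :: "gen list \<Rightarrow> 'b"
  assumes "supercomm scale od F"
  shows "F w = scale ((-1) ^ inversions od w) (F (sort_key to_nat w))"
  using assms
proof (induction w arbitrary: F)
  case Nil then show ?case by simp
next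
  case (Cons g w)
  have *: "length (filter P (sort_key to_nat w)) = length (filter P w)" for P
    by (metis mset_filter mset_sort size_mset)
  have "F (g # w) = scale ((-1) ^ inversions od w) (F (g # sort_key to_nat w))"
    using Cons.IH[OF supercomm_Cons[OF Cons.prems]] .
  also have "F (g # sort_key to_nat w) =
     scale ((-1) ^ (if od g then length (filter (\<lambda>h. od h \<and> to_nat h < to_nat g) w) else 0))
     (F (insort_key to_nat g (sort_key to_nat w)))"
    using supercomm_insort[OF Cons.prems, of "sort_key to_nat w" g] * by simp
  finally show ?case by (simp add: power_add mult.commute)
qed

lemma supercomm_repeat:
  fixes F :: "gen list \<Rightarrow> 'b"
  assumes "supercomm scale od F" "od g" "g \<in> set w"
  shows "F (g # w) = 0"
  using assms
proof (induction w arbitrary: F)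
  case Nil then show ?case by simp
next
  case (Cons h w)
  show ?case
  proof (cases "h = g")
    case True
    then show ?thesis using supercommD(2)[OF Cons.prems(1,2), of "[]" w] by simp
  next
    case False
    have "F (g # h # w) = scale (if od g \<and> od h then -1 else 1) (F (h # g # w))"
      using supercommD(1)[OF Cons.prems(1), of "[]" g h w] by simp
    also have "F (h # g # w) = 0"
      using Cons.IH[OF supercomm_Cons[OF Cons.prems(1)]] Cons.prems False by simp
    finally show ?thesis by simp
  qed
qed

lemma supercomm_not_reduced:
  fixes F :: "gen list \<Rightarrow> 'b"
  assumes "supercomm scale od F" "\<not> reduced od w"
  shows "F w = 0"
  using assms
proof (induction w arbitrary: F)
  case Nil then show ?case by (simp add: reduced_def)
next
  case (Cons g w)
  show ?case
  proof (cases "reduced od w")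
    case True
    then have "od g" "g \<in> set w" using Cons.prems(2) by (auto simp: reduced_def split: if_splits)
    then show ?thesis by (rule supercomm_repeat[OF Cons.prems(1)])
  next
    case False
    then show ?thesis using Cons.IH[OF supercomm_Cons[OF Cons.prems(1)]] by simp
  qed
qed

lemma lin_ext_monomial:
  fixes F :: "gen list \<Rightarrow> 'b"
  assumes "supercomm scale od F"
  shows "lin_ext scale F (monomial od w) = F w"
proof (cases "reduced od w")
  case True
  then show ?thesis using supercomm_sort[OF assms, of w] by (simp add: monomial_def)
next
  case False
  then show ?thesis using supercomm_not_reduced[OF assms, of w] by (simp add: monomial_def)
qed


lemma lin_ext_lin_ext:
  "lin_ext scale F (lin_ext pm_scale G x) = lin_ext scale (\<lambda>v. lin_ext scale F (G v)) x"
  by (simp add: lin_ext_def[of pm_scale] lin_ext_sum lin_ext_scale)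
     (simp add: lin_ext_def[of scale])

lemma lin_ext_fun_add: "lin_ext scale (\<lambda>u. F u + H u) x = lin_ext scale F x + lin_ext scale H x"
  by (simp add: lin_ext_def sum.distrib scale_right_distrib)

lemma lin_ext_fun_scale: "lin_ext scale (\<lambda>u. scale r (F u)) x = scale r (lin_ext scale F x)"
  by (simp add: lin_ext_def scale_sum_right mult.commute)

lemma supercomm_lin_ext:
  assumes "\<And>v. supercomm scale od (F v)"
  shows "supercomm scale od (\<lambda>u. lin_ext scale (\<lambda>v. F v u) y)"
  unfolding supercomm_def
proof (intro conjI allI impI)
  fix u v g h
  have "F x (u @ g # h # v) = scale (if od g \<and> od h then -1 else 1) (F x (u @ h # g # v))" for x
    using supercommD(1)[OF assms] .
  then show "lin_ext scale (\<lambda>va. F va (u @ g # h # v)) y =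
       scale (if od g \<and> od h then - 1 else 1) (lin_ext scale (\<lambda>va. F va (u @ h # g # v)) y)"
    unfolding lin_ext_def by (simp add: scale_sum_right)
next
  fix u v g assume "od g"
  then show "lin_ext scale (\<lambda>va. F va (u @ g # g # v)) y = 0"
    using supercommD(2)[OF assms] by (simp add: lin_ext_def)
qed

lemma supercomm_map:
  assumes "supercomm scale od F" "\<And>g. od (\<phi> g) = od g"
  shows "supercomm scale od (\<lambda>w. F (map \<phi> w))"
  unfolding supercomm_def
proof (intro conjI allI impI)
  fix u v g h
  show "F (map \<phi> (u @ g # h # v)) = scale (if od g \<and> od h then -1 else 1) (F (map \<phi> (u @ h # g # v)))"
    using supercommD(1)[OF assms(1), of "map \<phi> u" "\<phi> g" "\<phi> h" "map \<phi> v"] assms(2) by simp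
next
  fix u v g assume "od g"
  then show "F (map \<phi> (u @ g # g # v)) = 0"
    using supercommD(2)[OF assms(1), of "\<phi> g" "map \<phi> u" "map \<phi> v"] assms(2) by simp
qed

end

lemma inversions_swap:
  "to_nat g \<noteq> to_nat h \<Longrightarrow> (-1 :: 'k::field) ^ inversions od (u @ g # h # v) =
     (if od g \<and> od h then -1 else 1) * (-1) ^ inversions od (u @ h # g # v)"
  by (induction u) (auto simp: power_add)

lemma sort_key_swap:
  "sort_key to_nat (u @ g # h # v) = sort_key (to_nat :: gen \<Rightarrow> nat) (u @ h # g # v)"
  by (induction u) (cases "g = h", auto intro: insort_key_left_comm)

lemma supercomm_monomial: "supercomm pm_scale od (monomial od)"
  unfolding supercomm_def
proof (intro conjI allI impI)
  fix u v g h
  show "monomial od (u @ g # h # v) =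
       pm_scale (if od g \<and> od h then - 1 else (1::'a)) (monomial od (u @ h # g # v))"
  proof (cases "g = h")
    case False
    moreover have "reduced od (u @ g # h # v) = reduced od (u @ h # g # v)"
      by (auto simp: reduced_def)
    ultimately show ?thesis
      using inversions_swap[of g h od u v, where 'k='a]
      by (auto simp: monomial_def sort_key_swap[of u g h v])
  next
    case True
    then show ?thesis by (auto simp: monomial_def reduced_def)
  qed
qed (auto simp: monomial_def reduced_def)

lemma monomial_normal:
  assumes "sorted (map to_nat w)" "reduced od w"
  shows "monomial od w = Poly_Mapping.single w 1"
proof -
  have "inversions od w = 0" using assms(1)
    by (induction w) (auto simp: filter_empty_conv)
  then show ?thesis using assms by (simp add: monomial_def sort_key_id_if_sorted)
qed

lemma lin_ext_normal:
  assumes "\<And>w. w \<in> Poly_Mapping.keys x \<Longrightarrow> sorted (map to_nat w) \<and> reduced od w"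
  shows "lin_ext pm_scale (monomial od) x = x"
proof (rule poly_mapping_eqI)
  fix k
  have "lin_ext pm_scale (monomial od) x = (\<Sum>w\<in>Poly_Mapping.keys x. Poly_Mapping.single w (Poly_Mapping.lookup x w))"
    unfolding lin_ext_def by (rule sum.cong) (auto simp: monomial_normal assms)
  then show "Poly_Mapping.lookup (lin_ext pm_scale (monomial od) x) k = Poly_Mapping.lookup x k"
    by (simp add: lookup_sum lookup_single when_def in_keys_iff)
qed

context
  fixes W \<kappa> b c dy dx dg od and G :: "('k::field, gen list \<Rightarrow>\<^sub>0 'k) fiw_alg"
  assumes dg_def: "dg = gen_deg dy dx" and od_def: "od = odd_gen \<kappa> dg"
    and G_def: "G = free_fiw_algebra W \<kappa> b c dy dx"
begin

interpretation V: vector_space "pm_scale :: 'k \<Rightarrow> (gen list \<Rightarrow>\<^sub>0 'k) \<Rightarrow> _" by (rule vector_space_pm_scale)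


lemma G_simps:
  "alg_scale G = pm_scale"
  "alg_piece G n d = {a. \<forall>w\<in>Poly_Mapping.keys a. sorted (map to_nat w) \<and> reduced od w \<and>
                          set w \<subseteq> gens W b c n \<and> sum_list (map dg w) = d}"
  "alg_mult G n d e x y = lin_ext pm_scale (\<lambda>u. lin_ext pm_scale (\<lambda>v. monomial od (u @ v)) y) x"
  "alg_unit G n = monomial od []"
  "alg_map G d m n f x = lin_ext pm_scale (\<lambda>w. monomial od (map (gen_map f) w)) x"
  by (simp_all add: G_def free_fiw_algebra_def Let_def od_def dg_def)

lemma dg_map: "dg (gen_map f g) = dg g"
  by (cases g) (simp_all add: dg_def)

lemma od_map: "od (gen_map f g) = od g"
  unfolding od_def odd_gen_def dg_map ..

lemma subspace_G: "V.subspace (alg_piece G n d)"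
  unfolding G_simps
proof (rule V.subspaceI; clarsimp)
  fix x y :: "gen list \<Rightarrow>\<^sub>0 'k" and w
  let ?N = "\<lambda>w. sorted (map to_nat w) \<and> reduced od w \<and> set w \<subseteq> gens W b c n \<and> sum_list (map dg w) = d"
  assume "\<forall>w\<in>Poly_Mapping.keys x. ?N w" "\<forall>w\<in>Poly_Mapping.keys y. ?N w" "w \<in> Poly_Mapping.keys (x + y)"
  then show "?N w" using Poly_Mapping.keys_add[of x y] by blast
next
  fix x :: "gen list \<Rightarrow>\<^sub>0 'k" and w r
  let ?N = "\<lambda>w. sorted (map to_nat w) \<and> reduced od w \<and> set w \<subseteq> gens W b c n \<and> sum_list (map dg w) = d"
  assume "\<forall>w\<in>Poly_Mapping.keys x. ?N w" "w \<in> Poly_Mapping.keys (pm_scale r x)"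
  then show "?N w" by (auto simp: in_keys_iff)
qed

lemma monomial_in_G:
  assumes "set w \<subseteq> gens W b c n" "sum_list (map dg w) = d"
  shows "monomial od w \<in> alg_piece G n d"
proof -
  have "sum_mset (image_mset dg (mset (sort_key to_nat w))) = sum_mset (image_mset dg (mset w))" by simp
  then have 1: "sum_list (map dg (sort_key to_nat w)) = d"
    using assms(2) by (simp only: sum_mset_sum_list flip: mset_map)
  have "mset (filter od (sort_key to_nat w)) = mset (filter od w)" by simp
  then have 2: "reduced od (sort_key to_nat w) = reduced od w"
    unfolding reduced_def by (rule mset_eq_imp_distinct_iff)
  show ?thesis
  proof (cases "reduced od w")
    case True
    then show ?thesis using assms(1) 1 2 by (simp add: G_simps(2) monomial_def)
  next
    case False
    then show ?thesis by (simp add: G_simps(2) monomial_def)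
  qed
qed

lemma lin_ext_in_G:
  assumes "\<And>w. w \<in> Poly_Mapping.keys x \<Longrightarrow> F w \<in> alg_piece G n d"
  shows "lin_ext pm_scale F x \<in> alg_piece G n d"
  unfolding lin_ext_def using assms
  by (intro V.subspace_sum[OF subspace_G]) (simp add: V.subspace_scale[OF subspace_G])

lemmas le_M = lin_ext_monomial[OF vector_space_pm_scale]
lemmas le_le = lin_ext_lin_ext[OF vector_space_pm_scale]
lemmas sc_M = supercomm_monomial

lemma gens_map:
  assumes "f \<in> fiw_hom W m n" "g \<in> gens W b c m"
  shows "gen_map f g \<in> gens W b c n"
  using assms by (cases g) (auto simp: gens_def fiw_hom_def image_iff PiE_def Pi_def)

lemma G_mult_mult:
  "lin_ext pm_scale (\<lambda>u. lin_ext pm_scale (\<lambda>v. monomial od (u @ h v)) z) (monomial od w) =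
     lin_ext pm_scale (\<lambda>v. monomial od (w @ h v)) z"
  by (rule le_M, rule supercomm_lin_ext[OF vector_space_pm_scale])
     (use supercomm_context[OF vector_space_pm_scale sc_M, of od "[]"] in simp)

lemma le_M_left: "lin_ext pm_scale (\<lambda>v. monomial od (u @ v)) (monomial od w) = monomial od (u @ w)"
  using le_M[OF supercomm_context[OF vector_space_pm_scale sc_M, of od u "[]"]] by simp

lemma le_M_map: "lin_ext pm_scale (\<lambda>w. monomial od (map (gen_map f) w)) (monomial od w) = monomial od (map (gen_map f) w)"
  by (rule le_M) (rule supercomm_map[OF vector_space_pm_scale sc_M], rule od_map)

lemma linear_on: "linear_map_on pm_scale pm_scale V (lin_ext pm_scale (F :: _ \<Rightarrow> gen list \<Rightarrow>\<^sub>0 'k))"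
  by (simp add: linear_map_on_def lin_ext_add[OF vector_space_pm_scale] lin_ext_scale[OF vector_space_pm_scale])

lemma le_N: "x \<in> alg_piece G n d \<Longrightarrow> lin_ext pm_scale (monomial od) x = x"
  by (rule lin_ext_normal) (auto simp: G_simps)

lemma fiw_algebra_G: "fiw_algebra W G"
proof (rule fiw_algebra.intro, goal_cases)
  case 1 show ?case by (simp add: G_simps vector_space_pm_scale)
next
  case 2 show ?case
  proof (rule fiw_algebra_axioms.intro, goal_cases)
    case 1 show ?case using subspace_G by (simp add: G_simps(1))
  next
    case (2 x n d y e)
    show ?case unfolding G_simps(3)
      by (rule lin_ext_in_G, rule lin_ext_in_G, rule monomial_in_G) (use 2 in \<open>auto simp: G_simps\<close>)
  next
    case (3 y n e d)
    show ?case unfolding G_simps by (rule linear_on)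
  next
    case (4 x n d e)
    show ?case unfolding G_simps linear_map_on_def
      by (simp add: lin_ext_add[OF vector_space_pm_scale] lin_ext_scale[OF vector_space_pm_scale]
            lin_ext_fun_add[OF vector_space_pm_scale] lin_ext_fun_scale[OF vector_space_pm_scale])
  next
    case (5 x n d y e z k)
    show ?case unfolding G_simps by (simp add: le_le G_mult_mult le_M_left)
  next
    case 6 show ?case unfolding G_simps(4) by (rule monomial_in_G) auto
  next
    case (7 x n d) then show ?case
      using le_N[OF 7] by (simp add: G_simps(3,4) G_mult_mult)
  next
    case (8 x n d) then show ?case
      using le_N[OF 8] by (simp add: G_simps(3,4) le_M_left)
  next
    case (9 f m n x d)
    show ?case unfolding G_simps(5)
      by (rule lin_ext_in_G, rule monomial_in_G)
         (use 9 gens_map[OF 9(1)] in \<open>auto simp: G_simps(2) o_def dg_map subset_iff\<close>)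
  next
    case 10 show ?case unfolding G_simps by (rule linear_on)
  next
    case 11 show ?case unfolding G_simps by (simp add: le_le le_M_map G_mult_mult le_M_left)
  next
    case 12 show ?case unfolding G_simps by (simp add: le_M_map)
  next
    case (13 x n d)
    have "lin_ext pm_scale (\<lambda>w. monomial od (map (gen_map (fiw_id W n)) w)) x = lin_ext pm_scale (monomial od) x"
    proof (rule lin_ext_cong[OF vector_space_pm_scale])
      fix w assume "w \<in> Poly_Mapping.keys x"
      then have "set w \<subseteq> gens W b c n" using 13 by (auto simp: G_simps)
      then have "map (gen_map (fiw_id W n)) w = w"
        by (intro map_idI) (auto simp: gens_def fiw_id_def)
      then show "monomial od (map (gen_map (fiw_id W n)) w) = monomial od w" by simp
    qed
    then show ?case using le_N[OF 13] by (simp add: G_simps(5))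
  next
    case (14 f l m g n x d)
    have "lin_ext pm_scale (\<lambda>w. monomial od (map (gen_map (compose (fiw_obj W l) g f)) w)) x =
        lin_ext pm_scale (\<lambda>w. monomial od (map (gen_map g) (map (gen_map f) w))) x"
    proof (rule lin_ext_cong[OF vector_space_pm_scale])
      fix w assume "w \<in> Poly_Mapping.keys x"
      then have "set w \<subseteq> gens W b c l" using 14 by (auto simp: G_simps)
      then have "map (gen_map (compose (fiw_obj W l) g f)) w = map (gen_map g) (map (gen_map f) w)"
        by (auto simp: gens_def compose_def)
      then show "monomial od (map (gen_map (compose (fiw_obj W l) g f)) w) = monomial od (map (gen_map g) (map (gen_map f) w))"
        by (simp only:)
    qed
    then show ?case by (simp add: G_simps(5) le_le le_M_map)
  qed
qed

end

theorem fiw_algebra_free: "fiw_algebra W (free_fiw_algebra W \<kappa> b c dy dx)"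
  by (rule fiw_algebra_G[OF refl refl refl])


section \<open>Character polynomials and the inner product\<close>

definition cycle_supports :: "family \<Rightarrow> nat \<Rightarrow> (int \<Rightarrow> int) \<Rightarrow> int set set" where
  "cycle_supports W n \<sigma> = orbit \<sigma> ` fiw_obj W n"

text \<open>A positive $r$-cycle $(s_1 \cdots s_r)(\bar s_1 \cdots \bar s_r)$ of $B_n$ is a pair of
  distinct orbits \<open>O\<close>, \<open>-O\<close> of size $r$, and is counted once, through its support; a negative
  $r$-cycle $(s_1 \cdots s_r \bar s_1 \cdots \bar s_r)$ is a single orbit \<open>O = -O\<close> of size $2r$.\<close>

definition pos_cycles :: "family \<Rightarrow> nat \<Rightarrow> nat \<Rightarrow> (int \<Rightarrow> int) \<Rightarrow> nat" where
  "pos_cycles W n r \<sigma> = (case W of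
     TypeA \<Rightarrow> card {S \<in> cycle_supports W n \<sigma>. card S = r}
   | TypeBC \<Rightarrow> card {S \<union> uminus ` S |S. S \<in> cycle_supports W n \<sigma> \<and> uminus ` S \<noteq> S \<and> card S = r})"

definition neg_cycles :: "family \<Rightarrow> nat \<Rightarrow> nat \<Rightarrow> (int \<Rightarrow> int) \<Rightarrow> nat" where
  "neg_cycles W n r \<sigma> = card {S \<in> cycle_supports W n \<sigma>. uminus ` S = S \<and> card S = 2 * r}"

datatype cycle_var = PosCycles nat | NegCycles nat

type_synonym 'k char_poly = "(cycle_var \<Rightarrow>\<^sub>0 nat) \<Rightarrow>\<^sub>0 'k"

definition cycle_vars :: "family \<Rightarrow> cycle_var set" where
  "cycle_vars W = PosCycles ` {1..} \<union> (if W = TypeBC then NegCycles ` {1..} else {})"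

definition is_char_poly :: "family \<Rightarrow> 'k::zero char_poly \<Rightarrow> bool" where
  "is_char_poly W P \<longleftrightarrow> (\<forall>m\<in>Poly_Mapping.keys P. Poly_Mapping.keys m \<subseteq> cycle_vars W)"

primrec cycle_count :: "family \<Rightarrow> nat \<Rightarrow> (int \<Rightarrow> int) \<Rightarrow> cycle_var \<Rightarrow> nat" where
  "cycle_count W n \<sigma> (PosCycles r) = pos_cycles W n r \<sigma>"
| "cycle_count W n \<sigma> (NegCycles r) = neg_cycles W n r \<sigma>"

definition char_poly_eval :: "family \<Rightarrow> 'k::field char_poly \<Rightarrow> nat \<Rightarrow> (int \<Rightarrow> int) \<Rightarrow> 'k" where
  "char_poly_eval W P n \<sigma> = (\<Sum>m\<in>Poly_Mapping.keys P. Poly_Mapping.lookup P m *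
     (\<Prod>v\<in>Poly_Mapping.keys m. of_nat (cycle_count W n \<sigma> v) ^ Poly_Mapping.lookup m v))"

text \<open>The trace of the endomorphism \<open>T\<close> of the finite-dimensional space \<open>V\<close>, computed in an
  arbitrary basis.\<close>

definition trace_on :: "('k::field \<Rightarrow> 'a \<Rightarrow> 'a::ab_group_add) \<Rightarrow> 'a set \<Rightarrow> ('a \<Rightarrow> 'a) \<Rightarrow> 'k" where
  "trace_on s V T = (let B = SOME B. B \<subseteq> V \<and> \<not> module.dependent s B \<and> module.span s B = V
     in \<Sum>e\<in>B. module.representation s B (T e) e)"

definition inner_weyl ::
  "family \<Rightarrow> nat \<Rightarrow> ((int \<Rightarrow> int) \<Rightarrow> complex) \<Rightarrow> ((int \<Rightarrow> int) \<Rightarrow> complex) \<Rightarrow> complex" where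
  "inner_weyl W n \<alpha> \<beta> = (\<Sum>\<sigma>\<in>weyl W n. \<alpha> \<sigma> * cnj (\<beta> \<sigma>)) / of_nat (card (weyl W n))"

text \<open>A subfield $k$ of the complex numbers is a field type together with a (necessarily injective)
  field homomorphism \<open>\<iota>\<close> into \<^typ>\<open>complex\<close>, through which class functions become complex-valued.\<close>

definition field_embedding :: "('k::field \<Rightarrow> complex) \<Rightarrow> bool" where
  "field_embedding \<iota> \<longleftrightarrow> \<iota> 1 = 1 \<and> (\<forall>x y. \<iota> (x + y) = \<iota> x + \<iota> y \<and> \<iota> (x * y) = \<iota> x * \<iota> y)"

definition char_poly_inner ::
  "('k::field \<Rightarrow> complex) \<Rightarrow> family \<Rightarrow> 'k char_poly \<Rightarrow> nat \<Rightarrow>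
     ('k \<Rightarrow> 'a \<Rightarrow> 'a::ab_group_add) \<Rightarrow> 'a set \<Rightarrow> ((int \<Rightarrow> int) \<Rightarrow> 'a \<Rightarrow> 'a) \<Rightarrow> complex" where
  "char_poly_inner \<iota> W P n s V \<rho> =
     inner_weyl W n (\<lambda>\<sigma>. \<iota> (char_poly_eval W P n \<sigma>)) (\<lambda>\<sigma>. \<iota> (trace_on s V (\<rho> \<sigma>)))"

end

theory Submission
  imports Defs
begin

text \<open>
  For \<open>\<tau>\<close> in \<open>W\<^sub>k\<close>, let \<open>N\<^sub>\<tau>(\<sigma>)\<close> be the number of morphisms \<open>f\<close> from \<open>k\<close> to \<open>n\<close> with
  \<open>\<sigma> f = f \<tau>\<close>. Multiplying \<open>N\<^sub>\<tau>\<close> by a cycle count either hits a cycle of \<open>\<tau>\<close> again or appends a new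
  one, so the functions \<open>N\<^sub>\<tau>\<close> span all character polynomials. The inner product of \<open>N\<^sub>\<tau>\<close> with a
  representation \<open>V\<close> of \<open>W\<^sub>n\<close> is the (conjugated) trace of \<open>\<tau>\<close> on the invariants of \<open>V\<close> under
  the pointwise stabiliser \<open>H\<^sub>n\<close> of \<open>k\<close>, and taking these invariants is exact.

  Growth: the invariants of \<open>\<Gamma>\<^sup>d\<^sub>n\<close> are spanned by averages of monomials, one for each \<open>H\<^sub>n\<close>-orbit. Up
  to finitely many factors these orbits are multisets of multidegrees, and comparing with the Euler
  product of \<open>1 / (1 - z\<^sup>m)\<close> bounds their number by \<open>C / z\<^sup>d\<close> for every \<open>z < 1\<close>, uniformly in \<open>n\<close>. As
  \<open>\<tau>\<close> has finite order, the same bound holds for its trace on the invariants of a subquotient.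

  Existence of the limits: including \<open>n\<close> into \<open>n + 1\<close> and averaging maps the \<open>H\<^sub>n\<close>-invariants to the
  \<open>H\<^bsub>n+1\<^esub>\<close>-invariants. On \<open>\<Gamma>\<^sup>d\<close> this multiplies each coefficient by a positive number, so it is
  injective; for submodules of \<open>\<Gamma>\<^sup>d\<close> the dimensions of the invariants are therefore nondecreasing and
  bounded, and the map is eventually bijective. This passes to quotients, so the traces of
  \<open>\<tau>\<close> are eventually constant, and no Noetherianity theorem is needed.
\<close>

section \<open>Traces on finite-dimensional subspaces\<close>

text \<open>The obstacle is uniformity in \<open>n\<close>: the pieces
  \<open>\<Gamma>\<^sup>d\<^sub>n\<close> grow with \<open>n\<close>, so neither their dimensions
  nor traces on them can be bounded directly. Up to the stabiliser, a monomial forgets which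
  positions beyond \<open>k\<close> it occupies, and the dependence on \<open>n\<close> disappears.
  A bound on invariants passes to an equivariant subquotient for each \<open>n\<close> separately,
  which is all that the second claim requires. Existence of limits compares different
  \<open>n\<close> and therefore uses the morphisms of a functorial subquotient.

  Signs are the danger in averaging: with odd generators the average of a single monomial may
  vanish. Injectivity of the averaged inclusion is therefore read off from the coefficients of an
  invariant. There every contribution to a given coefficient is either that coefficient or zero, so
  nothing cancels and in characteristic zero a positive multiple survives.

  The field \<open>k\<close> may lack roots of unity, so the trace bound for an automorphism of
  finite order is first proved over the complex numbers and then transported through a
  matrix.\<close>

locale vspace = vector_space scale
  for scale :: "'a::field \<Rightarrow> 'b::ab_group_add \<Rightarrow> 'b"
begin

definition findim :: "'b set \<Rightarrow> bool" where
  "findim V \<longleftrightarrow> subspace V \<and> (\<exists>B. finite B \<and> V \<subseteq> span B)"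

definition basis_of :: "'b set \<Rightarrow> 'b set \<Rightarrow> bool" where
  "basis_of V B \<longleftrightarrow> B \<subseteq> V \<and> independent B \<and> span B = V"

lemma basis_of_exists:
  assumes "subspace V"
  obtains B where "basis_of V B"
proof -
  obtain B where B: "B \<subseteq> V" "independent B" "V \<subseteq> span B"
    using maximal_independent_subset by blast
  moreover have "span B \<subseteq> V" using B(1) assms by (rule span_minimal)
  ultimately show ?thesis using that unfolding basis_of_def by blast
qed

lemma basis_of_card_le:
  assumes "basis_of V B" "finite S" "V \<subseteq> span S"
  shows "finite B" "card B \<le> card S"
  using assms independent_span_bound[of S B] unfolding basis_of_def by auto

lemma findim_basis_finite: "findim V \<Longrightarrow> basis_of V B \<Longrightarrow> finite B"
  unfolding findim_def using basis_of_card_le(1) by blast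

lemma findim_subspace: "findim V \<Longrightarrow> subspace V"
  by (simp add: findim_def)

lemma findim_subset: "findim V \<Longrightarrow> subspace U \<Longrightarrow> U \<subseteq> V \<Longrightarrow> findim U"
  unfolding findim_def by blast

text \<open>\<open>linear_map_on\<close> says nothing outside \<open>V\<close>. Facts about linear
  maps become applicable after passing to a globally linear map that agrees with \<open>f\<close> on
  \<open>V\<close>, built from a basis of \<open>V\<close>.\<close>

lemma linear_map_on_extend:
  assumes "vspace t" "subspace V" "linear_map_on scale t V f"
  obtains g where "Vector_Spaces.linear scale t g" "\<And>x. x \<in> V \<Longrightarrow> g x = f x"
proof -
  interpret P: vector_space_pair scale t
    by (intro vector_space_pair.intro vector_space_axioms assms(1)[unfolded vspace_def])
  obtain B where B: "basis_of V B" using basis_of_exists[OF assms(2)] .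
  then have B': "independent B" "B \<subseteq> V" "span B = V" by (auto simp: basis_of_def)
  obtain g where g: "Vector_Spaces.linear scale t g" "\<forall>x\<in>B. g x = f x"
    using P.linear_independent_extend[OF B'(1)] by blast
  have f: "f (x + y) = f x + f y" "f (scale r x) = t r (f x)" if "x \<in> V" "y \<in> V" for x y r
    using assms(3) that unfolding linear_map_on_def by auto
  have "f 0 = f 0 + f 0" using f(1)[of 0 0] subspace_0[OF assms(2)] by simp
  then have f0: "f 0 = 0" by simp
  have "x \<in> V \<and> g x = f x" if "x \<in> span B" for x
    using that
  proof (induction rule: span_induct_alt)
    case base
    then show ?case using f0 P.linear_0[OF g(1)] subspace_0[OF assms(2)] by simp
  next
    case (step c x y)
    have "x \<in> V" "scale c x \<in> V" using step B' subspace_scale[OF assms(2)] by auto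
    then show ?case using step f g B' subspace_add[OF assms(2)]
      by (simp add: P.linear_add[OF g(1)] P.linear_scale[OF g(1)])
  qed
  then show ?thesis using that g(1) B'(3) by blast
qed

lemma trace_on_basis: "subspace V \<Longrightarrow> \<exists>B. basis_of V B \<and> trace_on scale V T = (\<Sum>e\<in>B. representation B (T e) e)"
  unfolding trace_on_def Let_def
proof (intro exI conjI)
  assume "subspace V"
  then have "\<exists>B. B \<subseteq> V \<and> independent B \<and> span B = V"
    using basis_of_exists[of V] unfolding basis_of_def by metis
  from someI_ex[OF this] show "basis_of V (SOME B. B \<subseteq> V \<and> independent B \<and> span B = V)"
    unfolding basis_of_def .
qed (rule refl)

text \<open>Both sides expand into the same double sum of products of matrix entries of
  \<open>f\<close> and \<open>g\<close>. With \<open>f\<close> the identity this is independence of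
  the basis. The two spaces may have different types, so traces can be moved between
  representations.\<close>

lemma trace_on_cyclic_basis:
  fixes t :: "'a \<Rightarrow> 'c \<Rightarrow> 'c::ab_group_add"
  assumes vt: "vspace t"
    and B: "basis_of V B" "finite B" and C: "vspace.basis_of t V' C" "finite C"
    and f: "linear_map_on scale t V f" "f ` V \<subseteq> V'" and g: "linear_map_on t scale V' g" "g ` V' \<subseteq> V"
  shows "(\<Sum>e\<in>B. representation B (g (f e)) e) = (\<Sum>c\<in>C. module.representation t C (f (g c)) c)"
proof -
  interpret t: vspace t by (rule vt)
  interpret P: vector_space_pair scale t by unfold_locales
  interpret Q: vector_space_pair t scale by unfold_locales
  note B' = B(1)[unfolded basis_of_def] note C' = C(1)[unfolded t.basis_of_def]
  have sV: "subspace V" "t.subspace V'" using subspace_span[of B] t.subspace_span[of C] B' C' by simp_all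
  obtain f' where f': "Vector_Spaces.linear scale t f'" "\<And>x. x \<in> V \<Longrightarrow> f' x = f x"
    using linear_map_on_extend[OF vt sV(1) f(1)] by metis
  obtain g' where g': "Vector_Spaces.linear t scale g'" "\<And>x. x \<in> V' \<Longrightarrow> g' x = g x"
    using t.linear_map_on_extend[OF vspace_axioms sV(2) g(1)] by metis
  have 1: "representation B (g (f e)) e = (\<Sum>c\<in>C. t.representation C (f e) c * representation B (g c) e)"
    if e: "e \<in> B" for e
  proof -
    have fe: "f e \<in> V'" using e B' f(2) by auto
    have "f e = (\<Sum>c\<in>C. t (t.representation C (f e) c) c)"
      using t.sum_representation_eq[of C "f e" C] C' C(2) fe by auto
    then have "g (f e) = g' (\<Sum>c\<in>C. t (t.representation C (f e) c) c)" using g'(2)[OF fe] by simp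
    also have "\<dots> = (\<Sum>c\<in>C. scale (t.representation C (f e) c) (g c))"
      using C' g'(2) by (auto simp: Q.linear_sum[OF g'(1)] Q.linear_scale[OF g'(1)] intro!: sum.cong)
    moreover have "g c \<in> span B" if "c \<in> C" for c using that C' B' g(2) by auto
    ultimately show ?thesis using B'[THEN conjunct2, THEN conjunct1]
      by (simp add: representation_sum representation_scale span_scale)
  qed
  have 2: "t.representation C (f (g c)) c = (\<Sum>e\<in>B. representation B (g c) e * t.representation C (f e) c)"
    if c: "c \<in> C" for c
  proof -
    have ge: "g c \<in> V" using c C' g(2) by auto
    have "g c = (\<Sum>e\<in>B. scale (representation B (g c) e) e)"
      using sum_representation_eq[of B "g c" B] B' B(2) ge by auto
    then have "f (g c) = f' (\<Sum>e\<in>B. scale (representation B (g c) e) e)" using f'(2)[OF ge] by simp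
    also have "\<dots> = (\<Sum>e\<in>B. t (representation B (g c) e) (f e))"
      using B' f'(2) by (auto simp: P.linear_sum[OF f'(1)] P.linear_scale[OF f'(1)] intro!: sum.cong)
    moreover have "f e \<in> t.span C" if "e \<in> B" for e using that C' B' f(2) by auto
    ultimately show ?thesis using C'[THEN conjunct2, THEN conjunct1]
      by (simp add: t.representation_sum t.representation_scale t.span_scale)
  qed
  show ?thesis
    using sum.swap[of "\<lambda>e c. t.representation C (f e) c * representation B (g c) e" C B]
    by (simp add: 1 2 mult.commute)
qed

lemma trace_on_cong: 
  assumes "subspace V" "\<And>x. x \<in> V \<Longrightarrow> T x = T' x"
  shows "trace_on scale V T = trace_on scale V T'"
proof -
  define B where "B = (SOME B. B \<subseteq> V \<and> independent B \<and> span B = V)"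
  have "\<exists>B. B \<subseteq> V \<and> independent B \<and> span B = V"
    using basis_of_exists[OF assms(1)] unfolding basis_of_def by metis
  from someI_ex[OF this] have "B \<subseteq> V" unfolding B_def by simp
  then show ?thesis
    unfolding trace_on_def Let_def B_def[symmetric] using assms(2) by (auto intro!: sum.cong)
qed

lemma trace_on_cyclic:
  fixes t :: "'a \<Rightarrow> 'c \<Rightarrow> 'c::ab_group_add"
  assumes vt: "vspace t" and V: "findim V" and V': "vspace.findim t V'"
    and f: "linear_map_on scale t V f" "f ` V \<subseteq> V'" and g: "linear_map_on t scale V' g" "g ` V' \<subseteq> V"
  shows "trace_on scale V (\<lambda>x. g (f x)) = trace_on t V' (\<lambda>x. f (g x))"
proof -
  interpret t: vspace t by (rule vt)
  obtain B where B: "basis_of V B" "trace_on scale V (\<lambda>x. g (f x)) = (\<Sum>e\<in>B. representation B (g (f e)) e)"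
    using trace_on_basis[OF findim_subspace[OF V], of "\<lambda>x. g (f x)"] by auto
  obtain C where C: "t.basis_of V' C" "trace_on t V' (\<lambda>x. f (g x)) = (\<Sum>e\<in>C. t.representation C (f (g e)) e)"
    using t.trace_on_basis[OF t.findim_subspace[OF V'], of "\<lambda>x. f (g x)"] by blast
  show ?thesis
    using trace_on_cyclic_basis[OF vt B(1) findim_basis_finite[OF V B(1)] C(1) t.findim_basis_finite[OF V' C(1)] f g]
      B(2) C(2) by simp
qed

lemma linear_map_on_id: "linear_map_on scale scale V (\<lambda>x. x)"
  by (simp add: linear_map_on_def)

lemma trace_on_eq:
  assumes "findim V" "basis_of V B" "linear_map_on scale scale V T" "T ` V \<subseteq> V"
  shows "trace_on scale V T = (\<Sum>e\<in>B. representation B (T e) e)"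
proof -
  obtain C where C: "basis_of V C" "trace_on scale V T = (\<Sum>e\<in>C. representation C (T e) e)"
    using trace_on_basis[OF findim_subspace[OF assms(1)], of T] by blast
  show ?thesis unfolding C(2)
    using trace_on_cyclic_basis[OF vspace_axioms C(1) findim_basis_finite[OF assms(1) C(1)]
       assms(2) findim_basis_finite[OF assms(1,2)] linear_map_on_id _ assms(3,4)] by simp
qed

lemma trace_on_id:
  assumes "findim V" "basis_of V B" shows "trace_on scale V (\<lambda>x. x) = of_nat (card B)"
  using trace_on_eq[OF assms linear_map_on_id] assms(2)
  by (auto simp: basis_of_def representation_basis subset_iff)

lemma trace_on_sum:
  assumes V: "findim V" and "\<And>i. i \<in> I \<Longrightarrow> linear_map_on scale scale V (T i)" "\<And>i. i \<in> I \<Longrightarrow> T i ` V \<subseteq> V"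
  shows "trace_on scale V (\<lambda>x. \<Sum>i\<in>I. scale (c i) (T i x)) = (\<Sum>i\<in>I. c i * trace_on scale V (T i))"
proof -
  have sV: "subspace V" using V by (rule findim_subspace)
  obtain B where B: "basis_of V B" using basis_of_exists[OF sV] .
  then have B': "independent B" "B \<subseteq> V" "span B = V" by (auto simp: basis_of_def)
  have in_V: "T i x \<in> V" if "i \<in> I" "x \<in> V" for i x using that assms(3) by auto
  have 1: "linear_map_on scale scale V (\<lambda>x. \<Sum>i\<in>I. scale (c i) (T i x))"
    using assms(2) unfolding linear_map_on_def
    by (auto simp: scale_right_distrib sum.distrib scale_sum_right mult.commute)
  have 2: "(\<lambda>x. \<Sum>i\<in>I. scale (c i) (T i x)) ` V \<subseteq> V"
    using in_V by (auto intro!: subspace_sum[OF sV] subspace_scale[OF sV])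
  have "representation B (\<Sum>i\<in>I. scale (c i) (T i e)) e = (\<Sum>i\<in>I. c i * representation B (T i e) e)" if "e \<in> B" for e
  proof -
    have "T i e \<in> span B" if "i \<in> I" for i using in_V that \<open>e \<in> B\<close> B' by auto
    then show ?thesis using B'(1) by (simp add: representation_sum representation_scale span_scale)
  qed
  then have "trace_on scale V (\<lambda>x. \<Sum>i\<in>I. scale (c i) (T i x)) = (\<Sum>e\<in>B. \<Sum>i\<in>I. c i * representation B (T i e) e)"
    unfolding trace_on_eq[OF V B 1 2] by (rule sum.cong[OF refl])
  also have "\<dots> = (\<Sum>i\<in>I. c i * (\<Sum>e\<in>B. representation B (T i e) e))"
    by (subst sum.swap) (simp add: sum_distrib_left)
  also have "\<dots> = (\<Sum>i\<in>I. c i * trace_on scale V (T i))"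
    using trace_on_eq[OF V B] assms by simp
  finally show ?thesis .
qed

text \<open>\<open>E\<close> factors through its image, on which it is the identity. Cyclicity moves
  the trace there, where it becomes a dimension.\<close>

lemma trace_on_idempotent:
  assumes V: "findim V" and E: "linear_map_on scale scale V E" "E ` V \<subseteq> V" and "\<And>x. x \<in> V \<Longrightarrow> E (E x) = E x"
  shows "\<exists>m::nat. trace_on scale V E = of_nat m"
proof -
  have sV: "subspace V" using V by (rule findim_subspace)
  obtain E' where E': "Vector_Spaces.linear scale scale E'" "\<And>x. x \<in> V \<Longrightarrow> E' x = E x"
    using linear_map_on_extend[OF vspace_axioms sV E(1)] by metis
  interpret P: vector_space_pair scale scale by unfold_locales
  have "E ` V = E' ` V" using E'(2) by auto
  then have "subspace (E ` V)" using P.linear_subspace_image[OF E'(1) sV] by simp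
  then have fE: "findim (E ` V)" using findim_subset[OF V] E(2) by blast
  obtain C where C: "basis_of (E ` V) C" using basis_of_exists[OF findim_subspace[OF fE]] .
  have "trace_on scale V E = trace_on scale (E ` V) E"
    using trace_on_cyclic[OF vspace_axioms V fE E(1) _ linear_map_on_id] E(2) by auto
  also have "\<dots> = trace_on scale (E ` V) (\<lambda>x. x)"
    by (rule trace_on_cong[OF findim_subspace[OF fE]]) (use assms(4) in auto)
  finally show ?thesis using trace_on_id[OF fE C] by auto
qed

end

section \<open>Traces of automorphisms of finite order\<close>

lemma linear_map_on_funpow:
  assumes "linear_map_on s s V T" "T ` V \<subseteq> V"
  shows "linear_map_on s s V (T ^^ i) \<and> (T ^^ i) ` V \<subseteq> V"
proof (induction i)
  case 0
  then show ?case by (simp add: linear_map_on_def)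
next
  case (Suc i)
  then have "(T ^^ i) x \<in> V" if "x \<in> V" for x using that by auto
  then show ?case using Suc assms unfolding linear_map_on_def by auto
qed

text \<open>Averaging the powers of \<open>T\<close> against the characters of a cyclic group gives
  projections \<open>E m\<close> onto the eigenspaces. Their traces are the multiplicities of the
  eigenvalues, and Fourier inversion writes the trace of \<open>T\<close> as a sum of
  \<open>card B\<close> roots of unity.\<close>

lemma norm_trace_on_finite_order_complex:
  fixes scale :: "complex \<Rightarrow> 'b::ab_group_add \<Rightarrow> 'b"
  assumes "vspace scale" and V: "vspace.findim scale V" and B: "vspace.basis_of scale V B"
    and T: "linear_map_on scale scale V T" "T ` V \<subseteq> V" and N: "N > 0" "\<And>x. x \<in> V \<Longrightarrow> (T ^^ N) x = x"
  shows "norm (trace_on scale V T) \<le> card B"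
proof -
  interpret vspace scale by fact
  \<comment> \<open>Doubling ensures \<open>1 < M\<close> even for \<open>N = 1\<close>, so that the
    inversion formula \<open>dft\<close> covers the exponent 1.\<close>
  define M where "M = 2 * N"
  have M: "M > 1" using N(1) by (simp add: M_def)
  have TM: "(T ^^ M) x = x" if "x \<in> V" for x
    using N(2) that by (simp add: M_def mult_2 funpow_add)
  define \<zeta> where "\<zeta> = cis (2 * pi / M)"
  have \<zeta>pow: "\<zeta> ^ i = cis (2 * pi * i / M)" for i by (simp add: \<zeta>_def DeMoivre mult_ac)
  have \<zeta>M: "\<zeta> ^ M = 1" using M by (simp add: \<zeta>pow)
  have inj: "inj_on (\<lambda>i. \<zeta> ^ i) {..<M}"
    using bij_betw_roots_unity[of M] M by (simp add: \<zeta>pow bij_betw_def)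
  have \<zeta>0: "\<zeta> \<noteq> 0" by (simp add: \<zeta>_def)
  define t where "t i = trace_on scale V (T ^^ i)" for i
  define E where "E m x = (\<Sum>i<M. scale (inverse \<zeta> ^ (m * i) / M) ((T ^^ i) x))" for m x
  note Ti = linear_map_on_funpow[OF T]
  have sV: "subspace V" using V by (rule findim_subspace)
  have TiV: "(T ^^ i) x \<in> V" if "x \<in> V" for i x using Ti that by auto
  have trE: "trace_on scale V (E m) = (\<Sum>i<M. inverse \<zeta> ^ (m * i) / M * t i)" for m
    unfolding E_def t_def using Ti by (intro trace_on_sum[OF V]) auto
  have EV: "E m x \<in> V" if "x \<in> V" for m x
    unfolding E_def using that TiV by (auto intro!: subspace_sum[OF sV] subspace_scale[OF sV])
  have Elin: "linear_map_on scale scale V (E m)" for m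
    unfolding linear_map_on_def
  proof (intro conjI ballI allI)
    show "E m (x + y) = E m x + E m y" if "x \<in> V" "y \<in> V" for x y
      using Ti that by (simp add: E_def linear_map_on_def scale_right_distrib sum.distrib)
    show "E m (scale r x) = scale r (E m x)" if "x \<in> V" for x r
      using Ti that by (simp add: E_def linear_map_on_def scale_sum_right mult.commute)
  qed
  obtain T' where T': "Vector_Spaces.linear scale scale T'" "\<And>x. x \<in> V \<Longrightarrow> T' x = T x"
    using linear_map_on_extend[OF vspace_axioms sV T(1)] by metis
  interpret P: vector_space_pair scale scale by unfold_locales
  have TE: "T (E m x) = scale (\<zeta> ^ m) (E m x)" if x: "x \<in> V" for m x
  proof -
    define f where "f i = scale (inverse \<zeta> ^ (m * i) / M) ((T ^^ i) x)" for i
    have "T (E m x) = (\<Sum>i<M. scale (inverse \<zeta> ^ (m * i) / M) ((T ^^ Suc i) x))"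
      using T'(2)[OF EV[OF x]] T'(2)[OF TiV[OF x]]
      by (simp add: E_def P.linear_sum[OF T'(1)] P.linear_scale[OF T'(1)])
    also have "\<dots> = (\<Sum>i<M. scale (\<zeta> ^ m) (f (Suc i)))"
      using \<zeta>0 by (intro sum.cong) (simp_all add: f_def power_add power_inverse field_simps)
    also have "\<dots> = scale (\<zeta> ^ m) (\<Sum>i<M. f (Suc i))" by (simp add: scale_sum_right)
    \<comment> \<open>The index shift is cyclic, because the \<open>M\<close>-th powers of both
      \<open>\<zeta>\<close> and \<open>T\<close> are trivial.\<close>
    also have "(\<Sum>i<M. f (Suc i)) = (\<Sum>i<M. f i)"
    proof -
      have "inverse \<zeta> ^ (m * M) = 1" using \<zeta>M
        by (metis inverse_1 mult.commute power_inverse power_mult power_one)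
      then have "f M = f 0" using TM[OF x] by (simp add: f_def)
      moreover have "(\<Sum>i<M. f (Suc i)) + f 0 = (\<Sum>i<M. f i) + f M"
        using sum.lessThan_Suc[of f M] sum.lessThan_Suc_shift[of f M] by (simp add: add.commute)
      ultimately show ?thesis by simp
    qed
    finally show ?thesis by (simp add: E_def f_def)
  qed
  have TiE: "(T ^^ i) (E m x) = scale (\<zeta> ^ (m * i)) (E m x)" if x: "x \<in> V" for m x i
  proof (induction i)
    case (Suc i)
    have "(T ^^ Suc i) (E m x) = T' (scale (\<zeta> ^ (m * i)) (E m x))"
      using Suc T'(2)[of "scale (\<zeta> ^ (m * i)) (E m x)"] EV[OF x] subspace_scale[OF sV] by simp
    then show ?case using T'(2) TE[OF x] EV[OF x]
      by (simp add: P.linear_scale[OF T'(1)] power_add mult.commute)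
  qed simp
  have idem: "E m (E m x) = E m x" if x: "x \<in> V" for m x
  proof -
    have "E m (E m x) = (\<Sum>i<M. scale (1 / M) (E m x))"
      unfolding E_def[of m "E m x"] using TiE[OF x] \<zeta>0 by (simp add: power_inverse)
    also have "\<dots> = E m x" using M by (simp flip: scale_sum_left)
    finally show ?thesis .
  qed
  have "\<exists>p::nat. trace_on scale V (E m) = of_nat p" for m
    by (rule trace_on_idempotent[OF V Elin _ idem]) (use EV in auto)
  then obtain p :: "nat \<Rightarrow> nat" where p: "trace_on scale V (E m) = of_nat (p m)" for m by metis
  have dft: "t j = (\<Sum>m<M. (\<zeta> ^ j) ^ m * of_nat (p m))" if j: "j < M" for j
  proof -
    have geo: "(\<Sum>m<M. (\<zeta> ^ j * inverse \<zeta> ^ i) ^ m) = (if i = j then of_nat M else 0)" if "i < M" for i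
    proof (cases "i = j")
      case False
      then have "\<zeta> ^ j \<noteq> \<zeta> ^ i" using inj that j by (auto simp: inj_on_def)
      then have "\<zeta> ^ j * inverse \<zeta> ^ i \<noteq> 1" using \<zeta>0 by (simp add: field_simps)
      moreover have "(\<zeta> ^ j * inverse \<zeta> ^ i) ^ M = 1" 
        by (metis \<zeta>M inverse_1 mult_1 power_commutes power_inverse power_mult power_mult_distrib power_one mult.commute)
      ultimately show ?thesis using False by (simp add: sum_gp_strict)
    qed (use \<zeta>0 in \<open>simp add: power_inverse\<close>)
    have "(\<Sum>m<M. (\<zeta> ^ j) ^ m * of_nat (p m)) = (\<Sum>m<M. \<Sum>i<M. (\<zeta> ^ j * inverse \<zeta> ^ i) ^ m * (t i / M))"
      using trE p by (simp add: sum_distrib_left power_mult_distrib mult_ac flip: power_mult)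
    also have "\<dots> = (\<Sum>i<M. (\<Sum>m<M. (\<zeta> ^ j * inverse \<zeta> ^ i) ^ m) * (t i / M))"
      by (subst sum.swap) (simp only: sum_distrib_right)
    also have "\<dots> = (\<Sum>i<M. if i = j then t i else 0)"
      using geo M by (intro sum.cong) auto
    also have "\<dots> = t j" using j by simp
    finally show ?thesis by simp
  qed
  \<comment> \<open>At exponent 0 the inversion formula counts the eigenvalues, at exponent 1 it
    adds them up.\<close>
  have "t 0 = of_nat (card B)"
  proof -
    have "(T ^^ 0) = (\<lambda>x. x)" by (simp add: id_def)
    then show ?thesis unfolding t_def using trace_on_id[OF V B] by simp
  qed
  then have "(of_nat (card B) :: complex) = of_nat (\<Sum>m<M. p m)" using dft[of 0] M by simp
  then have card: "card B = (\<Sum>m<M. p m)" by (simp only: of_nat_eq_iff)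
  have "norm (t 1) \<le> (\<Sum>m<M. norm ((\<zeta> ^ 1) ^ m * of_nat (p m)))"
    using dft[of 1] M norm_sum by metis
  also have "\<dots> = real (card B)" unfolding card by (simp add: norm_mult norm_power \<zeta>_def)
  finally show ?thesis by (simp add: t_def)
qed

lemma field_embedding_simps:
  assumes "field_embedding (\<iota> :: 'k::field \<Rightarrow> complex)"
  shows "\<iota> (x + y) = \<iota> x + \<iota> y" "\<iota> (x * y) = \<iota> x * \<iota> y" "\<iota> 1 = 1" "\<iota> 0 = 0" "\<iota> (sum f I) = (\<Sum>i\<in>I. \<iota> (f i))"
    "\<iota> (of_nat m) = of_nat m" "\<iota> (prod f I) = (\<Prod>i\<in>I. \<iota> (f i))" "\<iota> (x ^ m) = \<iota> x ^ m"
proof -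
  have 1: "\<iota> (x + y) = \<iota> x + \<iota> y" "\<iota> (x * y) = \<iota> x * \<iota> y" "\<iota> 1 = 1" for x y
    using assms by (auto simp: field_embedding_def)
  have 0: "\<iota> 0 = 0" using 1(1)[of 0 0] by simp
  show "\<iota> (x + y) = \<iota> x + \<iota> y" "\<iota> (x * y) = \<iota> x * \<iota> y" "\<iota> 1 = 1" "\<iota> 0 = 0" by fact+
  show "\<iota> (sum f I) = (\<Sum>i\<in>I. \<iota> (f i))" by (induction I rule: infinite_finite_induct) (simp_all add: 0 1)
  show "\<iota> (prod f I) = (\<Prod>i\<in>I. \<iota> (f i))" by (induction I rule: infinite_finite_induct) (simp_all add: 0 1)
  show "\<iota> (of_nat m) = of_nat m" by (induction m) (simp_all add: 0 1)
  show "\<iota> (x ^ m) = \<iota> x ^ m" by (induction m) (simp_all add: 0 1)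
qed

text \<open>The field inherits characteristic zero from the complex numbers. Averaging divides by
  orders of stabilisers, and injectivity of the steps rests on a positive integer being
  nonzero.\<close>

lemma field_embedding_of_nat_neq_0:
  assumes "field_embedding (\<iota> :: 'k::field \<Rightarrow> complex)" "m > 0"
  shows "of_nat m \<noteq> (0::'k)"
  using field_embedding_simps(4,6)[OF assms(1)] assms(2) by (metis of_nat_eq_0_iff less_numeral_extra(3))

context vspace
begin

text \<open>The bound is obtained by extending scalars to \<^typ>\<open>complex\<close>, where the complexification of
  the span of \<open>B\<close> is modelled by finitely supported functions on \<open>B\<close>.\<close>

lemma norm_trace_on_finite_order:
  fixes \<iota> :: "'a \<Rightarrow> complex"
  assumes \<iota>: "field_embedding \<iota>" and V: "findim V" and B: "basis_of V B"
    and T: "linear_map_on scale scale V T" "T ` V \<subseteq> V" and N: "N > 0" "\<And>x. x \<in> V \<Longrightarrow> (T ^^ N) x = x"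
  shows "norm (\<iota> (trace_on scale V T)) \<le> card B"
proof -
  interpret C: vspace "pm_scale :: complex \<Rightarrow> ('b \<Rightarrow>\<^sub>0 complex) \<Rightarrow> _"
    by (simp add: vspace_def vector_space_pm_scale)
  interpret P: vector_space_pair "pm_scale :: complex \<Rightarrow> ('b \<Rightarrow>\<^sub>0 complex) \<Rightarrow> _" "pm_scale :: complex \<Rightarrow> ('b \<Rightarrow>\<^sub>0 complex) \<Rightarrow> _"
    by unfold_locales
  note \<iota>s = field_embedding_simps[OF \<iota>]
  have finB: "finite B" using findim_basis_finite[OF V B] .
  have B': "B \<subseteq> V" "independent B" "span B = V" using B by (auto simp: basis_of_def)
  have sV: "subspace V" using V by (rule findim_subspace)
  obtain T' where T': "Vector_Spaces.linear scale scale T'" "\<And>x. x \<in> V \<Longrightarrow> T' x = T x"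
    using linear_map_on_extend[OF vspace_axioms sV T(1)] by metis
  interpret Q: vector_space_pair scale scale by unfold_locales
  define s :: "'b \<Rightarrow> ('b \<Rightarrow>\<^sub>0 complex)" where "s e = Poly_Mapping.single e 1" for e
  \<comment> \<open>\<open>\<kappa>\<close> takes coordinates with respect to \<open>B\<close> and
    applies \<open>\<iota>\<close> to them. Correspondingly \<open>TC\<close> is the matrix of
    \<open>T\<close> with \<open>\<iota>\<close> applied to its entries.\<close>
  define \<kappa> where "\<kappa> x = (\<Sum>e\<in>B. Poly_Mapping.single e (\<iota> (representation B x e)))" for x
  define VC where "VC = {x :: 'b \<Rightarrow>\<^sub>0 complex. Poly_Mapping.keys x \<subseteq> B}"
  define TC where "TC = lin_ext pm_scale (\<lambda>e. \<kappa> (T e))"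
  have lookup_\<kappa>: "Poly_Mapping.lookup (\<kappa> x) e = (if e \<in> B then \<iota> (representation B x e) else 0)" for x e
    using finB by (auto simp: \<kappa>_def lookup_sum lookup_single when_def)
  have \<kappa>VC: "\<kappa> x \<in> VC" for x
    by (auto simp: VC_def in_keys_iff lookup_\<kappa> split: if_splits)
  have \<kappa>_sum: "\<kappa> (\<Sum>e\<in>B. scale (c e) (f e)) = (\<Sum>e\<in>B. pm_scale (\<iota> (c e)) (\<kappa> (f e)))" if "\<And>e. e \<in> B \<Longrightarrow> f e \<in> V" for c f
  proof (rule poly_mapping_eqI)
    fix b
    have "\<And>e. e \<in> B \<Longrightarrow> f e \<in> span B" using that B'(3) by simp
    then show "Poly_Mapping.lookup (\<kappa> (\<Sum>e\<in>B. scale (c e) (f e))) b =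
       Poly_Mapping.lookup (\<Sum>e\<in>B. pm_scale (\<iota> (c e)) (\<kappa> (f e))) b"
      using B'(2) by (simp add: lookup_\<kappa> lookup_sum representation_sum representation_scale span_scale \<iota>s)
  qed
  have TCadd: "TC (x + y) = TC x + TC y" and TCscale: "TC (pm_scale r x) = pm_scale r (TC x)" for x y r
    unfolding TC_def by (simp_all add: lin_ext_add lin_ext_scale vector_space_pm_scale)
  have TClin: "linear_map_on pm_scale pm_scale VC TC"
    by (simp add: linear_map_on_def TCadd TCscale)
  have sVC: "C.subspace VC"
    unfolding VC_def
  proof (rule C.subspaceI)
    fix x y :: "'b \<Rightarrow>\<^sub>0 complex"
    assume "x \<in> {x. Poly_Mapping.keys x \<subseteq> B}" "y \<in> {x. Poly_Mapping.keys x \<subseteq> B}"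
    then show "x + y \<in> {x. Poly_Mapping.keys x \<subseteq> B}" using Poly_Mapping.keys_add[of x y] by blast
  qed (auto simp: in_keys_iff subset_iff)
  have TCVC: "TC x \<in> VC" for x
    unfolding TC_def lin_ext_def using \<kappa>VC
    by (intro C.subspace_sum[OF sVC] C.subspace_scale[OF sVC]) auto
  have expand: "x = (\<Sum>e\<in>B. pm_scale (Poly_Mapping.lookup x e) (s e))" if "x \<in> VC" for x
  proof (rule poly_mapping_eqI)
    fix b show "Poly_Mapping.lookup x b = Poly_Mapping.lookup (\<Sum>e\<in>B. pm_scale (Poly_Mapping.lookup x e) (s e)) b"
      using that finB by (auto simp: VC_def s_def lookup_sum lookup_single when_def in_keys_iff)
  qed
  have inj_s: "inj s" by (auto simp: inj_def s_def intro: ccontr) (metis lookup_single_eq lookup_single_not_eq zero_neq_one)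
  have ind: "C.independent (s ` B)"
  proof (rule C.independent_if_scalars_zero)
    show "finite (s ` B)" using finB by simp
    fix f x assume 0: "(\<Sum>x\<in>s ` B. pm_scale (f x) x) = 0" and "x \<in> s ` B"
    then obtain e where e: "e \<in> B" "x = s e" by auto
    have "(\<Sum>x\<in>s ` B. pm_scale (f x) x) = (\<Sum>e\<in>B. pm_scale (f (s e)) (s e))"
      by (simp add: sum.reindex[OF inj_on_subset[OF inj_s]])
    then have "Poly_Mapping.lookup (\<Sum>e\<in>B. pm_scale (f (s e)) (s e)) e = 0" using 0 by simp
    then show "f x = 0" using e finB by (auto simp: s_def lookup_sum lookup_single when_def)
  qed
  have basC: "C.basis_of VC (s ` B)"
    unfolding C.basis_of_def
  proof (intro conjI ind equalityI)
    show "s ` B \<subseteq> VC" by (auto simp: s_def VC_def)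
    then show "C.span (s ` B) \<subseteq> VC" by (rule C.span_minimal[OF _ sVC])
    show "VC \<subseteq> C.span (s ` B)"
    proof
      fix x assume "x \<in> VC"
      from expand[OF this] show "x \<in> C.span (s ` B)"
        by (metis (no_types, lifting) C.span_base C.span_scale C.span_sum image_eqI)
    qed
  qed
  have VC: "C.findim VC"
    using finB sVC basC unfolding C.findim_def C.basis_of_def by blast
  have rep: "C.representation (s ` B) x (s e) = Poly_Mapping.lookup x e" if "x \<in> VC" "e \<in> B" for x e
  proof -
    have "C.representation (s ` B) (\<Sum>e\<in>B. pm_scale (Poly_Mapping.lookup x e) (s e)) (s e) =
       (\<Sum>b\<in>B. Poly_Mapping.lookup x b * (if s b = s e then 1 else 0))"
      using ind by (simp add: C.representation_sum C.representation_scale C.span_base C.span_scale C.representation_basis eq_commute[of "s e"] cong: if_cong)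
    also have "\<dots> = Poly_Mapping.lookup x e"
      using that finB inj_s by (simp add: inj_eq if_distrib[of "(*) _"] cong: if_cong)
    finally show ?thesis using expand[OF that(1)] by simp
  qed
  have TCs: "TC (s e) = \<kappa> (T e)" for e
    by (simp add: TC_def s_def lin_ext_single[OF vector_space_pm_scale] pm_scale_1)
  have "trace_on pm_scale VC TC = (\<Sum>e\<in>B. C.representation (s ` B) (TC (s e)) (s e))"
    using C.trace_on_eq[OF VC basC TClin] TCVC
    by (simp add: image_subset_iff sum.reindex[OF inj_on_subset[OF inj_s]])
  also have "\<dots> = (\<Sum>e\<in>B. \<iota> (representation B (T e) e))"
    using rep[OF \<kappa>VC] by (intro sum.cong) (simp_all add: TCs lookup_\<kappa>)
  also have "\<dots> = \<iota> (trace_on scale V T)"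
    using trace_on_eq[OF V B T] by (simp add: \<iota>s)
  finally have tr: "trace_on pm_scale VC TC = \<iota> (trace_on scale V T)" .
  \<comment> \<open>\<open>\<kappa>\<close> intertwines \<open>T\<close> with \<open>TC\<close>, and
    the images of the basis vectors form a basis of \<open>VC\<close>, so the finite order of
    \<open>T\<close> is inherited by \<open>TC\<close>.\<close>
  have TC\<kappa>: "TC (\<kappa> x) = \<kappa> (T x)" if x: "x \<in> V" for x
  proof -
    have "TC (\<kappa> x) = (\<Sum>e\<in>B. pm_scale (\<iota> (representation B x e)) (\<kappa> (T e)))"
      unfolding TC_def \<kappa>_def[of x]
      by (simp add: lin_ext_sum[OF vector_space_pm_scale] lin_ext_single[OF vector_space_pm_scale])
    also have "\<dots> = \<kappa> (\<Sum>e\<in>B. scale (representation B x e) (T e))"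
      by (rule \<kappa>_sum[symmetric]) (use T(2) B'(1) in auto)
    also have "(\<Sum>e\<in>B. scale (representation B x e) (T e)) = T' (\<Sum>e\<in>B. scale (representation B x e) e)"
      using B'(1) T'(2) by (auto simp: Q.linear_sum[OF T'(1)] Q.linear_scale[OF T'(1)] intro!: sum.cong)
    also have "\<dots> = T x"
      using sum_representation_eq[of B x B] B' finB x T'(2) by simp
    finally show ?thesis .
  qed
  have TCi\<kappa>: "(TC ^^ i) (\<kappa> x) = \<kappa> ((T ^^ i) x)" if x: "x \<in> V" for x i
  proof (induction i)
    case (Suc i)
    have "(T ^^ i) x \<in> V" using linear_map_on_funpow[OF T, of i] x by auto
    then show ?case using Suc TC\<kappa> by simp
  qed simp
  have TCiadd: "(TC ^^ i) (x + y) = (TC ^^ i) x + (TC ^^ i) y" for i x y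
    by (induction i) (simp_all add: TCadd)
  have TCiscale: "(TC ^^ i) (pm_scale r x) = pm_scale r ((TC ^^ i) x)" for i x r
    by (induction i) (simp_all add: TCscale)
  have TCi0: "(TC ^^ i) 0 = 0" for i using TCiscale[of i 0 0] by simp
  have TCisum: "(TC ^^ i) (sum f I) = (\<Sum>j\<in>I. (TC ^^ i) (f j))" for i I and f :: "'b \<Rightarrow> _"
    by (induction I rule: infinite_finite_induct) (simp_all add: TCiadd TCi0)
  have \<kappa>s: "\<kappa> e = s e" if "e \<in> B" for e
    using that B'(2) finB
    by (intro poly_mapping_eqI) (auto simp: lookup_\<kappa> s_def representation_basis \<iota>s lookup_single when_def)
  have "(TC ^^ N) x = x" if "x \<in> VC" for x
  proof -
    have "(TC ^^ N) (s e) = s e" if "e \<in> B" for e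
      using TCi\<kappa>[of e N] N(2)[of e] \<kappa>s[OF that] that B'(1) by auto
    then have "(TC ^^ N) (\<Sum>e\<in>B. pm_scale (Poly_Mapping.lookup x e) (s e)) = (\<Sum>e\<in>B. pm_scale (Poly_Mapping.lookup x e) (s e))"
      by (simp add: TCisum TCiscale)
    then show ?thesis using expand[OF that] by simp
  qed
  then have "norm (trace_on pm_scale VC TC) \<le> card (s ` B)"
    using norm_trace_on_finite_order_complex[OF C.vspace_axioms VC basC TClin _ N(1)] TCVC by blast
  then show ?thesis unfolding tr by (simp add: card_image[OF inj_on_subset[OF inj_s]])
qed

end

section \<open>Subexponential growth of the number of orbits of monomials\<close>

lemma power_sum_mset:
  fixes z :: real
  assumes "finite F" "set_mset M \<subseteq> F"
  shows "z ^ (\<Sum>t\<in>#M. wt t) = (\<Prod>t\<in>F. (z ^ wt t) ^ count M t)"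
  using assms(2)
proof (induction M)
  case (add x M)
  have "(\<Prod>t\<in>F. (z ^ wt t) ^ count (add_mset x M) t) =
      (\<Prod>t\<in>F. (z ^ wt t) ^ count M t * (if t = x then z ^ wt x else 1))"
    by (rule prod.cong) auto
  also have "\<dots> = (\<Prod>t\<in>F. (z ^ wt t) ^ count M t) * z ^ wt x"
    using add.prems assms(1) by (simp add: prod.distrib)
  finally show ?case using add by (simp add: power_add mult.commute)
qed simp

text \<open>Partial sums of the Euler product \<open>\<Prod>t. 1 / (1 - z ^ wt t)\<close>.\<close>

lemma sum_power_weight_multisets_le:
  fixes z S :: real
  assumes z: "0 < z" "z < 1" and wt: "\<And>t. t \<in> T \<Longrightarrow> wt t \<ge> (1::nat)"
    and S: "\<And>F. finite F \<Longrightarrow> F \<subseteq> T \<Longrightarrow> (\<Sum>t\<in>F. z ^ wt t) \<le> S"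
    and \<M>: "finite \<M>" "\<And>M. M \<in> \<M> \<Longrightarrow> set_mset M \<subseteq> T"
  shows "(\<Sum>M\<in>\<M>. z ^ (\<Sum>t\<in>#M. wt t)) \<le> exp (S / (1 - z))"
proof -
  define F where "F = (\<Union>M\<in>\<M>. set_mset M)"
  have F: "finite F" "F \<subseteq> T" using \<M> by (auto simp: F_def)
  \<comment> \<open>Any number above all multiplicities will do: multisets become functions from
    \<open>F\<close> into a finite box, over which a product of sums expands.\<close>
  define K where "K = Suc (\<Sum>M\<in>\<M>. size M)"
  have count: "count M t < K" if "M \<in> \<M>" for M t
  proof -
    have "count M t \<le> size M" by (rule count_le_size)
    also have "\<dots> \<le> (\<Sum>M\<in>\<M>. size M)" using that \<M>(1) by (intro member_le_sum) auto
    finally show ?thesis by (simp add: K_def)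
  qed
  define r where "r M = (\<lambda>t\<in>F. count M t)" for M :: "'a multiset"
  have r: "inj_on r \<M>"
  proof (rule inj_onI)
    fix M M' assume *: "M \<in> \<M>" "M' \<in> \<M>" "r M = r M'"
    show "M = M'"
    proof (rule multiset_eqI)
      fix t
      show "count M t = count M' t"
      proof (cases "t \<in> F")
        case True then show ?thesis using *(3) by (metis r_def restrict_apply')
      next
        case False
        then have "t \<notin># M" "t \<notin># M'" using * by (auto simp: F_def)
        then show ?thesis by (simp add: not_in_iff)
      qed
    qed
  qed
  have "(\<Sum>M\<in>\<M>. z ^ (\<Sum>t\<in>#M. wt t)) = (\<Sum>M\<in>\<M>. \<Prod>t\<in>F. (z ^ wt t) ^ r M t)"
  proof (rule sum.cong[OF refl])
    fix M assume "M \<in> \<M>"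
    then have "set_mset M \<subseteq> F" by (auto simp: F_def)
    then show "z ^ (\<Sum>t\<in>#M. wt t) = (\<Prod>t\<in>F. (z ^ wt t) ^ r M t)"
      using power_sum_mset[OF F(1)] by (simp add: r_def)
  qed
  also have "\<dots> = (\<Sum>g\<in>r ` \<M>. \<Prod>t\<in>F. (z ^ wt t) ^ g t)"
    by (simp add: sum.reindex[OF r])
  also have "\<dots> \<le> (\<Sum>g\<in>PiE F (\<lambda>_. {..<K}). \<Prod>t\<in>F. (z ^ wt t) ^ g t)"
  proof (rule sum_mono2)
    show "finite (PiE F (\<lambda>_. {..<K}))" using F by (simp add: finite_PiE)
    show "r ` \<M> \<subseteq> PiE F (\<lambda>_. {..<K})" using count by (auto simp: r_def)
  qed (use z in \<open>auto intro!: prod_nonneg\<close>)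
  also have "\<dots> = (\<Prod>t\<in>F. \<Sum>i<K. (z ^ wt t) ^ i)"
    using F by (subst prod_sum_PiE) auto
  also have "\<dots> \<le> (\<Prod>t\<in>F. exp (z ^ wt t / (1 - z)))"
  proof (rule prod_mono, intro conjI)
    fix t assume t: "t \<in> F"
    define x where "x = z ^ wt t"
    \<comment> \<open>Positive weights enter here: \<open>x \<le> z\<close> bounds the denominator
      in \<open>1 / (1 - x) = 1 + x / (1 - x)\<close> below by \<open>1 - z\<close>, uniformly in
      \<open>t\<close>.\<close>
    have "z ^ wt t \<le> z ^ 1" using t F wt z by (intro power_decreasing) auto
    then have x: "0 \<le> x" "x \<le> z" "x < 1" using z by (auto simp: x_def)
    have "(\<Sum>i<K. x ^ i) = (1 - x ^ K) / (1 - x)" using x by (simp add: sum_gp_strict)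
    also have "\<dots> \<le> 1 / (1 - x)" using x by (intro divide_right_mono) auto
    also have "\<dots> = 1 + x / (1 - x)" using x by (simp add: field_simps)
    also have "\<dots> \<le> 1 + x / (1 - z)" using x z by (intro add_left_mono divide_left_mono) auto
    also have "\<dots> \<le> exp (x / (1 - z))" by (rule exp_ge_add_one_self)
    finally show "(\<Sum>i<K. (z ^ wt t) ^ i) \<le> exp (z ^ wt t / (1 - z))" by (simp add: x_def)
    show "0 \<le> (\<Sum>i<K. (z ^ wt t) ^ i)" using z by (auto intro!: sum_nonneg)
  qed
  also have "\<dots> = exp ((\<Sum>t\<in>F. z ^ wt t) / (1 - z))"
    using F by (simp add: exp_sum sum_divide_distrib)
  also have "\<dots> \<le> exp (S / (1 - z))" using S[OF F] z by (simp add: divide_right_mono)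
  finally show ?thesis .
qed

section \<open>Positions, signs and labels of monomials\<close>

primrec gen_pos :: "gen \<Rightarrow> nat" where
  "gen_pos (Yvar j) = 0"
| "gen_pos (Xvar j a) = nat \<bar>a\<bar>"

text \<open>A generator with its position erased. It is kept inside the type \<open>gen\<close> so
  that \<open>gen_deg\<close> still applies; \<open>gen_at\<close> restores a position.\<close>

primrec gen_sgn :: "gen \<Rightarrow> gen" where
  "gen_sgn (Yvar j) = Yvar j"
| "gen_sgn (Xvar j a) = Xvar j (sgn a)"

primrec gen_at :: "nat \<Rightarrow> gen \<Rightarrow> gen" where
  "gen_at i (Yvar j) = Yvar j"
| "gen_at i (Xvar j s) = Xvar j (s * int i)"

text \<open>What a monomial contains at one position, signs included. Slot 0 collects the
  \<open>Yvar\<close>, which carry no subscript and are fixed by the group.\<close>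

definition slot :: "gen list \<Rightarrow> nat \<Rightarrow> gen multiset" where
  "slot w i = image_mset gen_sgn (filter_mset (\<lambda>g. gen_pos g = i) (mset w))"

text \<open>The stabiliser permutes the positions beyond \<open>k\<close>, which therefore all get the colour
  \<open>Suc k\<close>. Empty slots are dropped because the bound on multisets needs positive weights.\<close>

definition label :: "nat \<Rightarrow> nat \<Rightarrow> gen list \<Rightarrow> (nat \<times> gen multiset) multiset" where
  "label k n w = filter_mset (\<lambda>(i, v). v \<noteq> {#}) (image_mset (\<lambda>i. (min i (Suc k), slot w i)) (mset_set {..n}))"

lemma gen_at_pos_sgn: "gen_at (gen_pos g) (gen_sgn g) = g"
  by (cases g) (simp_all add: sgn_mult_abs)

lemma gen_deg_sgn: "gen_deg dy dx (gen_sgn g) = gen_deg dy dx g"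
  by (cases g) simp_all

lemma gen_pos_le: "g \<in> gens W b c n \<Longrightarrow> gen_pos g \<le> n"
  by (cases g) (auto simp: gens_def fiw_obj_def split: family.splits)

text \<open>The slots reassemble the word up to order. The function \<open>F\<close> chooses what to
  record of each letter: below it is the degree, or the letter placed at a possibly permuted
  position.\<close>

lemma sum_slot:
  assumes "\<And>g. g \<in> set w \<Longrightarrow> gen_pos g \<le> n"
  shows "(\<Sum>i\<le>n. image_mset (F i) (slot w i)) = image_mset (\<lambda>g. F (gen_pos g) (gen_sgn g)) (mset w)"
  using assms
proof (induction w)
  case Nil
  then show ?case by (simp add: slot_def)
next
  case (Cons g w)
  have "(\<Sum>i\<le>n. image_mset (F i) (slot (g # w) i)) =
     (\<Sum>i\<le>n. image_mset (F i) (slot w i) + (if i = gen_pos g then {#F (gen_pos g) (gen_sgn g)#} else {#}))"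
    by (intro sum.cong) (auto simp: slot_def)
  then show ?case using Cons by (simp add: sum.distrib)
qed

text \<open>Labels omit empty slots, but these can be recovered: the number of positions of each
  colour is known, so the nonempty slots determine how many empty ones there are.\<close>

lemma mset_eq_if_filter_eq:
  assumes "filter_mset (\<lambda>(i, v). v \<noteq> z) X = filter_mset (\<lambda>(i, v). v \<noteq> z) X'"
    and "image_mset fst X = image_mset fst X'"
  shows "X = X'"
proof (rule multiset_eqI, clarify)
  fix j v
  have cnt: "count X (j, v) = count X' (j, v)" if "v \<noteq> z" for v
    using arg_cong[OF assms(1), of "\<lambda>M. count M (j, v)"] that by simp
  have sz: "count (image_mset fst X) j = count X (j, z) + size (filter_mset (\<lambda>p. fst p = j) (filter_mset (\<lambda>(i, v). v \<noteq> z) X))" for X :: "('a \<times> 'b) multiset"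
    by (induction X) (auto split: prod.splits)
  show "count X (j, v) = count X' (j, v)"
    using cnt[of v] sz[of X] sz[of X'] assms by (cases "v = z") auto
qed

text \<open>Since slots remember signs, group elements that only permute positions suffice to match
  monomials in both families. The permutation acts on \<open>{..n}\<close>, where the point 0 stands
  for the slot of the \<open>Yvar\<close>.\<close>

definition perm_lift :: "family \<Rightarrow> nat \<Rightarrow> (nat \<Rightarrow> nat) \<Rightarrow> int \<Rightarrow> int" where
  "perm_lift W n p = (\<lambda>a\<in>fiw_obj W n. sgn a * int (p (nat \<bar>a\<bar>)))"

lemma in_fiw_obj_iff: "a \<in> fiw_obj W n \<longleftrightarrow> a \<noteq> 0 \<and> \<bar>a\<bar> \<le> int n \<and> (W = TypeA \<longrightarrow> a > 0)"
  by (cases W) (auto simp: fiw_obj_def)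

lemma finite_fiw_obj [simp]: "finite (fiw_obj W n)"
  by (cases W) (auto simp: fiw_obj_def)

lemma weylI:
  assumes "\<sigma> \<in> extensional (fiw_obj W n)" "\<And>a. a \<in> fiw_obj W n \<Longrightarrow> \<sigma> a \<in> fiw_obj W n" "inj_on \<sigma> (fiw_obj W n)"
    "\<And>a. W = TypeBC \<Longrightarrow> a \<in> fiw_obj W n \<Longrightarrow> \<sigma> (- a) = - \<sigma> a"
  shows "\<sigma> \<in> weyl W n"
proof -
  have "\<sigma> ` fiw_obj W n = fiw_obj W n"
    using assms by (intro endo_inj_surj) auto
  then show ?thesis using assms by (auto simp: weyl_def fiw_hom_def bij_betw_def PiE_iff)
qed

lemma perm_lift_weyl:
  assumes p: "p permutes {..n}" "p 0 = 0"
  shows "perm_lift W n p \<in> weyl W n"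
proof (rule weylI)
  have p0: "p i = 0 \<longleftrightarrow> i = 0" for i using p by (metis permutes_inverses(2))
  have pn: "p i \<le> n" if "i \<le> n" for i using permutes_in_image[OF p(1), of i] that by simp
  show "perm_lift W n p a \<in> fiw_obj W n" if "a \<in> fiw_obj W n" for a
    using that pn[of "nat \<bar>a\<bar>"] p0[of "nat \<bar>a\<bar>"] by (auto simp: perm_lift_def in_fiw_obj_iff abs_mult zero_less_mult_iff sgn_if)
  show "inj_on (perm_lift W n p) (fiw_obj W n)"
  proof (rule inj_onI)
    fix a b assume *: "a \<in> fiw_obj W n" "b \<in> fiw_obj W n" "perm_lift W n p a = perm_lift W n p b"
    then have eq: "sgn a * int (p (nat \<bar>a\<bar>)) = sgn b * int (p (nat \<bar>b\<bar>))" by (simp add: perm_lift_def)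
    have nz: "a \<noteq> 0" "b \<noteq> 0" using * by (auto simp: in_fiw_obj_iff)
    then have "p (nat \<bar>a\<bar>) \<noteq> 0" "p (nat \<bar>b\<bar>) \<noteq> 0" using p0 by auto
    then have "sgn a = sgn b" using arg_cong[OF eq, of sgn] by (simp add: sgn_mult)
    moreover have "p (nat \<bar>a\<bar>) = p (nat \<bar>b\<bar>)" using arg_cong[OF eq, of abs] nz by (simp add: abs_mult)
    then have "nat \<bar>a\<bar> = nat \<bar>b\<bar>" using permutes_inj[OF p(1)] by (auto simp: inj_def)
    ultimately show "a = b" by (metis sgn_mult_abs nat_0_le abs_ge_zero)
  qed
  show "perm_lift W n p (- a) = - perm_lift W n p a" if "W = TypeBC" "a \<in> fiw_obj W n" for a
    using that by (auto simp: perm_lift_def in_fiw_obj_iff)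
qed (simp add: perm_lift_def)

text \<open>Equal multisets of coloured slots are matched by a permutation of the positions.
  Positions up to \<open>k\<close> have colours that occur nowhere else, so they stay put and the
  lifted permutation fixes \<open>k\<close> pointwise. The order of the letters is not controlled,
  which later costs a sign.\<close>

lemma same_label:
  assumes "k \<le> n" "set w \<subseteq> gens W b c n" "set w' \<subseteq> gens W b c n" "label k n w = label k n w'"
  obtains h where "h \<in> weyl W n" "\<And>a. a \<in> fiw_obj W k \<Longrightarrow> h a = a" "mset (map (gen_map h) w) = mset w'"
proof -
  define f where "f w = (\<lambda>i. (min i (Suc k), slot w i))" for w
  have "image_mset (f w) (mset_set {..n}) = image_mset (f w') (mset_set {..n})"
  proof (rule mset_eq_if_filter_eq[where z = "{#}"])
    show "image_mset fst (image_mset (f w) (mset_set {..n})) = image_mset fst (image_mset (f w') (mset_set {..n}))"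
      by (simp add: f_def image_mset.compositionality o_def)
  qed (use assms(4) in \<open>simp add: label_def f_def\<close>)
  from image_mset_eq_implies_permutes[OF _ this] obtain p
    where p: "p permutes {..n}" "\<forall>i\<in>{..n}. f w i = f w' (p i)" by auto
  have p_fix: "p i = i" if "i \<le> k" for i
  proof -
    have "f w i = f w' (p i)" using p(2) that assms(1) by simp
    then have "min i (Suc k) = min (p i) (Suc k)" by (simp add: f_def)
    with that show ?thesis by linarith
  qed
  have slot: "slot w i = slot w' (p i)" if "i \<le> n" for i using p(2) that by (simp add: f_def)
  define h where "h = perm_lift W n p"
  have pos: "\<And>g. g \<in> set w \<Longrightarrow> gen_pos g \<le> n" "\<And>g. g \<in> set w' \<Longrightarrow> gen_pos g \<le> n"
    using assms gen_pos_le by blast+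
  have "mset (map (gen_map h) w) = image_mset (\<lambda>g. gen_at (p (gen_pos g)) (gen_sgn g)) (mset w)"
  proof -
    have "gen_map h g = gen_at (p (gen_pos g)) (gen_sgn g)" if "g \<in> set w" for g
      using that assms(2) by (cases g) (auto simp: h_def perm_lift_def gens_def)
    then show ?thesis by (auto intro: image_mset_cong)
  qed
  also have "\<dots> = (\<Sum>i\<le>n. image_mset (gen_at (p i)) (slot w i))"
    by (rule sum_slot[symmetric]) (rule pos(1))
  also have "\<dots> = (\<Sum>i\<le>n. image_mset (gen_at (p i)) (slot w' (p i)))"
    using slot by simp
  also have "\<dots> = (\<Sum>i\<le>n. image_mset (gen_at i) (slot w' i))"
    using sum.permute[OF p(1), of "\<lambda>i. image_mset (gen_at i) (slot w' i)"] by (simp add: o_def)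
  also have "\<dots> = mset w'"
    using sum_slot[of w' n gen_at] pos(2) by (simp add: gen_at_pos_sgn)
  finally have "mset (map (gen_map h) w) = mset w'" .
  moreover have "h a = a" if "a \<in> fiw_obj W k" for a
  proof -
    have "a \<in> fiw_obj W n" "nat \<bar>a\<bar> \<le> k" using that assms(1) by (auto simp: in_fiw_obj_iff)
    then show ?thesis using p_fix by (simp add: h_def perm_lift_def sgn_mult_abs)
  qed
  moreover have "h \<in> weyl W n" unfolding h_def using p(1) p_fix by (intro perm_lift_weyl) auto
  ultimately show ?thesis using that by blast
qed

definition words :: "family \<Rightarrow> nat \<Rightarrow> nat \<Rightarrow> (nat \<Rightarrow> nat) \<Rightarrow> (nat \<Rightarrow> nat) \<Rightarrow> nat \<Rightarrow> nat \<Rightarrow> gen list set" where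
  "words W b c dy dx n d = {w. set w \<subseteq> gens W b c n \<and> sum_list (map (gen_deg dy dx) w) = d}"

lemma finite_gens: "finite (gens W b c n)"
  by (simp add: gens_def)

lemma gen_deg_pos:
  assumes "\<forall>j<b. dy j > 0" "\<forall>j<c. dx j > 0" "g \<in> gens W b c n"
  shows "gen_deg dy dx g > 0"
  using assms by (auto simp: gens_def)

lemma finite_words:
  assumes "\<forall>j<b. dy j > 0" "\<forall>j<c. dx j > 0"
  shows "finite (words W b c dy dx n d)"
proof (rule finite_subset)
  have "length w \<le> sum_list (map (gen_deg dy dx) w)" if "set w \<subseteq> gens W b c n" for w
    using that
  proof (induction w)
    case (Cons g w)
    then have "gen_deg dy dx g > 0" by (intro gen_deg_pos[OF assms, of g W n]) simp
    with Cons show ?case by simp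
  qed simp
  then show "words W b c dy dx n d \<subseteq> {w. set w \<subseteq> gens W b c n \<and> length w \<le> d}"
    by (auto simp: words_def)
qed (rule finite_lists_length_le[OF finite_gens])

lemma sum_list_mset: "sum_list (map f w) = (\<Sum>g\<in>#mset w. f g)"
  by (simp flip: sum_mset_sum_list)

text \<open>The Euler product bound is applied twice. Over letters it bounds by \<open>S1\<close>
  the generating function of slots; over coloured nonempty slots it then bounds that of labels.
  Neither index set involves \<open>n\<close>.\<close>

lemma card_label_le:
  fixes z :: real
  assumes deg: "\<forall>j<b. dy j > 0" "\<forall>j<c. dx j > 0" and z: "0 < z" "z < 1"
  obtains C where "\<And>n d. card (label k n ` words W b c dy dx n d) \<le> C / z ^ d"
proof -
  \<comment> \<open>The alphabet of slots: \<open>Yvar\<close> and subscripts 1 and -1. Taking type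
    B/C here also covers the letters that occur in type A.\<close>
  define N where "N = gens TypeBC b c 1"
  define dg where "dg = gen_deg dy dx"
  define wt where "wt = (\<lambda>(i :: nat, v). \<Sum>g\<in>#v. dg g)"
  define T where "T = {..Suc k} \<times> {v. v \<noteq> {#} \<and> set_mset v \<subseteq> N}"
  have finN: "finite N" by (simp add: N_def finite_gens)
  have dgN: "dg g \<ge> 1" if "g \<in> N" for g
    using gen_deg_pos[OF deg] that by (fastforce simp: N_def dg_def)
  define S1 where "S1 = exp (real (card N) / (1 - z))"
  have S1: "(\<Sum>v\<in>\<M>. z ^ (\<Sum>g\<in>#v. dg g)) \<le> S1"
    if "finite \<M>" "\<And>v. v \<in> \<M> \<Longrightarrow> set_mset v \<subseteq> N" for \<M>
    unfolding S1_def
  proof (rule sum_power_weight_multisets_le[OF z dgN _ that])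
    fix F assume F: "finite F" "F \<subseteq> N"
    have "(\<Sum>t\<in>F. z ^ dg t) \<le> (\<Sum>t\<in>F. 1)" using z by (intro sum_mono) (simp add: power_le_one)
    also have "\<dots> \<le> card N" using card_mono[OF finN F(2)] by simp
    finally show "(\<Sum>t\<in>F. z ^ dg t) \<le> card N" .
  qed
  \<comment> \<open>The colours are \<open>0\<close> to \<open>k + 1\<close>, hence the factor
    \<open>k + 2\<close>.\<close>
  define S2 where "S2 = exp (real (k + 2) * S1 / (1 - z))"
  have S2: "(\<Sum>M\<in>\<M>. z ^ (\<Sum>t\<in>#M. wt t)) \<le> S2"
    if "finite \<M>" "\<And>M. M \<in> \<M> \<Longrightarrow> set_mset M \<subseteq> T" for \<M>
    unfolding S2_def
  proof (rule sum_power_weight_multisets_le[OF z _ _ that])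
    show "wt t \<ge> 1" if "t \<in> T" for t
    proof -
      obtain i v where t: "t = (i, v)" by force
      have v: "v \<noteq> {#}" "set_mset v \<subseteq> N" using that by (auto simp: T_def t)
      then obtain g where g: "g \<in># v" "g \<in> N" by (metis multiset_nonemptyE subsetD)
      have "dg g \<le> (\<Sum>g\<in>#v. dg g)" using g(1) by (metis multi_member_split image_mset_add_mset sum_mset.insert le_add1)
      then show ?thesis using dgN[OF g(2)] by (simp add: wt_def t)
    qed
    fix F assume F: "finite F" "F \<subseteq> T"
    have "(\<Sum>t\<in>F. z ^ wt t) \<le> (\<Sum>t\<in>{..Suc k} \<times> snd ` F. z ^ wt t)"
      using F z by (intro sum_mono2) (force simp: T_def)+
    also have "\<dots> = (\<Sum>i\<le>Suc k. \<Sum>v\<in>snd ` F. z ^ (\<Sum>g\<in>#v. dg g))"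
      by (simp only: sum.cartesian_product) (simp add: wt_def case_prod_unfold)
    also have "\<dots> \<le> (\<Sum>i\<le>Suc k. S1)"
    proof (intro sum_mono S1)
      show "set_mset v \<subseteq> N" if "v \<in> snd ` F" for v using that F(2) by (fastforce simp: T_def)
    qed (use F in auto)
    finally show "(\<Sum>t\<in>F. z ^ wt t) \<le> real (k + 2) * S1" by (simp add: algebra_simps)
  qed
  have "card (label k n ` words W b c dy dx n d) \<le> S2 / z ^ d" for n d
  proof -
    have label_T: "set_mset (label k n w) \<subseteq> T" and label_wt: "(\<Sum>t\<in>#label k n w. wt t) = d"
      if w: "w \<in> words W b c dy dx n d" for w
    proof -
      have "gen_sgn g \<in> N" if "g \<in> gens W b c n" for g
        using that by (cases g) (auto simp: N_def gens_def fiw_obj_def sgn_if split: family.splits)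
      then have "set_mset (slot w i) \<subseteq> N" for i using w by (auto simp: words_def slot_def)
      then show "set_mset (label k n w) \<subseteq> T" by (auto simp: label_def T_def)
      have pos: "gen_pos g \<le> n" if "g \<in> set w" for g using w that gen_pos_le by (auto simp: words_def)
      have "(\<Sum>t\<in>#filter_mset (\<lambda>(i, v). v \<noteq> {#}) X. wt t) = (\<Sum>t\<in>#X. wt t)" for X
        by (induction X) (auto simp: wt_def)
      then have "(\<Sum>t\<in>#label k n w. wt t) = (\<Sum>i\<le>n. \<Sum>g\<in>#slot w i. dg g)"
        by (simp add: label_def wt_def image_mset.compositionality o_def sum_unfold_sum_mset)
      also have "\<dots> = sum_mset (\<Sum>i\<le>n. image_mset dg (slot w i))"
        by (induction n) simp_all
      also have "\<dots> = (\<Sum>g\<in>#mset w. dg g)"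
        using sum_slot[of w n "\<lambda>i. dg"] pos by (simp add: dg_def gen_deg_sgn)
      also have "\<dots> = d" using w by (simp add: words_def dg_def sum_list_mset)
      finally show "(\<Sum>t\<in>#label k n w. wt t) = d" .
    qed
    \<comment> \<open>All labels of words of degree \<open>d\<close> have weight \<open>d\<close>,
      so the weighted sum is their number times \<open>z ^ d\<close>.\<close>
    have "card (label k n ` words W b c dy dx n d) * z ^ d = (\<Sum>M\<in>label k n ` words W b c dy dx n d. z ^ (\<Sum>t\<in>#M. wt t))"
      using label_wt by (subst sum.cong[where h = "\<lambda>_. z ^ d", OF refl]) auto
    also have "\<dots> \<le> S2" using label_T finite_words[OF deg] by (intro S2) auto
    finally show ?thesis using z by (simp add: field_simps)
  qed
  then show ?thesis using that by blast
qed

section \<open>Cycle counts and pattern counts\<close>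

lemma weylD:
  assumes "\<sigma> \<in> weyl W n"
  shows "a \<in> fiw_obj W n \<Longrightarrow> \<sigma> a \<in> fiw_obj W n" "inj_on \<sigma> (fiw_obj W n)" "\<sigma> \<in> extensional (fiw_obj W n)"
    "\<sigma> ` fiw_obj W n = fiw_obj W n" "a \<in> fiw_obj W n \<Longrightarrow> - a \<in> fiw_obj W n \<Longrightarrow> \<sigma> (- a) = - \<sigma> a"
proof -
  have "W = TypeBC" if "a \<in> fiw_obj W n" "- a \<in> fiw_obj W n"
    using that by (cases W) (auto simp: fiw_obj_def)
  then show "a \<in> fiw_obj W n \<Longrightarrow> - a \<in> fiw_obj W n \<Longrightarrow> \<sigma> (- a) = - \<sigma> a"
    using assms by (auto simp: weyl_def fiw_hom_def)
qed (use assms in \<open>auto simp: weyl_def fiw_hom_def bij_betw_def PiE_iff\<close>)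

lemma fiw_obj_nonzero: "a \<in> fiw_obj W n \<Longrightarrow> a \<noteq> 0"
  by (simp add: in_fiw_obj_iff)

primrec var_len :: "cycle_var \<Rightarrow> nat" where
  "var_len (PosCycles r) = r"
| "var_len (NegCycles r) = r"

primrec var_sgn :: "cycle_var \<Rightarrow> int" where
  "var_sgn (PosCycles r) = 1"
| "var_sgn (NegCycles r) = -1"

text \<open>The points of the cycles counted by a variable: \<open>\<epsilon>\<close> is \<open>1\<close> for positive and \<open>-1\<close> for
  negative \<open>r\<close>-cycles.\<close>

definition cycle_point :: "nat \<Rightarrow> int \<Rightarrow> (int \<Rightarrow> int) \<Rightarrow> int \<Rightarrow> bool" where
  "cycle_point r \<epsilon> \<sigma> a \<longleftrightarrow> (\<sigma> ^^ r) a = \<epsilon> * a \<and> (\<forall>i. 0 < i \<longrightarrow> i < r \<longrightarrow> (\<sigma> ^^ i) a \<noteq> a \<and> (\<sigma> ^^ i) a \<noteq> - a)"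

context
  fixes W n \<sigma>
  assumes \<sigma>: "\<sigma> \<in> weyl W n"
begin

lemma weyl_funpow_in: "a \<in> fiw_obj W n \<Longrightarrow> (\<sigma> ^^ i) a \<in> fiw_obj W n"
  by (induction i) (auto intro: weylD(1)[OF \<sigma>])

lemma weyl_funpow_inj: "a \<in> fiw_obj W n \<Longrightarrow> b \<in> fiw_obj W n \<Longrightarrow> (\<sigma> ^^ i) a = (\<sigma> ^^ i) b \<Longrightarrow> a = b"
proof (induction i)
  case (Suc i)
  then have "(\<sigma> ^^ i) a = (\<sigma> ^^ i) b"
    using inj_onD[OF weylD(2)[OF \<sigma>]] weyl_funpow_in by simp
  with Suc show ?case by blast
qed simp

lemma weyl_funpow_neg:
  assumes "a \<in> fiw_obj W n" "- a \<in> fiw_obj W n"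
  shows "(\<sigma> ^^ i) (- a) = - (\<sigma> ^^ i) a"
proof (induction i)
  case (Suc i)
  have "(\<sigma> ^^ i) a \<in> fiw_obj W n" "- (\<sigma> ^^ i) a \<in> fiw_obj W n"
    using weyl_funpow_in[OF assms(1), of i] weyl_funpow_in[OF assms(2), of i] Suc by auto
  then show ?case using Suc weylD(5)[OF \<sigma>] by simp
qed simp

lemma weyl_funpow_cancel:
  assumes "a \<in> fiw_obj W n" "i \<le> j" "(\<sigma> ^^ i) a = (\<sigma> ^^ j) a"
  shows "(\<sigma> ^^ (j - i)) a = a"
proof -
  have "(\<sigma> ^^ i) ((\<sigma> ^^ (j - i)) a) = (\<sigma> ^^ i) a"
    using assms(2,3) by (simp flip: funpow_add[unfolded o_def, THEN fun_cong])
  then show ?thesis using weyl_funpow_inj weyl_funpow_in assms(1) by metis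
qed

text \<open>\<open>orbit\<close> collects only positive powers, so the starting point does not
  belong to it by definition. By pigeonhole two powers agree at \<open>a\<close>, and injectivity
  cancels the smaller one.\<close>

lemma weyl_self_in_orbit:
  assumes "a \<in> fiw_obj W n" shows "a \<in> orbit \<sigma> a"
proof -
  have "\<not> inj_on (\<lambda>i. (\<sigma> ^^ i) a) {..card (fiw_obj W n)}"
  proof
    assume "inj_on (\<lambda>i. (\<sigma> ^^ i) a) {..card (fiw_obj W n)}"
    then have "card {..card (fiw_obj W n)} \<le> card (fiw_obj W n)"
      using weyl_funpow_in[OF assms] by (intro card_inj_on_le) auto
    then show False by simp
  qed
  then obtain i j where "i < j" "(\<sigma> ^^ i) a = (\<sigma> ^^ j) a"
    unfolding inj_on_def by (metis linorder_neqE_nat)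
  then have "(\<sigma> ^^ (j - i)) a = a" "j - i > 0" using weyl_funpow_cancel[OF assms, of i j] by auto
  then show ?thesis unfolding orbit_altdef by (metis (mono_tags, lifting) mem_Collect_eq)
qed

lemma weyl_orbit_eq:
  assumes "a \<in> fiw_obj W n" "b \<in> orbit \<sigma> a" shows "orbit \<sigma> b = orbit \<sigma> a"
  using orbit_cyclic_eq3[of \<sigma> "orbit \<sigma> a" b] weyl_self_in_orbit[OF assms(1)] assms(2)
  unfolding cyclic_on_def by blast

lemma weyl_orbit_subset: "a \<in> fiw_obj W n \<Longrightarrow> orbit \<sigma> a \<subseteq> fiw_obj W n"
  using weyl_funpow_in by (auto simp: orbit_altdef)

lemma weyl_orbit_uminus:
  assumes "a \<in> fiw_obj W n" "- a \<in> fiw_obj W n"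
  shows "orbit \<sigma> (- a) = uminus ` orbit \<sigma> a"
  using weyl_funpow_neg[OF assms] by (auto simp: orbit_altdef)

lemma card_orbit_iff:
  assumes a: "a \<in> fiw_obj W n" and r: "r > 0"
  shows "card (orbit \<sigma> a) = r \<longleftrightarrow> (\<sigma> ^^ r) a = a \<and> (\<forall>i. 0 < i \<longrightarrow> i < r \<longrightarrow> (\<sigma> ^^ i) a \<noteq> a)"
proof -
  have card: "card (orbit \<sigma> a) = m" if "m > 0" "(\<sigma> ^^ m) a = a" "\<forall>i. 0 < i \<longrightarrow> i < m \<longrightarrow> (\<sigma> ^^ i) a \<noteq> a" for m
  proof -
    have "inj_on (\<lambda>i. (\<sigma> ^^ i) a) {..<m}"
    proof (rule linorder_inj_onI')
      fix i j assume "i \<in> {..<m}" "j \<in> {..<m}" "i < j"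
      then show "(\<sigma> ^^ i) a \<noteq> (\<sigma> ^^ j) a"
        using weyl_funpow_cancel[OF a, of i j] that(3)[rule_format, of "j - i"] by auto
    qed
    moreover have "orbit \<sigma> a = (\<lambda>i. (\<sigma> ^^ i) a) ` {..<m}"
      using orbit_altdef_bounded[OF that(2,1)] by auto
    ultimately show ?thesis by (simp add: card_image)
  qed
  define m where "m = (LEAST i. 0 < i \<and> (\<sigma> ^^ i) a = a)"
  have "\<exists>i. 0 < i \<and> (\<sigma> ^^ i) a = a" using weyl_self_in_orbit[OF a] by (auto simp: orbit_altdef)
  then have m: "0 < m \<and> (\<sigma> ^^ m) a = a" unfolding m_def by (rule LeastI_ex)
  moreover have min: "\<forall>i. 0 < i \<longrightarrow> i < m \<longrightarrow> (\<sigma> ^^ i) a \<noteq> a"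
    unfolding m_def using not_less_Least by blast
  ultimately have "card (orbit \<sigma> a) = m" using card by blast
  then show ?thesis using m min card[of r] r by blast
qed

lemma cycle_point_pos_iff:
  assumes a: "a \<in> fiw_obj W n" and r: "r > 0"
  shows "cycle_point r 1 \<sigma> a \<longleftrightarrow> card (orbit \<sigma> a) = r \<and> - a \<notin> orbit \<sigma> a"
proof
  assume c: "cycle_point r 1 \<sigma> a"
  then have *: "(\<sigma> ^^ r) a = a" "\<And>i. 0 < i \<Longrightarrow> i < r \<Longrightarrow> (\<sigma> ^^ i) a \<noteq> a \<and> (\<sigma> ^^ i) a \<noteq> - a"
    by (auto simp: cycle_point_def)
  have "- a \<noteq> (\<sigma> ^^ i) a" if "i < r" for i
    using *(2)[of i] fiw_obj_nonzero[OF a] that by (cases "i = 0") auto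
  then show "card (orbit \<sigma> a) = r \<and> - a \<notin> orbit \<sigma> a"
    using * card_orbit_iff[OF a r] orbit_altdef_bounded[OF *(1) r] by auto
next
  assume c: "card (orbit \<sigma> a) = r \<and> - a \<notin> orbit \<sigma> a"
  then have "(\<sigma> ^^ i) a \<noteq> - a" if "0 < i" for i using that by (metis (mono_tags, lifting) orbit_altdef mem_Collect_eq)
  then show "cycle_point r 1 \<sigma> a" using c card_orbit_iff[OF a r] by (simp add: cycle_point_def)
qed

text \<open>If the \<open>r\<close>-th power sends \<open>a\<close> to \<open>- a\<close>, the
  second half of the cycle is the negative of the first. Conversely, \<open>- a\<close> can only sit
  half way around a cycle of length \<open>2 r\<close>.\<close>

lemma cycle_point_neg_iff:
  assumes a: "a \<in> fiw_obj W n" and na: "- a \<in> fiw_obj W n" and r: "r > 0"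
  shows "cycle_point r (-1) \<sigma> a \<longleftrightarrow> card (orbit \<sigma> a) = 2 * r \<and> - a \<in> orbit \<sigma> a"
proof
  assume c: "cycle_point r (-1) \<sigma> a"
  then have *: "(\<sigma> ^^ r) a = - a" "\<And>i. 0 < i \<Longrightarrow> i < r \<Longrightarrow> (\<sigma> ^^ i) a \<noteq> a \<and> (\<sigma> ^^ i) a \<noteq> - a"
    by (auto simp: cycle_point_def)
  have shift: "(\<sigma> ^^ (i + r)) a = - (\<sigma> ^^ i) a" for i
    using *(1) weyl_funpow_neg[OF a na] by (simp add: funpow_add)
  have "(\<sigma> ^^ (2 * r)) a = a" using shift[of r] *(1) by (simp add: mult_2)
  moreover have "(\<sigma> ^^ i) a \<noteq> a" if "0 < i" "i < 2 * r" for i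
  proof -
    consider "i < r" | "i = r" | "r < i" by linarith
    then show ?thesis
    proof cases
      case 3
      then have "(\<sigma> ^^ i) a = - (\<sigma> ^^ (i - r)) a" "0 < i - r" "i - r < r" using shift[of "i - r"] that by auto
      then show ?thesis using *(2)[of "i - r"] by (metis minus_minus)
    qed (use * that fiw_obj_nonzero[OF a] in auto)
  qed
  moreover have "- a \<in> orbit \<sigma> a" using *(1) r unfolding orbit_altdef by (metis (mono_tags, lifting) mem_Collect_eq)
  ultimately show "card (orbit \<sigma> a) = 2 * r \<and> - a \<in> orbit \<sigma> a"
    using card_orbit_iff[OF a, of "2 * r"] r by simp
next
  assume c: "card (orbit \<sigma> a) = 2 * r \<and> - a \<in> orbit \<sigma> a"
  then have *: "(\<sigma> ^^ (2 * r)) a = a" "\<And>i. 0 < i \<Longrightarrow> i < 2 * r \<Longrightarrow> (\<sigma> ^^ i) a \<noteq> a"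
    using card_orbit_iff[OF a, of "2 * r"] r by auto
  \<comment> \<open>Applying the \<open>i\<close>-th power twice returns to \<open>a\<close>, so
    \<open>2 * i\<close> is a multiple of the period \<open>2 * r\<close>. As it lies strictly
    between 0 and \<open>4 * r\<close>, it equals \<open>2 * r\<close>.\<close>
  have neg: "i = r" if "0 < i" "i < 2 * r" "(\<sigma> ^^ i) a = - a" for i
  proof -
    have ii: "(\<sigma> ^^ (i + i)) a = a" using that weyl_funpow_neg[OF a na] by (simp add: funpow_add)
    consider "i < r" | "i = r" | "r < i" by linarith
    then show ?thesis
    proof cases
      case 1
      then show ?thesis using *(2)[of "i + i"] ii that by auto
    next
      case 3
      then have "(\<sigma> ^^ (i + i - 2 * r)) a = a"
        using weyl_funpow_cancel[OF a, of "2 * r" "i + i"] *(1) ii by simp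
      then show ?thesis using *(2)[of "i + i - 2 * r"] 3 that by auto
    qed
  qed
  obtain i where i: "i < 2 * r" "- a = (\<sigma> ^^ i) a"
    using c orbit_altdef_bounded[OF *(1)] r by auto
  moreover have "i \<noteq> 0" using i fiw_obj_nonzero[OF a] by (metis funpow_0 equal_neg_zero)
  ultimately have "i = r" using neg[of i] by simp
  then have "(\<sigma> ^^ r) a = - a" using i by simp
  moreover have "(\<sigma> ^^ i) a \<noteq> a \<and> (\<sigma> ^^ i) a \<noteq> - a" if "0 < i" "i < r" for i
    using *(2)[of i] neg[of i] that by auto
  ultimately show "cycle_point r (-1) \<sigma> a" by (simp add: cycle_point_def)
qed

lemma orbit_disjoint:
  assumes "a \<in> fiw_obj W n" "b \<in> fiw_obj W n" "orbit \<sigma> a \<inter> orbit \<sigma> b \<noteq> {}"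
  shows "orbit \<sigma> a = orbit \<sigma> b"
  using assms weyl_orbit_eq by (metis disjoint_iff)

text \<open>Points are easier to handle than cycles because a morphism hits points. In type A a
  cycle has \<open>r\<close> points. In type B/C it has \<open>2 r\<close>: a positive cycle is a
  pair of orbits of size \<open>r\<close>, a negative one a single orbit of size
  \<open>2 r\<close>.\<close>

lemma card_cycle_points:
  assumes v: "v \<in> cycle_vars W"
  shows "card {a \<in> fiw_obj W n. cycle_point (var_len v) (var_sgn v) \<sigma> a} =
    (if W = TypeA then 1 else 2) * var_len v * cycle_count W n \<sigma> v"
proof (cases v)
  case (PosCycles r)
  with v have r: "r > 0" by (auto simp: cycle_vars_def split: if_splits)
  have "card {a \<in> fiw_obj W n. cycle_point r 1 \<sigma> a} = (if W = TypeA then r else 2 * r) * cycle_count W n \<sigma> v"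
  proof (cases W)
    case TypeA
    define \<C> where "\<C> = {S \<in> cycle_supports W n \<sigma>. card S = r}"
    have neg: "- a \<notin> orbit \<sigma> a" if "a \<in> fiw_obj W n" for a
    proof -
      have "- a \<notin> fiw_obj W n" using that TypeA by (auto simp: in_fiw_obj_iff)
      then show ?thesis using weyl_orbit_subset[OF that] by blast
    qed
    have "{a \<in> fiw_obj W n. cycle_point r 1 \<sigma> a} = {a \<in> fiw_obj W n. card (orbit \<sigma> a) = r}"
      using cycle_point_pos_iff[OF _ r] neg by auto
    also have "\<dots> = \<Union>\<C>"
    proof (intro equalityI subsetI)
      fix a assume "a \<in> {a \<in> fiw_obj W n. card (orbit \<sigma> a) = r}"
      then show "a \<in> \<Union>\<C>" using weyl_self_in_orbit[of a] by (auto simp: \<C>_def cycle_supports_def)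
    next
      fix a assume "a \<in> \<Union>\<C>"
      then obtain b where b: "b \<in> fiw_obj W n" "a \<in> orbit \<sigma> b" "card (orbit \<sigma> b) = r"
        by (auto simp: \<C>_def cycle_supports_def)
      then show "a \<in> {a \<in> fiw_obj W n. card (orbit \<sigma> a) = r}"
        using weyl_orbit_subset[OF b(1)] weyl_orbit_eq[OF b(1,2)] by auto
    qed
    finally have "{a \<in> fiw_obj W n. cycle_point r 1 \<sigma> a} = \<Union>\<C>" .
    moreover have "r * card \<C> = card (\<Union>\<C>)"
    proof (rule card_partition)
      show "finite \<C>" by (simp add: \<C>_def cycle_supports_def)
      have "\<Union>\<C> \<subseteq> fiw_obj W n" using weyl_orbit_subset by (auto simp: \<C>_def cycle_supports_def)
      then show "finite (\<Union>\<C>)" by (rule finite_subset) simp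
    next
      fix S S' assume "S \<in> \<C>" "S' \<in> \<C>" "S \<noteq> S'"
      then show "S \<inter> S' = {}" using orbit_disjoint by (auto simp: \<C>_def cycle_supports_def)
    qed (simp add: \<C>_def)
    ultimately show ?thesis using TypeA PosCycles by (simp add: pos_cycles_def \<C>_def)
  next
    case TypeBC
    define \<C> where "\<C> = {S \<union> uminus ` S |S. S \<in> cycle_supports W n \<sigma> \<and> uminus ` S \<noteq> S \<and> card S = r}"
    have neg: "- a \<in> fiw_obj W n" if "a \<in> fiw_obj W n" for a using that TypeBC by (auto simp: in_fiw_obj_iff)
    have sym: "uminus ` orbit \<sigma> a = orbit \<sigma> a \<longleftrightarrow> - a \<in> orbit \<sigma> a" if a: "a \<in> fiw_obj W n" for a
      using weyl_orbit_uminus[OF a neg[OF a]] weyl_self_in_orbit[OF a] weyl_orbit_eq[OF a, of "- a"] by auto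
    have \<C>: "\<C> = (\<lambda>a. orbit \<sigma> a \<union> orbit \<sigma> (- a)) ` {a \<in> fiw_obj W n. cycle_point r 1 \<sigma> a}"
    proof -
      have "\<C> = (\<lambda>a. orbit \<sigma> a \<union> uminus ` orbit \<sigma> a) ` {a \<in> fiw_obj W n. uminus ` orbit \<sigma> a \<noteq> orbit \<sigma> a \<and> card (orbit \<sigma> a) = r}"
        by (auto simp: \<C>_def cycle_supports_def)
      also have "\<dots> = (\<lambda>a. orbit \<sigma> a \<union> uminus ` orbit \<sigma> a) ` {a \<in> fiw_obj W n. cycle_point r 1 \<sigma> a}"
        using cycle_point_pos_iff[OF _ r] sym by (intro arg_cong2[where f = image] refl) auto
      also have "\<dots> = (\<lambda>a. orbit \<sigma> a \<union> orbit \<sigma> (- a)) ` {a \<in> fiw_obj W n. cycle_point r 1 \<sigma> a}"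
        using weyl_orbit_uminus neg by (intro image_cong refl) auto
      finally show ?thesis .
    qed
    have sub: "orbit \<sigma> a \<union> orbit \<sigma> (- a) \<subseteq> {a \<in> fiw_obj W n. cycle_point r 1 \<sigma> a}"
      if a: "a \<in> fiw_obj W n" "cycle_point r 1 \<sigma> a" for a
    proof -
      have 1: "orbit \<sigma> a \<subseteq> {a \<in> fiw_obj W n. cycle_point r 1 \<sigma> a}"
        if a: "a \<in> fiw_obj W n" "cycle_point r 1 \<sigma> a" for a
      proof
        fix b assume b: "b \<in> orbit \<sigma> a"
        then have bo: "b \<in> fiw_obj W n" "orbit \<sigma> b = orbit \<sigma> a"
          using weyl_orbit_subset[OF a(1)] weyl_orbit_eq[OF a(1)] by auto
        have "- b \<notin> orbit \<sigma> b"
        proof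
          assume "- b \<in> orbit \<sigma> b"
          then have "uminus ` orbit \<sigma> a = orbit \<sigma> a" using sym[OF bo(1)] bo(2) by simp
          then show False using sym[OF a(1)] cycle_point_pos_iff[OF a(1) r] a(2) by simp
        qed
        then show "b \<in> {a \<in> fiw_obj W n. cycle_point r 1 \<sigma> a}"
          using bo cycle_point_pos_iff[OF bo(1) r] cycle_point_pos_iff[OF a(1) r] a(2) by simp
      qed
      have "cycle_point r 1 \<sigma> (- a)"
        using a(2) weyl_funpow_neg[OF a(1) neg[OF a(1)]] by (auto simp: cycle_point_def) (metis minus_minus)
      then show ?thesis using 1[OF a] 1[of "- a"] neg[OF a(1)] by blast
    qed
    have eq: "{a \<in> fiw_obj W n. cycle_point r 1 \<sigma> a} = \<Union>\<C>"
      unfolding \<C> using sub weyl_self_in_orbit by blast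
    moreover have "2 * r * card \<C> = card (\<Union>\<C>)"
    proof (rule card_partition)
      show "finite \<C>" unfolding \<C> by simp
      show "finite (\<Union>\<C>)" unfolding eq[symmetric] by simp
    next
      fix S assume "S \<in> \<C>"
      then obtain a where a: "a \<in> fiw_obj W n" "cycle_point r 1 \<sigma> a" "S = orbit \<sigma> a \<union> orbit \<sigma> (- a)"
        unfolding \<C> by auto
      have c: "card (orbit \<sigma> a) = r" "- a \<notin> orbit \<sigma> a" using cycle_point_pos_iff[OF a(1) r] a(2) by auto
      have na: "- a \<in> fiw_obj W n" using neg a by simp
      have "orbit \<sigma> a \<inter> orbit \<sigma> (- a) = {}"
        using orbit_disjoint[OF a(1) na] weyl_self_in_orbit[OF na] c(2) by auto
      moreover have "card (orbit \<sigma> (- a)) = r"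
        using c(1) weyl_orbit_uminus[OF a(1) na] by (simp add: card_image)
      ultimately show "card S = 2 * r"
        unfolding a(3) using c(1) finite_orbit[OF weyl_self_in_orbit[OF a(1)]] finite_orbit[OF weyl_self_in_orbit[OF na]]
        by (simp add: card_Un_disjoint)
    next
      fix S S' assume S: "S \<in> \<C>" "S' \<in> \<C>" "S \<noteq> S'"
      then obtain a b where ab: "a \<in> fiw_obj W n" "S = orbit \<sigma> a \<union> orbit \<sigma> (- a)"
        "b \<in> fiw_obj W n" "S' = orbit \<sigma> b \<union> orbit \<sigma> (- b)"
        unfolding \<C> by auto
      \<comment> \<open>Each point of a support recovers it as the union of its own orbit and the
        orbit of its negative, so supports with a common point coincide.\<close>
      have SS: "S = orbit \<sigma> x \<union> orbit \<sigma> (- x)" if "x \<in> S" "a \<in> fiw_obj W n" "S = orbit \<sigma> a \<union> orbit \<sigma> (- a)" for x a S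
      proof -
        have na: "- a \<in> fiw_obj W n" using neg that by simp
        have x: "x \<in> fiw_obj W n" "- x \<in> fiw_obj W n"
          using that weyl_orbit_subset[OF that(2)] weyl_orbit_subset[OF na] neg by auto
        from that(1,3) consider "x \<in> orbit \<sigma> a" | "x \<in> orbit \<sigma> (- a)" by auto
        then show ?thesis
        proof cases
          case 1
          then have "orbit \<sigma> x = orbit \<sigma> a" using weyl_orbit_eq[OF that(2)] by simp
          then show ?thesis using that(3) weyl_orbit_uminus[OF that(2) na] weyl_orbit_uminus[OF x] by simp
        next
          case 2
          then have "orbit \<sigma> x = orbit \<sigma> (- a)" using weyl_orbit_eq[OF na] by simp
          then show ?thesis using that(3) weyl_orbit_uminus[OF that(2) na] weyl_orbit_uminus[OF x]
            by (simp add: image_image Un_commute)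
        qed
      qed
      show "S \<inter> S' = {}" using SS[OF _ ab(1,2)] SS[OF _ ab(3,4)] S(3) by blast
    qed
    ultimately show ?thesis using TypeBC PosCycles by (simp add: pos_cycles_def \<C>_def)
  qed
  then show ?thesis using PosCycles by (cases W) simp_all
next
  case (NegCycles r)
  with v have r: "r > 0" and W: "W = TypeBC" by (auto simp: cycle_vars_def split: if_splits)
  have neg: "- a \<in> fiw_obj W n" if "a \<in> fiw_obj W n" for a using that W by (auto simp: in_fiw_obj_iff)
  have sym: "uminus ` orbit \<sigma> a = orbit \<sigma> a \<longleftrightarrow> - a \<in> orbit \<sigma> a" if a: "a \<in> fiw_obj W n" for a
    using weyl_orbit_uminus[OF a neg[OF a]] weyl_self_in_orbit[OF a] weyl_orbit_eq[OF a, of "- a"] by auto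
  define \<C> where "\<C> = {S \<in> cycle_supports W n \<sigma>. uminus ` S = S \<and> card S = 2 * r}"
  have "{a \<in> fiw_obj W n. cycle_point r (-1) \<sigma> a} = \<Union>\<C>"
  proof (intro equalityI subsetI)
    fix a assume "a \<in> {a \<in> fiw_obj W n. cycle_point r (-1) \<sigma> a}"
    then have a: "a \<in> fiw_obj W n" "cycle_point r (-1) \<sigma> a" by auto
    then have "orbit \<sigma> a \<in> \<C>"
      using cycle_point_neg_iff[OF a(1) neg[OF a(1)] r] sym[OF a(1)] by (auto simp: \<C>_def cycle_supports_def)
    then show "a \<in> \<Union>\<C>" using weyl_self_in_orbit[OF a(1)] by blast
  next
    fix a assume "a \<in> \<Union>\<C>"
    then obtain b where b: "b \<in> fiw_obj W n" "a \<in> orbit \<sigma> b" "uminus ` orbit \<sigma> b = orbit \<sigma> b" "card (orbit \<sigma> b) = 2 * r"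
      by (auto simp: \<C>_def cycle_supports_def)
    then have a: "a \<in> fiw_obj W n" "orbit \<sigma> a = orbit \<sigma> b"
      using weyl_orbit_subset[OF b(1)] weyl_orbit_eq[OF b(1)] by auto
    then show "a \<in> {a \<in> fiw_obj W n. cycle_point r (-1) \<sigma> a}"
      using cycle_point_neg_iff[OF a(1) neg[OF a(1)] r] sym[OF a(1)] b by simp
  qed
  moreover have "2 * r * card \<C> = card (\<Union>\<C>)"
  proof (rule card_partition)
    show "finite \<C>" by (simp add: \<C>_def cycle_supports_def)
    have "\<Union>\<C> \<subseteq> fiw_obj W n" using weyl_orbit_subset by (auto simp: \<C>_def cycle_supports_def)
    then show "finite (\<Union>\<C>)" by (rule finite_subset) simp
  next
    fix S S' assume "S \<in> \<C>" "S' \<in> \<C>" "S \<noteq> S'"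
    then show "S \<inter> S' = {}" using orbit_disjoint by (auto simp: \<C>_def cycle_supports_def)
  qed (simp add: \<C>_def)
  ultimately have "card {a \<in> fiw_obj W n. cycle_point r (-1) \<sigma> a} = 2 * r * cycle_count W n \<sigma> v"
    using NegCycles by (simp add: neg_cycles_def \<C>_def)
  then show ?thesis using W NegCycles by simp
qed

end

section \<open>Morphisms, pattern counts and appended cycles\<close>

lemma fiw_hom_iff:
  "f \<in> fiw_hom W k n \<longleftrightarrow> f \<in> extensional (fiw_obj W k) \<and> f ` fiw_obj W k \<subseteq> fiw_obj W n \<and> inj_on f (fiw_obj W k) \<and>
     (\<forall>a. a \<in> fiw_obj W k \<longrightarrow> - a \<in> fiw_obj W k \<longrightarrow> f (- a) = - f a)"
proof -
  have "W = TypeBC \<longleftrightarrow> - a \<in> fiw_obj W k" if "a \<in> fiw_obj W k" for a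
    using that by (cases W) (auto simp: fiw_obj_def)
  then show ?thesis by (auto simp: fiw_hom_def PiE_iff)
qed

lemma fiw_hom_in: "f \<in> fiw_hom W k n \<Longrightarrow> a \<in> fiw_obj W k \<Longrightarrow> f a \<in> fiw_obj W n"
  and fiw_hom_inj: "f \<in> fiw_hom W k n \<Longrightarrow> inj_on f (fiw_obj W k)"
  and fiw_hom_neg: "f \<in> fiw_hom W k n \<Longrightarrow> a \<in> fiw_obj W k \<Longrightarrow> - a \<in> fiw_obj W k \<Longrightarrow> f (- a) = - f a"
  and fiw_hom_ext: "f \<in> fiw_hom W k n \<Longrightarrow> f \<in> extensional (fiw_obj W k)"
  by (auto simp: fiw_hom_iff)

lemma weyl_iff_hom: "\<sigma> \<in> weyl W n \<longleftrightarrow> \<sigma> \<in> fiw_hom W n n"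
proof
  assume "\<sigma> \<in> fiw_hom W n n"
  then show "\<sigma> \<in> weyl W n"
    by (simp add: weyl_def fiw_hom_iff bij_betw_def endo_inj_surj)
qed (simp add: weyl_def)

lemma finite_fiw_hom [simp]: "finite (fiw_hom W k n)"
proof -
  have "fiw_hom W k n \<subseteq> fiw_obj W k \<rightarrow>\<^sub>E fiw_obj W n" by (auto simp: fiw_hom_def)
  then show ?thesis by (rule finite_subset) (auto intro: finite_PiE)
qed

text \<open>The signs that preserve the objects of the family: only 1 in type A. Writing subscripts
  as a sign times an absolute value lets both families share one argument.\<close>

definition sign_in :: "family \<Rightarrow> int \<Rightarrow> bool" where
  "sign_in W s \<longleftrightarrow> s = 1 \<or> (s = -1 \<and> W = TypeBC)"

lemma sign_in_sgn: "x \<in> fiw_obj W n \<Longrightarrow> sign_in W (sgn x)"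
  by (cases W) (auto simp: sign_in_def in_fiw_obj_iff sgn_if)

lemma sign_in_mult: "sign_in W s \<Longrightarrow> sign_in W t \<Longrightarrow> sign_in W (s * t)"
  by (auto simp: sign_in_def)

lemma sign_in_square: "sign_in W s \<Longrightarrow> s * s = 1"
  by (auto simp: sign_in_def)

lemma sign_in_obj: "sign_in W s \<Longrightarrow> a \<in> fiw_obj W n \<Longrightarrow> s * a \<in> fiw_obj W n"
  by (auto simp: sign_in_def in_fiw_obj_iff)

lemma fiw_hom_sign: "f \<in> fiw_hom W k n \<Longrightarrow> sign_in W s \<Longrightarrow> a \<in> fiw_obj W k \<Longrightarrow> f (s * a) = s * f a"
  using sign_in_obj[of W s a k] by (auto simp: sign_in_def fiw_hom_neg)

lemma weyl_funpow_sign: "\<sigma> \<in> weyl W n \<Longrightarrow> sign_in W s \<Longrightarrow> a \<in> fiw_obj W n \<Longrightarrow> (\<sigma> ^^ i) (s * a) = s * (\<sigma> ^^ i) a"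
  using sign_in_obj[of W s a n] by (auto simp: sign_in_def weyl_funpow_neg)

text \<open>A member embeds \<open>\<tau>\<close> into \<open>\<sigma>\<close>: its image is stable
  under \<open>\<sigma>\<close>, which acts there as \<open>\<tau>\<close>. The cardinality is
  \<open>N\<^sub>\<tau>(\<sigma>)\<close>.\<close>

definition fix_set :: "family \<Rightarrow> nat \<Rightarrow> nat \<Rightarrow> (int \<Rightarrow> int) \<Rightarrow> (int \<Rightarrow> int) \<Rightarrow> (int \<Rightarrow> int) set" where
  "fix_set W k n \<tau> \<sigma> = {f \<in> fiw_hom W k n. \<forall>a\<in>fiw_obj W k. \<sigma> (f a) = f (\<tau> a)}"

lemma finite_fix_set [simp]: "finite (fix_set W k n \<tau> \<sigma>)"
  by (simp add: fix_set_def)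

text \<open>The new cycle runs through \<open>k + 1\<close>, ..., \<open>k + r\<close> and returns
  to \<open>k + 1\<close> with sign \<open>\<epsilon>\<close>. Thus one formula yields a positive
  cycle for \<open>\<epsilon> = 1\<close> and a negative one for \<open>\<epsilon> = -1\<close>; the
  factor \<open>sgn x\<close> makes it odd.\<close>

definition append_cycle :: "family \<Rightarrow> nat \<Rightarrow> (int \<Rightarrow> int) \<Rightarrow> nat \<Rightarrow> int \<Rightarrow> int \<Rightarrow> int" where
  "append_cycle W k \<tau> r \<epsilon> = (\<lambda>x\<in>fiw_obj W (k + r).
     if \<bar>x\<bar> \<le> int k then \<tau> x else if \<bar>x\<bar> < int (k + r) then x + sgn x else \<epsilon> * sgn x * int (k + 1))"

lemma fiw_obj_mono: "k \<le> n \<Longrightarrow> fiw_obj W k \<subseteq> fiw_obj W n"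
  by (auto simp: in_fiw_obj_iff)

lemma append_cycle_weyl:
  assumes \<tau>: "\<tau> \<in> weyl W k" and r: "r > 0" and \<epsilon>: "sign_in W \<epsilon>"
  shows "append_cycle W k \<tau> r \<epsilon> \<in> weyl W (k + r)"
proof (rule weylI)
  note \<epsilon> = \<epsilon>[unfolded sign_in_def]
  let ?\<tau> = "append_cycle W k \<tau> r \<epsilon>"
  have small: "?\<tau> x = \<tau> x" "\<tau> x \<in> fiw_obj W k" if "x \<in> fiw_obj W (k + r)" "\<bar>x\<bar> \<le> int k" for x
    using that weylD(1)[OF \<tau>, of x] by (auto simp: append_cycle_def in_fiw_obj_iff)
  have mid: "?\<tau> x = x + sgn x" if "x \<in> fiw_obj W (k + r)" "\<bar>x\<bar> > int k" "\<bar>x\<bar> < int (k + r)" for x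
    using that by (auto simp: append_cycle_def)
  have top: "?\<tau> x = \<epsilon> * sgn x * int (k + 1)" if "x \<in> fiw_obj W (k + r)" "\<bar>x\<bar> = int (k + r)" for x
    using that r by (auto simp: append_cycle_def)
  have tri: "P" if "x \<in> fiw_obj W (k + r)" "\<bar>x\<bar> \<le> int k \<Longrightarrow> P" "\<bar>x\<bar> > int k \<Longrightarrow> \<bar>x\<bar> < int (k + r) \<Longrightarrow> P" "\<bar>x\<bar> = int (k + r) \<Longrightarrow> P" for x P
  proof -
    have "\<bar>x\<bar> \<le> int (k + r)" using that(1) by (simp add: in_fiw_obj_iff)
    then consider "\<bar>x\<bar> \<le> int k" | "\<bar>x\<bar> > int k" "\<bar>x\<bar> < int (k + r)" | "\<bar>x\<bar> = int (k + r)" by linarith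
    then show P by cases (use that(2-4) in blast)+
  qed
  show "?\<tau> x \<in> fiw_obj W (k + r)" if x: "x \<in> fiw_obj W (k + r)" for x
    using x
  proof (rule tri)
    show "?\<tau> x \<in> fiw_obj W (k + r)" if "\<bar>x\<bar> \<le> int k" using small[OF x that] fiw_obj_mono[of k "k + r" W] by auto
  qed (use x r \<epsilon> mid[OF x] top[OF x] in \<open>auto simp: in_fiw_obj_iff sgn_if abs_mult\<close>)
  show "?\<tau> (- x) = - ?\<tau> x" if "W = TypeBC" "x \<in> fiw_obj W (k + r)" for x
  proof -
    have nx: "- x \<in> fiw_obj W (k + r)" using that by (auto simp: in_fiw_obj_iff)
    show ?thesis using that(2)
    proof (rule tri)
      assume "\<bar>x\<bar> \<le> int k"
      moreover have "\<tau> (- x) = - \<tau> x"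
        using calculation that by (intro weylD(5)[OF \<tau>]) (auto simp: in_fiw_obj_iff)
      ultimately show ?thesis using small(1)[OF that(2)] small(1)[OF nx] by simp
    qed (use mid[OF that(2)] mid[OF nx] top[OF that(2)] top[OF nx] in auto)
  qed
  show "inj_on ?\<tau> (fiw_obj W (k + r))"
  proof (rule inj_onI)
    have lo: "\<bar>?\<tau> x\<bar> \<le> int k" if "x \<in> fiw_obj W (k + r)" "\<bar>x\<bar> \<le> int k" for x
      using small[OF that] by (simp add: in_fiw_obj_iff)
    have mi: "\<bar>?\<tau> x\<bar> > int (k + 1)" if "x \<in> fiw_obj W (k + r)" "\<bar>x\<bar> > int k" "\<bar>x\<bar> < int (k + r)" for x
      using mid[OF that] that by (auto simp: sgn_if)
    have to: "\<bar>?\<tau> x\<bar> = int (k + 1)" if "x \<in> fiw_obj W (k + r)" "\<bar>x\<bar> = int (k + r)" for x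
    proof -
      have x: "\<bar>sgn x\<bar> = 1" using that(1) by (simp add: in_fiw_obj_iff abs_sgn_eq_1)
      have e: "\<bar>\<epsilon>\<bar> = 1" using \<epsilon> by auto
      show ?thesis by (simp only: top[OF that] abs_mult x e mult_1 abs_of_nat)
    qed
    fix x y assume x: "x \<in> fiw_obj W (k + r)" and y: "y \<in> fiw_obj W (k + r)" and eq: "?\<tau> x = ?\<tau> y"
    show "x = y" using x
    proof (rule tri)
      assume xs: "\<bar>x\<bar> \<le> int k"
      have ys: "\<bar>y\<bar> \<le> int k" by (rule tri[OF y]) (use xs lo[OF x] mi[OF y] to[OF y] eq in auto)
      have "x \<in> fiw_obj W k" "y \<in> fiw_obj W k" using x y xs ys by (auto simp: in_fiw_obj_iff)
      then show ?thesis using eq small(1)[OF x xs] small(1)[OF y ys] inj_onD[OF weylD(2)[OF \<tau>]] by simp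
    next
      assume xm: "\<bar>x\<bar> > int k" "\<bar>x\<bar> < int (k + r)"
      have "\<bar>y\<bar> > int k \<and> \<bar>y\<bar> < int (k + r)" by (rule tri[OF y]) (use xm mi[OF x] lo[OF y] to[OF y] eq in auto)
      then have ym: "\<bar>y\<bar> > int k" "\<bar>y\<bar> < int (k + r)" by auto
      show ?thesis using eq mid[OF x xm] mid[OF y ym] xm ym by (auto simp: sgn_if split: if_splits)
    next
      assume xt: "\<bar>x\<bar> = int (k + r)"
      have yt: "\<bar>y\<bar> = int (k + r)" by (rule tri[OF y]) (use xt mi[OF y] lo[OF y] to[OF x] eq in auto)
      show ?thesis using eq top[OF x xt] top[OF y yt] xt yt \<epsilon> r by (auto simp: sgn_if split: if_splits)
    qed
  qed
qed (simp add: append_cycle_def)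

lemma fix_set_funpow:
  assumes "\<tau> \<in> weyl W k" "f \<in> fix_set W k n \<tau> \<sigma>" "x \<in> fiw_obj W k"
  shows "(\<sigma> ^^ i) (f x) = f ((\<tau> ^^ i) x)"
  using assms weyl_funpow_in[OF assms(1,3)] by (induction i) (auto simp: fix_set_def)

text \<open>An injective intertwiner preserves and reflects every relation between powers and signs.
  In type A the relations involving \<open>- x\<close> fail on both sides by positivity.\<close>

lemma cycle_point_fix_set:
  assumes \<tau>: "\<tau> \<in> weyl W k" and f: "f \<in> fix_set W k n \<tau> \<sigma>" and x: "x \<in> fiw_obj W k"
    and \<epsilon>: "sign_in W \<epsilon>"
  shows "cycle_point r \<epsilon> \<sigma> (f x) \<longleftrightarrow> cycle_point r \<epsilon> \<tau> x"
proof -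
  have f': "f \<in> fiw_hom W k n" using f by (simp add: fix_set_def)
  have pos: "(\<sigma> ^^ i) (f x) = f x \<longleftrightarrow> (\<tau> ^^ i) x = x" for i
    using fix_set_funpow[OF \<tau> f x] inj_onD[OF fiw_hom_inj[OF f']] weyl_funpow_in[OF \<tau> x] x by metis
  have neg: "(\<sigma> ^^ i) (f x) = - f x \<longleftrightarrow> (\<tau> ^^ i) x = - x" for i
  proof (cases W)
    case TypeA
    have "(\<tau> ^^ i) x > 0" "x > 0" "f ((\<tau> ^^ i) x) > 0" "f x > 0"
      using fiw_hom_in[OF f'] weyl_funpow_in[OF \<tau> x, of i] x TypeA by (auto simp: in_fiw_obj_iff)
    then show ?thesis using fix_set_funpow[OF \<tau> f x, of i] by auto
  next
    case TypeBC
    then have nx: "- x \<in> fiw_obj W k" using x by (auto simp: in_fiw_obj_iff)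
    then show ?thesis
      using inj_on_eq_iff[OF fiw_hom_inj[OF f'] weyl_funpow_in[OF \<tau> x, of i] nx]
      by (simp only: fix_set_funpow[OF \<tau> f x] fiw_hom_neg[OF f' x nx, symmetric])
  qed
  show ?thesis using \<epsilon>[unfolded sign_in_def] pos neg by (auto simp: cycle_point_def)
qed


lemma append_cycle_funpow:
  assumes "i < r"
  shows "(append_cycle W k \<tau> r \<epsilon> ^^ i) (int (k + 1)) = int (k + 1 + i)"
  using assms
proof (induction i)
  case (Suc i)
  have "int (k + 1 + i) \<in> fiw_obj W (k + r)" using Suc.prems by (auto simp: in_fiw_obj_iff)
  then show ?case using Suc by (simp add: append_cycle_def)
qed simp

lemma append_cycle_point:
  assumes "r > 0"
  shows "cycle_point r \<epsilon> (append_cycle W k \<tau> r \<epsilon>) (int (k + 1))"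
proof -
  let ?\<tau> = "append_cycle W k \<tau> r \<epsilon>"
  have top: "int (k + r) \<in> fiw_obj W (k + r)" using assms by (auto simp: in_fiw_obj_iff)
  have "(?\<tau> ^^ r) (int (k + 1)) = ?\<tau> ((?\<tau> ^^ (r - 1)) (int (k + 1)))"
    using assms by (metis Suc_pred' funpow.simps(2) o_apply)
  also have "\<dots> = ?\<tau> (int (k + r))" using append_cycle_funpow[of "r - 1" r W k \<tau> \<epsilon>] assms by simp
  also have "\<dots> = \<epsilon> * int (k + 1)" using top assms by (simp add: append_cycle_def)
  finally show ?thesis using append_cycle_funpow[of _ r W k \<tau> \<epsilon>] by (simp add: cycle_point_def)
qed

text \<open>Both sides count pairs of a morphism \<open>f\<close> in the fix set and a point
  \<open>a\<close> on an \<open>r\<close>-cycle of \<open>\<sigma>\<close> of sign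
  \<open>\<epsilon>\<close>. Points in the image of \<open>f\<close> correspond to cycle points of
  \<open>\<tau>\<close>. If \<open>a\<close> is outside the image, so is its whole cycle, and the
  pair amounts to the extension of \<open>f\<close> that sends \<open>k + 1 + i\<close> to
  \<open>(\<sigma> ^^ i) a\<close>.\<close>

lemma card_fix_set_times_cycle_points:
  assumes \<sigma>: "\<sigma> \<in> weyl W n" and \<tau>: "\<tau> \<in> weyl W k" and r: "r > 0" and \<epsilon>: "sign_in W \<epsilon>"
  shows "card (fix_set W k n \<tau> \<sigma>) * card {a \<in> fiw_obj W n. cycle_point r \<epsilon> \<sigma> a} =
    card {x \<in> fiw_obj W k. cycle_point r \<epsilon> \<tau> x} * card (fix_set W k n \<tau> \<sigma>) +
    card (fix_set W (k + r) n (append_cycle W k \<tau> r \<epsilon>) \<sigma>)"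
proof -
  define \<tau>' where "\<tau>' = append_cycle W k \<tau> r \<epsilon>"
  have \<tau>': "\<tau>' \<in> weyl W (k + r)" unfolding \<tau>'_def by (rule append_cycle_weyl[OF \<tau> r \<epsilon>])
  define F where "F = fix_set W k n \<tau> \<sigma>"
  define C where "C = {a \<in> fiw_obj W n. cycle_point r \<epsilon> \<sigma> a}"
  define A where "A f = {a \<in> C. a \<notin> f ` fiw_obj W k}" for f
  have finC: "finite C" by (simp add: C_def)
  have split: "card C = card {x \<in> fiw_obj W k. cycle_point r \<epsilon> \<tau> x} + card (A f)" if f: "f \<in> F" for f
  proof -
    have f': "f \<in> fiw_hom W k n" using f by (simp add: F_def fix_set_def)
    have "C = f ` {x \<in> fiw_obj W k. cycle_point r \<epsilon> \<tau> x} \<union> A f"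
      using cycle_point_fix_set[OF \<tau> f[unfolded F_def] _ \<epsilon>] fiw_hom_in[OF f'] by (auto simp: C_def A_def)
    moreover have "f ` {x \<in> fiw_obj W k. cycle_point r \<epsilon> \<tau> x} \<inter> A f = {}" by (auto simp: A_def)
    moreover have "card (f ` {x \<in> fiw_obj W k. cycle_point r \<epsilon> \<tau> x}) = card {x \<in> fiw_obj W k. cycle_point r \<epsilon> \<tau> x}"
      by (rule card_image[OF inj_on_subset[OF fiw_hom_inj[OF f']]]) auto
    moreover have "finite (A f)" using finC by (simp add: A_def)
    ultimately show ?thesis by (simp add: card_Un_disjoint)
  qed
  have "card F * card C = (\<Sum>f\<in>F. card C)" by simp
  also have "\<dots> = card {x \<in> fiw_obj W k. cycle_point r \<epsilon> \<tau> x} * card F + (\<Sum>f\<in>F. card (A f))"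
    using split by (simp add: sum.distrib)
  also have "(\<Sum>f\<in>F. card (A f)) = card (Sigma F A)"
    using finC by (subst card_SigmaI) (auto simp: F_def A_def)
  also have "\<dots> = card (fix_set W (k + r) n \<tau>' \<sigma>)"
  proof -
    \<comment> \<open>A member of the larger fix set is determined by its restriction to
      \<open>k\<close> and its value at \<open>k + 1\<close>, since \<open>\<tau>'\<close> carries
      \<open>k + 1\<close> through the remaining positions. \<open>\<Psi>\<close> rebuilds it from
      these data.\<close>
    define \<Phi> where "\<Phi> g = (restrict g (fiw_obj W k), g (int (k + 1)))" for g :: "int \<Rightarrow> int"
    define \<Psi> where "\<Psi> = (\<lambda>(f :: int \<Rightarrow> int, a). \<lambda>x\<in>fiw_obj W (k + r). if \<bar>x\<bar> \<le> int k then f x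
       else sgn x * (\<sigma> ^^ (nat \<bar>x\<bar> - k - 1)) a)"
    have base: "int (k + 1) \<in> fiw_obj W (k + r)" using r by (auto simp: in_fiw_obj_iff)
    have obj_k: "x \<in> fiw_obj W k \<longleftrightarrow> x \<in> fiw_obj W (k + r) \<and> \<bar>x\<bar> \<le> int k" for x
      by (auto simp: in_fiw_obj_iff)
    have big: "nat \<bar>x\<bar> - k - 1 < r" "x = sgn x * int (k + 1 + (nat \<bar>x\<bar> - k - 1))" if "x \<in> fiw_obj W (k + r)" "\<not> \<bar>x\<bar> \<le> int k" for x
    proof -
      have "int (k + 1 + (nat \<bar>x\<bar> - k - 1)) = \<bar>x\<bar>" using that by auto
      then show "x = sgn x * int (k + 1 + (nat \<bar>x\<bar> - k - 1))" by (simp only: sgn_mult_abs)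
      show "nat \<bar>x\<bar> - k - 1 < r" using that by (auto simp: in_fiw_obj_iff)
    qed
    have "bij_betw \<Phi> (fix_set W (k + r) n \<tau>' \<sigma>) (Sigma F A)"
    proof (rule bij_betw_byWitness[where f' = \<Psi>])
      show "\<forall>g\<in>fix_set W (k + r) n \<tau>' \<sigma>. \<Psi> (\<Phi> g) = g"
      proof
        fix g assume g: "g \<in> fix_set W (k + r) n \<tau>' \<sigma>"
        then have g': "g \<in> fiw_hom W (k + r) n" by (simp add: fix_set_def)
        show "\<Psi> (\<Phi> g) = g"
        proof
          fix x
          show "\<Psi> (\<Phi> g) x = g x"
          proof (cases "x \<in> fiw_obj W (k + r)")
            case False
            then show ?thesis using fiw_hom_ext[OF g'] by (simp add: \<Psi>_def \<Phi>_def extensional_def)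
          next
            case x: True
            show ?thesis
            proof (cases "\<bar>x\<bar> \<le> int k")
              case True
              then show ?thesis using x obj_k[of x] by (simp add: \<Psi>_def \<Phi>_def)
            next
              case False
              define i where "i = nat \<bar>x\<bar> - k - 1"
              note big = big[OF x False, folded i_def]
              have "int (k + 1 + i) \<in> fiw_obj W (k + r)" using big(1) by (auto simp: in_fiw_obj_iff)
              then have "g x = sgn x * g (int (k + 1 + i))"
                using fiw_hom_sign[OF g' sign_in_sgn[OF x]] big(2) by metis
              also have "g (int (k + 1 + i)) = (\<sigma> ^^ i) (g (int (k + 1)))"
                using fix_set_funpow[OF \<tau>' g base, of i] append_cycle_funpow[OF big(1), of W k \<tau> \<epsilon>] by (simp add: \<tau>'_def)
              finally show ?thesis using x False by (simp add: \<Psi>_def \<Phi>_def i_def)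
            qed
          qed
        qed
      qed
      show "\<forall>p\<in>Sigma F A. \<Phi> (\<Psi> p) = p"
      proof
        fix p assume "p \<in> Sigma F A"
        then obtain f a where p: "p = (f, a)" "f \<in> F" "a \<in> A f" by auto
        have "f \<in> extensional (fiw_obj W k)" using p(2) by (auto simp: F_def fix_set_def fiw_hom_ext)
        then have "restrict (\<Psi> p) (fiw_obj W k) = f"
          using obj_k by (auto simp: \<Psi>_def p(1) extensional_def restrict_def)
        moreover have "\<Psi> p (int (k + 1)) = a" using base by (simp add: \<Psi>_def p(1))
        ultimately show "\<Phi> (\<Psi> p) = p" by (simp add: \<Phi>_def p(1))
      qed
      show "\<Phi> ` fix_set W (k + r) n \<tau>' \<sigma> \<subseteq> Sigma F A"
      proof (rule image_subsetI)
        fix g assume g: "g \<in> fix_set W (k + r) n \<tau>' \<sigma>"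
        then have g': "g \<in> fiw_hom W (k + r) n" by (simp add: fix_set_def)
        have "restrict g (fiw_obj W k) \<in> F"
        proof -
          have "\<sigma> (g a) = g (\<tau> a)" "\<tau> a \<in> fiw_obj W k" if "a \<in> fiw_obj W k" for a
            using g that obj_k[of a] weylD(1)[OF \<tau> that] by (auto simp: fix_set_def \<tau>'_def append_cycle_def)
          moreover have "restrict g (fiw_obj W k) \<in> fiw_hom W k n"
            using g' obj_k unfolding fiw_hom_iff by (auto simp: inj_on_def)
          ultimately show ?thesis by (simp add: F_def fix_set_def)
        qed
        moreover have "g (int (k + 1)) \<in> C"
          using cycle_point_fix_set[OF \<tau>' g base \<epsilon>] append_cycle_point[OF r] fiw_hom_in[OF g' base] by (simp add: C_def \<tau>'_def)
        moreover have "g (int (k + 1)) \<noteq> g x" if "x \<in> fiw_obj W k" for x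
        proof
          assume "g (int (k + 1)) = g x"
          then have "int (k + 1) = x" using inj_onD[OF fiw_hom_inj[OF g']] base that obj_k by blast
          then show False using that by (auto simp: in_fiw_obj_iff)
        qed
        ultimately show "\<Phi> g \<in> Sigma F A" by (auto simp: \<Phi>_def A_def)
      qed
      show "\<Psi> ` Sigma F A \<subseteq> fix_set W (k + r) n \<tau>' \<sigma>"
      proof clarify
        fix f a assume f: "f \<in> F" and a: "a \<in> A f"
        have f': "f \<in> fiw_hom W k n" using f by (simp add: F_def fix_set_def)
        have a': "a \<in> fiw_obj W n" "cycle_point r \<epsilon> \<sigma> a" "a \<notin> f ` fiw_obj W k" using a by (auto simp: A_def C_def)
        define g where "g = \<Psi> (f, a)"
        have g_small: "g x = f x" if "x \<in> fiw_obj W k" for x using that obj_k[of x] by (simp add: g_def \<Psi>_def)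
        have g_big: "g (s * int (k + 1 + i)) = s * (\<sigma> ^^ i) a" if s: "sign_in W s" and "i < r" for s i
        proof -
          have "int (k + 1 + i) \<in> fiw_obj W (k + r)" using that by (auto simp: in_fiw_obj_iff)
          then have "s * int (k + 1 + i) \<in> fiw_obj W (k + r)" using sign_in_obj[OF s] by blast
          moreover have "\<bar>s * int (k + 1 + i)\<bar> = int (k + 1 + i)" "sgn (s * int (k + 1 + i)) = s"
            using s by (auto simp: sign_in_def)
          ultimately show ?thesis by (simp add: g_def \<Psi>_def del: of_nat_add of_nat_Suc)
        qed
        have \<sigma>a: "(\<sigma> ^^ i) a \<in> fiw_obj W n" for i by (rule weyl_funpow_in[OF \<sigma> a'(1)])
        have decomp: "P" if "x \<in> fiw_obj W (k + r)" "x \<in> fiw_obj W k \<Longrightarrow> P"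
            "\<And>s i. sign_in W s \<Longrightarrow> i < r \<Longrightarrow> x = s * int (k + 1 + i) \<Longrightarrow> P" for x P
          using that(2,3) obj_k[of x] big[of x] sign_in_sgn[OF that(1)] that(1) by blast
        have odd: "g (- x) = - g x" if "x \<in> fiw_obj W (k + r)" "- x \<in> fiw_obj W (k + r)" for x
        proof (rule decomp[OF that(1)])
          assume x: "x \<in> fiw_obj W k"
          have "- x \<in> fiw_obj W k" using that(2) x by (auto simp: in_fiw_obj_iff)
          then show ?thesis using g_small x fiw_hom_neg[OF f'] by simp
        next
          fix s i assume x: "sign_in W s" "i < r" "x = s * int (k + 1 + i)"
          have "sign_in W (- s)" using that x(1) by (cases W) (auto simp: sign_in_def in_fiw_obj_iff)
          then show ?thesis using g_big[OF x(1,2)] g_big[of "- s" i] x by simp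
        qed
        have into: "g x \<in> fiw_obj W n" if "x \<in> fiw_obj W (k + r)" for x
        proof (rule decomp[OF that])
          show "g x \<in> fiw_obj W n" if "x \<in> fiw_obj W k" using g_small[OF that] fiw_hom_in[OF f' that] by simp
          show "g x \<in> fiw_obj W n" if "sign_in W s" "i < r" "x = s * int (k + 1 + i)" for s i
            using g_big[OF that(1,2)] sign_in_obj[OF that(1) \<sigma>a] that(3) by simp
        qed
        \<comment> \<open>The rest of the cycle avoids the image too: were
          \<open>s * (\<sigma> ^^ i) a\<close> hit by \<open>f\<close>, applying the power
          \<open>r - i\<close> would put \<open>s * \<epsilon> * a\<close>, and hence
          \<open>a\<close>, into the image.\<close>
        have sep: "f x \<noteq> s * (\<sigma> ^^ i) a" if "x \<in> fiw_obj W k" "sign_in W s" "i < r" for x s i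
        proof
          assume eq: "f x = s * (\<sigma> ^^ i) a"
          define y where "y = (\<tau> ^^ (r - i)) x"
          have y: "y \<in> fiw_obj W k" unfolding y_def by (rule weyl_funpow_in[OF \<tau> that(1)])
          have "f y = (\<sigma> ^^ (r - i)) (s * (\<sigma> ^^ i) a)"
            unfolding y_def using fix_set_funpow[OF \<tau> f[unfolded F_def] that(1)] eq by metis
          also have "\<dots> = s * (\<sigma> ^^ (r - i + i)) a"
            using weyl_funpow_sign[OF \<sigma> that(2) \<sigma>a] by (simp only: funpow_add o_apply)
          also have "\<dots> = (s * \<epsilon>) * a" using a'(2) that(3) by (simp add: cycle_point_def)
          finally have "f ((s * \<epsilon>) * y) = (s * \<epsilon>) * ((s * \<epsilon>) * a)"
            using fiw_hom_sign[OF f' sign_in_mult[OF that(2) \<epsilon>] y] by simp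
          also have "\<dots> = a" using sign_in_square[OF sign_in_mult[OF that(2) \<epsilon>]] by (metis mult.assoc mult_1)
          finally show False using a'(3) sign_in_obj[OF sign_in_mult[OF that(2) \<epsilon>] y] by (metis imageI)
        qed
        \<comment> \<open>Minimality in \<open>cycle_point\<close> excludes both \<open>a\<close>
          and \<open>- a\<close> at intermediate powers. So the power is determined, and then so is
          the sign because \<open>a\<close> is nonzero.\<close>
        have inj1: "s = t \<and> i = j" if "sign_in W s" "sign_in W t" "i \<le> j" "j < r" "s * (\<sigma> ^^ i) a = t * (\<sigma> ^^ j) a" for s t i j
        proof -
          have st: "sign_in W (s * t)" using sign_in_mult that by blast
          have "(\<sigma> ^^ i) a = (s * t) * (\<sigma> ^^ j) a"
            using that(5) sign_in_square[OF that(1)] by (metis mult.assoc mult_1)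
          also have "\<dots> = (\<sigma> ^^ i) ((s * t) * (\<sigma> ^^ (j - i)) a)"
            using weyl_funpow_sign[OF \<sigma> st \<sigma>a] that(3) by (metis funpow_add le_add_diff_inverse o_apply)
          finally have e: "a = (s * t) * (\<sigma> ^^ (j - i)) a"
            using weyl_funpow_inj[OF \<sigma> a'(1) sign_in_obj[OF st \<sigma>a]] by blast
          have "(\<sigma> ^^ (j - i)) a = a \<or> (\<sigma> ^^ (j - i)) a = - a" using e st by (auto simp: sign_in_def)
          then have "j - i = 0" using a'(2) that(4) unfolding cycle_point_def
            by (metis less_imp_diff_less not_gr_zero)
          then have "i = j" "a = (s * t) * a" using e that(3) by auto
          then show ?thesis using fiw_obj_nonzero[OF a'(1)] that(1,2) by (auto simp: sign_in_def)
        qed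
        have inj2: "s = t \<and> i = j" if "sign_in W s" "sign_in W t" "i < r" "j < r" "s * (\<sigma> ^^ i) a = t * (\<sigma> ^^ j) a" for s t i j
          using inj1[of s t i j] inj1[of t s j i] that by (metis linear)
        have "inj_on g (fiw_obj W (k + r))"
        proof (rule inj_onI)
          fix x y assume xy: "x \<in> fiw_obj W (k + r)" "y \<in> fiw_obj W (k + r)" "g x = g y"
          show "x = y"
          proof (rule decomp[OF xy(1)]; rule decomp[OF xy(2)])
            assume "x \<in> fiw_obj W k" "y \<in> fiw_obj W k"
            then show ?thesis using xy(3) g_small inj_onD[OF fiw_hom_inj[OF f']] by simp
          next
            fix s i assume "x \<in> fiw_obj W k" "sign_in W s" "i < r" "y = s * int (k + 1 + i)"
            then show ?thesis using xy(3) g_small g_big sep by metis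
          next
            fix s i assume "y \<in> fiw_obj W k" "sign_in W s" "i < r" "x = s * int (k + 1 + i)"
            then show ?thesis using xy(3) g_small g_big sep by metis
          next
            fix s i t j assume "sign_in W s" "i < r" "x = s * int (k + 1 + i)" "sign_in W t" "j < r" "y = t * int (k + 1 + j)"
            then show ?thesis using xy(3) g_big inj2[of s t i j] by metis
          qed
        qed
        moreover have "g \<in> extensional (fiw_obj W (k + r))" by (simp add: g_def \<Psi>_def)
        ultimately have "g \<in> fiw_hom W (k + r) n"
          unfolding fiw_hom_iff using odd into by auto
        moreover have "\<sigma> (g x) = g (\<tau>' x)" if "x \<in> fiw_obj W (k + r)" for x
        proof (rule decomp[OF that])
          assume x: "x \<in> fiw_obj W k"
          have "\<tau>' x = \<tau> x" using x obj_k by (auto simp: \<tau>'_def append_cycle_def)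
          then show ?thesis using g_small[OF x] g_small[OF weylD(1)[OF \<tau> x]] f x by (simp add: F_def fix_set_def)
        next
          fix s i assume x: "sign_in W s" "i < r" "x = s * int (k + 1 + i)"
          have \<tau>x: "\<tau>' x = s * \<tau>' (int (k + 1 + i))"
            using x(2) fiw_hom_sign[of \<tau>' W "k + r" "k + r" s "int (k + 1 + i)"] \<tau>' x(1,3) by (auto simp: weyl_iff_hom in_fiw_obj_iff)
          have \<sigma>g: "\<sigma> (g x) = s * (\<sigma> ^^ Suc i) a"
            using g_big[OF x(1,2)] x(3) weyl_funpow_sign[OF \<sigma> x(1) \<sigma>a, of 1 i] by simp
          show ?thesis
          proof (cases "Suc i < r")
            case True
            then have "\<tau>' (int (k + 1 + i)) = int (k + 1 + Suc i)" by (simp add: \<tau>'_def append_cycle_def in_fiw_obj_iff)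
            then show ?thesis using \<tau>x \<sigma>g g_big[OF x(1) True] by simp
          next
            case False
            then have i: "Suc i = r" using x(2) by simp
            then have "\<tau>' (int (k + 1 + i)) = \<epsilon> * int (k + 1 + 0)" by (auto simp: \<tau>'_def append_cycle_def in_fiw_obj_iff)
            then have "g (\<tau>' x) = g ((s * \<epsilon>) * int (k + 1 + 0))" using \<tau>x by (simp add: mult.assoc)
            also have "\<dots> = (s * \<epsilon>) * a" using g_big[OF sign_in_mult[OF x(1) \<epsilon>] r] by simp
            finally show ?thesis using \<sigma>g a'(2) by (simp only: i) (simp add: cycle_point_def)
          qed
        qed
        ultimately show "\<Psi> (f, a) \<in> fix_set W (k + r) n \<tau>' \<sigma>" by (simp add: fix_set_def g_def)
      qed
    qed
    then show ?thesis by (simp add: bij_betw_same_card)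
  qed
  finally show ?thesis by (simp add: F_def C_def \<tau>'_def)
qed

text \<open>The rule \<open>cong\<close> identifies functions that agree on the groups, because the
  recursion for cycle counts holds at group elements. Scalars are complex, since the recursion
  divides by the number of points on a cycle and the inner product is complex anyway.\<close>

inductive_set pattern_span :: "family \<Rightarrow> (nat \<Rightarrow> (int \<Rightarrow> int) \<Rightarrow> complex) set" for W where
  pattern: "\<tau> \<in> weyl W k \<Longrightarrow> (\<lambda>n \<sigma>. of_nat (card (fix_set W k n \<tau> \<sigma>))) \<in> pattern_span W"
| add: "Q \<in> pattern_span W \<Longrightarrow> Q' \<in> pattern_span W \<Longrightarrow> (\<lambda>n \<sigma>. Q n \<sigma> + Q' n \<sigma>) \<in> pattern_span W"
| scale: "Q \<in> pattern_span W \<Longrightarrow> (\<lambda>n \<sigma>. c * Q n \<sigma>) \<in> pattern_span W"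
| cong: "Q \<in> pattern_span W \<Longrightarrow> (\<And>n \<sigma>. \<sigma> \<in> weyl W n \<Longrightarrow> Q' n \<sigma> = Q n \<sigma>) \<Longrightarrow> Q' \<in> pattern_span W"

text \<open>The counting identity, divided by the number \<open>M\<close> of points on one cycle,
  writes the product as a combination of two pattern counts: the given one and the one with a cycle
  appended.\<close>

lemma pattern_span_times_cycle_count:
  assumes v: "v \<in> cycle_vars W" and "Q \<in> pattern_span W"
  shows "(\<lambda>n \<sigma>. of_nat (cycle_count W n \<sigma> v) * Q n \<sigma>) \<in> pattern_span W"
  using assms(2)
proof (induction rule: pattern_span.induct)
  case (pattern \<tau> k)
  define r where "r = var_len v"
  define \<epsilon> where "\<epsilon> = var_sgn v"
  have r: "r > 0" and \<epsilon>: "sign_in W \<epsilon>"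
    using v by (auto simp: cycle_vars_def r_def \<epsilon>_def sign_in_def split: if_splits)
  define M where "M = (if W = TypeA then 1 else 2) * r"
  define c where "c = card {x \<in> fiw_obj W k. cycle_point r \<epsilon> \<tau> x}"
  define \<tau>' where "\<tau>' = append_cycle W k \<tau> r \<epsilon>"
  have \<tau>': "\<tau>' \<in> weyl W (k + r)" unfolding \<tau>'_def by (rule append_cycle_weyl[OF pattern r \<epsilon>])
  have M: "M > 0" using r by (simp add: M_def)
  have "of_nat (cycle_count W n \<sigma> v) * (of_nat (card (fix_set W k n \<tau> \<sigma>)) :: complex) =
      (of_nat c / of_nat M) * of_nat (card (fix_set W k n \<tau> \<sigma>)) + (1 / of_nat M) * of_nat (card (fix_set W (k + r) n \<tau>' \<sigma>))"
    if "\<sigma> \<in> weyl W n" for n \<sigma>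
  proof -
    have "card (fix_set W k n \<tau> \<sigma>) * (M * cycle_count W n \<sigma> v) =
        c * card (fix_set W k n \<tau> \<sigma>) + card (fix_set W (k + r) n \<tau>' \<sigma>)"
      using card_fix_set_times_cycle_points[OF that pattern r \<epsilon>] card_cycle_points[OF that v]
      by (simp add: c_def M_def r_def \<epsilon>_def \<tau>'_def)
    then have "of_nat (card (fix_set W k n \<tau> \<sigma>)) * (of_nat M * (of_nat (cycle_count W n \<sigma> v) :: complex)) =
        of_nat c * of_nat (card (fix_set W k n \<tau> \<sigma>)) + of_nat (card (fix_set W (k + r) n \<tau>' \<sigma>))"
      by (metis of_nat_add of_nat_mult)
    then show ?thesis using M by (simp add: field_simps)
  qed
  with pattern_span.add[OF pattern_span.scale[OF pattern_span.pattern[OF pattern]] pattern_span.scale[OF pattern_span.pattern[OF \<tau>']]]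
  show ?case by (rule pattern_span.cong)
next
  case (add Q Q')
  from pattern_span.add[OF add.IH] show ?case by (simp add: algebra_simps)
next
  case (scale Q c)
  from pattern_span.scale[OF scale.IH, of c] show ?case by (simp add: algebra_simps)
next
  case (cong Q Q')
  from cong.IH show ?case by (rule pattern_span.cong) (simp add: cong.hyps)
qed

text \<open>The object \<open>0\<close> is empty, and the unique morphism out of it intertwines with
  every \<open>\<sigma>\<close>.\<close>

lemma pattern_span_one: "(\<lambda>n \<sigma>. 1) \<in> pattern_span W"
proof -
  have 0: "fiw_obj W' 0 = {}" for W' by (cases W') (auto simp: fiw_obj_def)
  have "(\<lambda>_. undefined) \<in> weyl W 0" by (rule weylI) (simp_all add: 0)
  moreover have "fix_set W 0 n \<tau> \<sigma> = {\<lambda>_. undefined}" for n \<tau> \<sigma>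
    by (auto simp: fix_set_def fiw_hom_iff 0)
  ultimately show ?thesis using pattern_span.pattern[of "\<lambda>_. undefined" W 0] by simp
qed

lemma pattern_span_zero: "(\<lambda>n \<sigma>. 0) \<in> pattern_span W"
  using pattern_span.scale[OF pattern_span_one, of 0] by simp

lemma pattern_span_sum:
  assumes "\<And>i. i \<in> I \<Longrightarrow> Q i \<in> pattern_span W"
  shows "(\<lambda>n \<sigma>. \<Sum>i\<in>I. Q i n \<sigma>) \<in> pattern_span W"
  using assms
  by (induction I rule: infinite_finite_induct) (auto intro: pattern_span_zero pattern_span.add)

lemma char_poly_in_pattern_span:
  assumes \<iota>: "field_embedding \<iota>" and P: "is_char_poly W P"
  shows "(\<lambda>n \<sigma>. \<iota> (char_poly_eval W P n \<sigma>)) \<in> pattern_span W"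
proof -
  have monom: "(\<lambda>n \<sigma>. \<Prod>v\<in>K. of_nat (cycle_count W n \<sigma> v) ^ e v) \<in> pattern_span W"
    if "finite K" "K \<subseteq> cycle_vars W" for K and e :: "cycle_var \<Rightarrow> nat"
    using that
  proof (induction K rule: finite_induct)
    case empty
    then show ?case by (simp add: pattern_span_one)
  next
    case (insert v K)
    have "(\<lambda>n \<sigma>. of_nat (cycle_count W n \<sigma> v) ^ j * (\<Prod>v\<in>K. of_nat (cycle_count W n \<sigma> v) ^ e v)) \<in> pattern_span W" for j
    proof (induction j)
      case 0
      then show ?case using insert by simp
    next
      case (Suc j)
      have "v \<in> cycle_vars W" using insert.prems by simp
      from pattern_span_times_cycle_count[OF this Suc] show ?case by (simp add: mult.assoc)
    qed
    then show ?case using insert.hyps by simp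
  qed
  have "(\<lambda>n \<sigma>. \<Sum>m\<in>Poly_Mapping.keys P. \<iota> (Poly_Mapping.lookup P m) *
      (\<Prod>v\<in>Poly_Mapping.keys m. of_nat (cycle_count W n \<sigma> v) ^ Poly_Mapping.lookup m v)) \<in> pattern_span W"
    using P by (intro pattern_span_sum pattern_span.scale monom) (auto simp: is_char_poly_def)
  then show ?thesis by (simp add: char_poly_eval_def field_embedding_simps[OF \<iota>])
qed

section \<open>Averages over the stabiliser of a subobject\<close>

lemma compose_hom:
  assumes f: "f \<in> fiw_hom W l m" and g: "g \<in> fiw_hom W m n"
  shows "compose (fiw_obj W l) g f \<in> fiw_hom W l n"
  unfolding fiw_hom_iff
proof (intro conjI allI impI)
  note fin = fiw_hom_in[OF f]
  show "compose (fiw_obj W l) g f ` fiw_obj W l \<subseteq> fiw_obj W n"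
    using fin fiw_hom_in[OF g] by (auto simp: compose_def)
  show "inj_on (compose (fiw_obj W l) g f) (fiw_obj W l)"
    using fin fiw_hom_inj[OF f] fiw_hom_inj[OF g] by (auto simp: compose_def inj_on_def)
  fix a assume a: "a \<in> fiw_obj W l" "- a \<in> fiw_obj W l"
  then have "- f a \<in> fiw_obj W m" using fin[OF a(2)] fiw_hom_neg[OF f a] by simp
  then show "compose (fiw_obj W l) g f (- a) = - compose (fiw_obj W l) g f a"
    using a fin fiw_hom_neg[OF f a] fiw_hom_neg[OF g] by (simp add: compose_def)
qed (simp add: compose_def)

lemma compose_weyl: "\<sigma> \<in> weyl W n \<Longrightarrow> \<tau> \<in> weyl W n \<Longrightarrow> compose (fiw_obj W n) \<sigma> \<tau> \<in> weyl W n"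
  using compose_hom[of \<tau> W n n \<sigma> n] by (simp add: weyl_iff_hom)

lemma fiw_id_weyl: "fiw_id W n \<in> weyl W n"
  by (rule weylI) (auto simp: fiw_id_def inj_on_def in_fiw_obj_iff)

lemma finite_weyl [simp]: "finite (weyl W n)"
  using finite_fiw_hom[of W n n] by (rule finite_subset[rotated]) (auto simp: weyl_iff_hom)

definition weyl_inv :: "family \<Rightarrow> nat \<Rightarrow> (int \<Rightarrow> int) \<Rightarrow> int \<Rightarrow> int" where
  "weyl_inv W n \<sigma> = (\<lambda>a\<in>fiw_obj W n. inv_into (fiw_obj W n) \<sigma> a)"

lemma weyl_inv:
  assumes \<sigma>: "\<sigma> \<in> weyl W n"
  shows "weyl_inv W n \<sigma> \<in> weyl W n" "a \<in> fiw_obj W n \<Longrightarrow> weyl_inv W n \<sigma> (\<sigma> a) = a"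
    "a \<in> fiw_obj W n \<Longrightarrow> \<sigma> (weyl_inv W n \<sigma> a) = a"
proof -
  note D = weylD[OF \<sigma>]
  show 1: "weyl_inv W n \<sigma> (\<sigma> a) = a" if "a \<in> fiw_obj W n" for a
    using D(1,2) that by (simp add: weyl_inv_def)
  show 2: "\<sigma> (weyl_inv W n \<sigma> a) = a" if "a \<in> fiw_obj W n" for a
    using D(4) that by (simp add: weyl_inv_def f_inv_into_f)
  have 3: "weyl_inv W n \<sigma> a \<in> fiw_obj W n" if "a \<in> fiw_obj W n" for a
    using D(4) that inv_into_into[of a \<sigma> "fiw_obj W n"] by (simp add: weyl_inv_def)
  show "weyl_inv W n \<sigma> \<in> weyl W n"
  proof (rule weylI)
    show "inj_on (weyl_inv W n \<sigma>) (fiw_obj W n)" by (rule inj_on_inverseI[of _ \<sigma>]) (rule 2)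
    show "weyl_inv W n \<sigma> (- a) = - weyl_inv W n \<sigma> a" if "W = TypeBC" "a \<in> fiw_obj W n" for a
    proof -
      have neg: "- b \<in> fiw_obj W n" if "b \<in> fiw_obj W n" for b using that \<open>W = TypeBC\<close> by (auto simp: in_fiw_obj_iff)
      have "\<sigma> (- weyl_inv W n \<sigma> a) = - a" using D(5)[OF 3[OF that(2)] neg[OF 3[OF that(2)]]] 2[OF that(2)] by simp
      then show ?thesis using 1[OF neg[OF 3[OF that(2)]]] by simp
    qed
  qed (use 3 in \<open>auto simp: weyl_inv_def\<close>)
qed

lemma weyl_eqI:
  assumes "\<sigma> \<in> weyl W n" "\<sigma>' \<in> weyl W n" "\<And>a. a \<in> fiw_obj W n \<Longrightarrow> \<sigma> a = \<sigma>' a"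
  shows "\<sigma> = \<sigma>'"
  using assms weylD(3) by (meson extensionalityI)

text \<open>The absolute values missed by \<open>S\<close> and by \<open>f ` S\<close> are matched up arbitrarily.\<close>

lemma extend_to_weyl:
  assumes S: "S \<subseteq> fiw_obj W n" "\<And>a. a \<in> S \<Longrightarrow> W = TypeBC \<Longrightarrow> - a \<in> S"
    and f: "f ` S \<subseteq> fiw_obj W n" "inj_on f S" "\<And>a. a \<in> S \<Longrightarrow> W = TypeBC \<Longrightarrow> f (- a) = - f a"
  obtains g where "g \<in> weyl W n" "\<And>a. a \<in> S \<Longrightarrow> g a = f a"
proof -
  define ab where "ab a = nat \<bar>a\<bar>" for a :: int
  define A where "A = ab ` S"
  define B where "B = ab ` f ` S"
  have ab_eq: "a = b \<or> (W = TypeBC \<and> a = - b)" if "a \<in> fiw_obj W n" "b \<in> fiw_obj W n" "ab a = ab b" for a b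
    using that by (cases W) (auto simp: ab_def in_fiw_obj_iff)
  have A_iff: "ab a \<in> A \<longleftrightarrow> a \<in> S" if a: "a \<in> fiw_obj W n" for a
  proof
    assume "ab a \<in> A"
    then obtain b where b: "b \<in> S" "ab a = ab b" by (auto simp: A_def)
    then show "a \<in> S" using ab_eq[OF a _ b(2)] S by auto
  qed (simp add: A_def)
  have fab: "ab (f a) = ab (f b) \<longleftrightarrow> ab a = ab b" if ab: "a \<in> S" "b \<in> S" for a b
  proof
    assume "ab a = ab b"
    then have "a = b \<or> (W = TypeBC \<and> a = - b)" using ab_eq S(1) ab by blast
    then show "ab (f a) = ab (f b)" using f(3)[OF ab(2)] by (auto simp: ab_def)
  next
    assume "ab (f a) = ab (f b)"
    then have "f a = f b \<or> (W = TypeBC \<and> f a = - f b)" using ab_eq f(1) ab by blast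
    then have "f a = f b \<or> (W = TypeBC \<and> f a = f (- b))" using f(3)[OF ab(2)] by auto
    then have "a = b \<or> a = - b" using inj_onD[OF f(2)] ab S(2) by blast
    then show "ab a = ab b" by (auto simp: ab_def)
  qed
  have card: "card A = card B"
  proof -
    \<comment> \<open>The map induced by \<open>f\<close> on absolute values. By \<open>fab\<close>
      it does not depend on the chosen representative and is injective.\<close>
    define F where "F i = ab (f (SOME a. a \<in> S \<and> ab a = i))" for i
    have F: "F (ab a) = ab (f a)" if "a \<in> S" for a
    proof -
      have "(SOME a'. a' \<in> S \<and> ab a' = ab a) \<in> S \<and> ab (SOME a'. a' \<in> S \<and> ab a' = ab a) = ab a"
        by (rule someI[of _ a]) (use that in simp)
      then show ?thesis unfolding F_def using fab that by blast
    qed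
    have "bij_betw F A B"
      unfolding bij_betw_def
    proof
      show "inj_on F A" by (rule inj_onI) (auto simp: A_def F fab)
      show "F ` A = B" by (auto simp: A_def B_def F image_image)
    qed
    then show ?thesis by (rule bij_betw_same_card)
  qed
  have sub: "A \<subseteq> {1..n}" "B \<subseteq> {1..n}"
    using S(1) f(1) by (auto simp: A_def B_def ab_def in_fiw_obj_iff image_subset_iff subset_iff nat_le_iff)
  then have "card ({1..n} - A) = card ({1..n} - B)"
    using card by (simp add: card_Diff_subset finite_subset)
  then obtain p where p: "bij_betw p ({1..n} - A) ({1..n} - B)"
    using finite_same_card_bij[of "{1..n} - A" "{1..n} - B"] by auto
  define g where "g = (\<lambda>a\<in>fiw_obj W n. if a \<in> S then f a else sgn a * int (p (ab a)))"
  have pa: "p (ab a) \<in> {1..n} - B" if "a \<in> fiw_obj W n" "a \<notin> S" for a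
  proof -
    have "ab a \<in> {1..n} - A" using that A_iff[OF that(1)] by (auto simp: ab_def in_fiw_obj_iff)
    then show ?thesis using bij_betwE[OF p] by blast
  qed
  have gS: "g a = f a" if "a \<in> S" for a using that S(1) by (auto simp: g_def)
  have gN: "g a = sgn a * int (p (ab a))" "ab (g a) = p (ab a)" if "a \<in> fiw_obj W n" "a \<notin> S" for a
    using that by (auto simp: g_def ab_def abs_mult in_fiw_obj_iff sgn_if)
  have "g \<in> weyl W n"
  proof (rule weylI)
    show "g a \<in> fiw_obj W n" if "a \<in> fiw_obj W n" for a
    proof (cases "a \<in> S")
      case True then show ?thesis using gS f(1) by auto
    next
      case False
      show ?thesis unfolding gN(1)[OF that False]
        by (rule sign_in_obj[OF sign_in_sgn[OF that]]) (use pa[OF that False] in \<open>auto simp: in_fiw_obj_iff\<close>)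
    qed
    show "inj_on g (fiw_obj W n)"
    proof (rule inj_onI)
      have mixed: "g a \<noteq> g b" if "a \<in> S" "b \<in> fiw_obj W n" "b \<notin> S" for a b
      proof
        assume "g a = g b"
        then have "p (ab b) = ab (f a)" using gS[OF that(1)] gN(2)[OF that(2,3)] by simp
        then have "p (ab b) \<in> B" using that(1) by (simp add: B_def)
        then show False using pa[OF that(2,3)] by simp
      qed
      fix a b assume ab: "a \<in> fiw_obj W n" "b \<in> fiw_obj W n" "g a = g b"
      consider "a \<in> S" "b \<in> S" | "a \<notin> S" "b \<notin> S" using mixed[of a b] mixed[of b a] ab by auto
      then show "a = b"
      proof cases
        case 1
        then show ?thesis using ab(3) gS inj_onD[OF f(2)] by simp
      next
        case 2
        have "ab a \<in> {1..n} - A" "ab b \<in> {1..n} - A"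
          using ab 2 A_iff by (auto simp: ab_def in_fiw_obj_iff)
        moreover have pe: "p (ab a) = p (ab b)" using gN(2)[OF ab(1) 2(1)] gN(2)[OF ab(2) 2(2)] ab(3) by simp
        ultimately have "ab a = ab b" using p by (auto simp: bij_betw_def inj_on_def)
        moreover have "sgn a = sgn b"
          using gN(1)[OF ab(1) 2(1)] gN(1)[OF ab(2) 2(2)] ab(3) pe pa[OF ab(2) 2(2)] by auto
        ultimately show ?thesis unfolding ab_def by (metis sgn_mult_abs nat_0_le abs_ge_zero)
      qed
    qed
    show "g (- a) = - g a" if "W = TypeBC" "a \<in> fiw_obj W n" for a
    proof -
      have na: "- a \<in> fiw_obj W n" using that by (auto simp: in_fiw_obj_iff)
      have iff: "- a \<in> S \<longleftrightarrow> a \<in> S" using S(2) that(1) by fastforce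
      show ?thesis
      proof (cases "a \<in> S")
        case True
        then show ?thesis using iff gS f(3)[OF True that(1)] by simp
      next
        case False
        then show ?thesis using iff gN(1)[OF that(2) False] gN(1)[OF na] by (simp add: ab_def)
      qed
    qed
  qed (simp add: g_def)
  then show ?thesis using that gS by blast
qed

lemma extend_hom:
  assumes "f \<in> fiw_hom W k n" "k \<le> n"
  obtains g where "g \<in> weyl W n" "\<And>a. a \<in> fiw_obj W k \<Longrightarrow> g a = f a"
proof (rule extend_to_weyl[of "fiw_obj W k" W n f])
  show "fiw_obj W k \<subseteq> fiw_obj W n" using fiw_obj_mono[OF assms(2)] .
  show neg: "- a \<in> fiw_obj W k" if "a \<in> fiw_obj W k" "W = TypeBC" for a using that by (auto simp: in_fiw_obj_iff)
  show "f (- a) = - f a" if "a \<in> fiw_obj W k" "W = TypeBC" for a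
    using neg[OF that] fiw_hom_neg[OF assms(1) that(1)] by simp
qed (use assms fiw_hom_inj[OF assms(1)] fiw_hom_in[OF assms(1)] that in auto)

section \<open>The pointwise stabiliser and its cosets\<close>

definition stab :: "family \<Rightarrow> nat \<Rightarrow> nat \<Rightarrow> (int \<Rightarrow> int) set" where
  "stab W k n = {h \<in> weyl W n. \<forall>a\<in>fiw_obj W k. h a = a}"

text \<open>A convenient choice: any other lift of \<open>\<tau>\<close> to the larger group differs
  from it by an element of the stabiliser and so acts in the same way on invariants.\<close>

definition extend_id :: "family \<Rightarrow> nat \<Rightarrow> nat \<Rightarrow> (int \<Rightarrow> int) \<Rightarrow> int \<Rightarrow> int" where
  "extend_id W k n \<tau> = (\<lambda>a\<in>fiw_obj W n. if a \<in> fiw_obj W k then \<tau> a else a)"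

lemma stab_weyl: "h \<in> stab W k n \<Longrightarrow> h \<in> weyl W n"
  by (simp add: stab_def)

lemma finite_stab [simp]: "finite (stab W k n)"
  by (simp add: stab_def)

lemma fiw_id_stab: "k \<le> n \<Longrightarrow> fiw_id W n \<in> stab W k n"
  using fiw_id_weyl fiw_obj_mono[of k n W] by (auto simp: stab_def fiw_id_def)

lemma card_stab_pos: "k \<le> n \<Longrightarrow> card (stab W k n) > 0"
  using fiw_id_stab by (auto simp: card_gt_0_iff)

lemma extend_id:
  assumes \<tau>: "\<tau> \<in> weyl W k" and kn: "k \<le> n"
  shows "extend_id W k n \<tau> \<in> weyl W n" "a \<in> fiw_obj W k \<Longrightarrow> extend_id W k n \<tau> a = \<tau> a"
proof -
  note D = weylD[OF \<tau>]
  have sub: "fiw_obj W k \<subseteq> fiw_obj W n" by (rule fiw_obj_mono[OF kn])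
  show "a \<in> fiw_obj W k \<Longrightarrow> extend_id W k n \<tau> a = \<tau> a" using sub by (auto simp: extend_id_def)
  have neg: "- a \<in> fiw_obj W k \<longleftrightarrow> a \<in> fiw_obj W k" if "W = TypeBC" for a
    using that by (auto simp: in_fiw_obj_iff)
  show "extend_id W k n \<tau> \<in> weyl W n"
  proof (rule weylI)
    show "inj_on (extend_id W k n \<tau>) (fiw_obj W n)"
      using D(1,2) by (auto simp: extend_id_def inj_on_def)
    show "extend_id W k n \<tau> (- a) = - extend_id W k n \<tau> a" if "W = TypeBC" "a \<in> fiw_obj W n" for a
    proof -
      have "- a \<in> fiw_obj W n" using that by (auto simp: in_fiw_obj_iff)
      then show ?thesis using that neg[OF that(1)] D(5) by (auto simp: extend_id_def)
    qed
  qed (use D(1) sub in \<open>auto simp: extend_id_def\<close>)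
qed

text \<open>The lifts of \<open>f\<close> form a left coset of the stabiliser:
  \<open>extend_hom\<close> supplies one of them, and composing with its inverse carries the others
  into the stabiliser.\<close>

lemma card_stab_coset:
  assumes f: "f \<in> fiw_hom W k n" and kn: "k \<le> n"
  shows "card {g \<in> weyl W n. \<forall>a\<in>fiw_obj W k. g a = f a} = card (stab W k n)"
proof -
  obtain g where g: "g \<in> weyl W n" "\<And>a. a \<in> fiw_obj W k \<Longrightarrow> g a = f a" using extend_hom[OF f kn] by blast
  have sub: "fiw_obj W k \<subseteq> fiw_obj W n" by (rule fiw_obj_mono[OF kn])
  have "bij_betw (compose (fiw_obj W n) g) (stab W k n) {g \<in> weyl W n. \<forall>a\<in>fiw_obj W k. g a = f a}"
  proof (rule bij_betw_byWitness[where f' = "compose (fiw_obj W n) (weyl_inv W n g)"])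
    show "\<forall>h\<in>stab W k n. compose (fiw_obj W n) (weyl_inv W n g) (compose (fiw_obj W n) g h) = h"
    proof
      fix h assume "h \<in> stab W k n"
      then have h: "h \<in> weyl W n" by (rule stab_weyl)
      show "compose (fiw_obj W n) (weyl_inv W n g) (compose (fiw_obj W n) g h) = h"
        by (rule weyl_eqI[OF _ h], intro compose_weyl weyl_inv(1) g(1) h)
          (simp add: compose_def weyl_inv[OF g(1)] weylD(1)[OF h] weylD(1)[OF g(1)] weylD(1)[OF weyl_inv(1)[OF g(1)]])
    qed
    show "\<forall>h\<in>{g \<in> weyl W n. \<forall>a\<in>fiw_obj W k. g a = f a}. compose (fiw_obj W n) g (compose (fiw_obj W n) (weyl_inv W n g) h) = h"
    proof
      fix h assume "h \<in> {g \<in> weyl W n. \<forall>a\<in>fiw_obj W k. g a = f a}"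
      then have h: "h \<in> weyl W n" by simp
      show "compose (fiw_obj W n) g (compose (fiw_obj W n) (weyl_inv W n g) h) = h"
        by (rule weyl_eqI[OF _ h], intro compose_weyl weyl_inv(1) g(1) h)
          (simp add: compose_def weyl_inv[OF g(1)] weylD(1)[OF h] weylD(1)[OF g(1)] weylD(1)[OF weyl_inv(1)[OF g(1)]])
    qed
    show "compose (fiw_obj W n) g ` stab W k n \<subseteq> {g \<in> weyl W n. \<forall>a\<in>fiw_obj W k. g a = f a}"
      using compose_weyl g sub by (auto simp: stab_def compose_def)
    show "compose (fiw_obj W n) (weyl_inv W n g) ` {g \<in> weyl W n. \<forall>a\<in>fiw_obj W k. g a = f a} \<subseteq> stab W k n"
    proof (rule image_subsetI)
      fix h assume h: "h \<in> {g \<in> weyl W n. \<forall>a\<in>fiw_obj W k. g a = f a}"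
      have "compose (fiw_obj W n) (weyl_inv W n g) h a = a" if a: "a \<in> fiw_obj W k" for a
      proof -
        have an: "a \<in> fiw_obj W n" using a sub by auto
        have "h a = g a" using h g(2) a by simp
        then show ?thesis using weyl_inv(2)[OF g(1) an] an by (simp add: compose_def)
      qed
      then show "compose (fiw_obj W n) (weyl_inv W n g) h \<in> stab W k n"
        using compose_weyl[OF weyl_inv(1)[OF g(1)]] h by (simp add: stab_def)
    qed
  qed
  then show ?thesis by (simp add: bij_betw_same_card)
qed

text \<open>Restriction to \<open>k\<close> partitions the group into these cosets, one for each
  morphism.\<close>

lemma card_hom_stab:
  assumes kn: "k \<le> n"
  shows "card (fiw_hom W k n) * card (stab W k n) = card (weyl W n)"
proof -
  have sub: "fiw_obj W k \<subseteq> fiw_obj W n" by (rule fiw_obj_mono[OF kn])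
  have "weyl W n = (\<Union>f\<in>fiw_hom W k n. {g \<in> weyl W n. \<forall>a\<in>fiw_obj W k. g a = f a})"
  proof (intro equalityI subsetI)
    fix g assume g: "g \<in> weyl W n"
    have "restrict g (fiw_obj W k) \<in> fiw_hom W k n"
      unfolding fiw_hom_iff
    proof (intro conjI allI impI)
      show "inj_on (restrict g (fiw_obj W k)) (fiw_obj W k)"
        using inj_on_subset[OF weylD(2)[OF g] sub] by simp
      show "restrict g (fiw_obj W k) (- a) = - restrict g (fiw_obj W k) a" if "a \<in> fiw_obj W k" "- a \<in> fiw_obj W k" for a
        using weylD(5)[OF g] that sub by (simp add: subset_iff)
    qed (use weylD(1)[OF g] sub in auto)
    then show "g \<in> (\<Union>f\<in>fiw_hom W k n. {g \<in> weyl W n. \<forall>a\<in>fiw_obj W k. g a = f a})"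
      using g by (auto intro!: bexI[of _ "restrict g (fiw_obj W k)"])
  qed auto
  moreover have "card (\<Union>f\<in>fiw_hom W k n. {g \<in> weyl W n. \<forall>a\<in>fiw_obj W k. g a = f a}) =
      (\<Sum>f\<in>fiw_hom W k n. card {g \<in> weyl W n. \<forall>a\<in>fiw_obj W k. g a = f a})"
  proof (rule card_UN_disjoint)
    show "\<forall>f\<in>fiw_hom W k n. \<forall>f'\<in>fiw_hom W k n. f \<noteq> f' \<longrightarrow>
        {g \<in> weyl W n. \<forall>a\<in>fiw_obj W k. g a = f a} \<inter> {g \<in> weyl W n. \<forall>a\<in>fiw_obj W k. g a = f' a} = {}"
    proof (intro ballI impI)
      fix f f' assume f: "f \<in> fiw_hom W k n" "f' \<in> fiw_hom W k n" "f \<noteq> f'"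
      have False if g: "\<forall>a\<in>fiw_obj W k. g a = f a" "\<forall>a\<in>fiw_obj W k. g a = f' a" for g
        using extensionalityI[OF fiw_hom_ext[OF f(1)] fiw_hom_ext[OF f(2)]] g f(3) by metis
      then show "{g \<in> weyl W n. \<forall>a\<in>fiw_obj W k. g a = f a} \<inter> {g \<in> weyl W n. \<forall>a\<in>fiw_obj W k. g a = f' a} = {}"
        by blast
    qed
  qed auto
  ultimately show ?thesis using card_stab_coset[OF _ kn] by simp
qed

text \<open>Exchange the sums, fix \<open>f\<close>, and lift it to \<open>g\<close> in the group.
  The \<open>\<sigma>\<close> satisfying the intertwining condition for \<open>f\<close> are exactly
  the conjugates by \<open>g\<close> of \<open>extend_id W k n \<tau>\<close> composed with
  stabiliser elements. A class function does not see \<open>g\<close>, so every \<open>f\<close>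
  contributes the same sum.\<close>

lemma sum_fix_set:
  fixes \<chi> :: "(int \<Rightarrow> int) \<Rightarrow> 'c::comm_semiring_1"
  assumes \<tau>: "\<tau> \<in> weyl W k" and kn: "k \<le> n"
    and \<chi>: "\<And>g \<sigma>. g \<in> weyl W n \<Longrightarrow> \<sigma> \<in> weyl W n \<Longrightarrow>
      \<chi> (compose (fiw_obj W n) g (compose (fiw_obj W n) \<sigma> (weyl_inv W n g))) = \<chi> \<sigma>"
  shows "(\<Sum>\<sigma>\<in>weyl W n. of_nat (card (fix_set W k n \<tau> \<sigma>)) * \<chi> \<sigma>) =
    of_nat (card (fiw_hom W k n)) * (\<Sum>h\<in>stab W k n. \<chi> (compose (fiw_obj W n) (extend_id W k n \<tau>) h))"
proof -
  let ?c = "compose (fiw_obj W n)"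
  let ?\<tau> = "extend_id W k n \<tau>"
  have sub: "fiw_obj W k \<subseteq> fiw_obj W n" by (rule fiw_obj_mono[OF kn])
  note \<tau>' = extend_id[OF \<tau> kn]
  have fibre: "(\<Sum>\<sigma>\<in>{\<sigma> \<in> weyl W n. f \<in> fix_set W k n \<tau> \<sigma>}. \<chi> \<sigma>) = (\<Sum>h\<in>stab W k n. \<chi> (?c ?\<tau> h))"
    if f: "f \<in> fiw_hom W k n" for f
  proof -
    obtain g where g: "g \<in> weyl W n" "\<And>a. a \<in> fiw_obj W k \<Longrightarrow> g a = f a" using extend_hom[OF f kn] by blast
    note gi = weyl_inv[OF g(1)] and ti = weyl_inv[OF \<tau>'(1)]
    note in_n = weylD(1)[OF g(1)] weylD(1)[OF gi(1)] weylD(1)[OF \<tau>'(1)] weylD(1)[OF ti(1)]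
    show ?thesis
    proof (rule sum.reindex_bij_witness[where j = "\<lambda>\<sigma>. ?c (weyl_inv W n ?\<tau>) (?c (weyl_inv W n g) (?c \<sigma> g))"
          and i = "\<lambda>h. ?c g (?c (?c ?\<tau> h) (weyl_inv W n g))"])
      fix \<sigma> assume "\<sigma> \<in> {\<sigma> \<in> weyl W n. f \<in> fix_set W k n \<tau> \<sigma>}"
      then have \<sigma>: "\<sigma> \<in> weyl W n" "\<And>a. a \<in> fiw_obj W k \<Longrightarrow> \<sigma> (f a) = f (\<tau> a)" by (auto simp: fix_set_def)
      note in_n = in_n weylD(1)[OF \<sigma>(1)]
      show eq: "?c g (?c (?c ?\<tau> (?c (weyl_inv W n ?\<tau>) (?c (weyl_inv W n g) (?c \<sigma> g)))) (weyl_inv W n g)) = \<sigma>"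
        by (rule weyl_eqI[OF _ \<sigma>(1)], intro compose_weyl g(1) gi(1) ti(1) \<tau>'(1) \<sigma>(1))
          (simp add: compose_def gi(2,3) ti(2,3) in_n)
      have "?c (weyl_inv W n ?\<tau>) (?c (weyl_inv W n g) (?c \<sigma> g)) a = a" if a: "a \<in> fiw_obj W k" for a
      proof -
        have an: "a \<in> fiw_obj W n" using a sub by auto
        have ta: "\<tau> a \<in> fiw_obj W k" using weylD(1)[OF \<tau> a] .
        then have tan: "\<tau> a \<in> fiw_obj W n" using sub by auto
        have "\<sigma> (g a) = g (\<tau> a)" using \<sigma>(2)[OF a] g(2)[OF a] g(2)[OF ta] by simp
        then have "?c (weyl_inv W n ?\<tau>) (?c (weyl_inv W n g) (?c \<sigma> g)) a = weyl_inv W n ?\<tau> (?\<tau> a)"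
          using an gi(2)[OF tan] \<tau>'(2)[OF a] by (simp add: compose_def)
        then show ?thesis using ti(2)[OF an] by simp
      qed
      then show "?c (weyl_inv W n ?\<tau>) (?c (weyl_inv W n g) (?c \<sigma> g)) \<in> stab W k n"
        using compose_weyl g gi ti \<tau>' \<sigma> by (simp add: stab_def)
      have "\<chi> (?c ?\<tau> (?c (weyl_inv W n ?\<tau>) (?c (weyl_inv W n g) (?c \<sigma> g)))) =
         \<chi> (?c g (?c (?c ?\<tau> (?c (weyl_inv W n ?\<tau>) (?c (weyl_inv W n g) (?c \<sigma> g)))) (weyl_inv W n g)))"
        using \<chi> compose_weyl g gi ti \<tau>' \<sigma> by metis
      then show "\<chi> (?c ?\<tau> (?c (weyl_inv W n ?\<tau>) (?c (weyl_inv W n g) (?c \<sigma> g)))) = \<chi> \<sigma>" using eq by simp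
    next
      fix h assume h': "h \<in> stab W k n"
      then have h: "h \<in> weyl W n" "\<And>a. a \<in> fiw_obj W k \<Longrightarrow> h a = a" by (auto simp: stab_def)
      note in_n = in_n weylD(1)[OF h(1)]
      show "?c (weyl_inv W n ?\<tau>) (?c (weyl_inv W n g) (?c (?c g (?c (?c ?\<tau> h) (weyl_inv W n g))) g)) = h"
        by (rule weyl_eqI[OF _ h(1)], intro compose_weyl g(1) gi(1) ti(1) \<tau>'(1) h(1))
          (simp add: compose_def gi(2,3) ti(2,3) in_n)
      have "?c g (?c (?c ?\<tau> h) (weyl_inv W n g)) (f a) = f (\<tau> a)" if a: "a \<in> fiw_obj W k" for a
      proof -
        have an: "a \<in> fiw_obj W n" using a sub by auto
        have ta: "\<tau> a \<in> fiw_obj W k" using weylD(1)[OF \<tau> a] .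
        have "weyl_inv W n g (f a) = a" using gi(2)[OF an] g(2)[OF a] by simp
        then show ?thesis using fiw_hom_in[OF f a] an h(2)[OF a] \<tau>'(2)[OF a] g(2)[OF ta] by (simp add: compose_def)
      qed
      then show "?c g (?c (?c ?\<tau> h) (weyl_inv W n g)) \<in> {\<sigma> \<in> weyl W n. f \<in> fix_set W k n \<tau> \<sigma>}"
        using f compose_weyl g gi \<tau>' h by (simp add: fix_set_def)
    qed
  qed
  have "(\<Sum>\<sigma>\<in>weyl W n. of_nat (card (fix_set W k n \<tau> \<sigma>)) * \<chi> \<sigma>) =
      (\<Sum>\<sigma>\<in>weyl W n. \<Sum>f\<in>fiw_hom W k n. if f \<in> fix_set W k n \<tau> \<sigma> then \<chi> \<sigma> else 0)"
  proof (rule sum.cong[OF refl])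
    fix \<sigma>
    have "(\<Sum>f\<in>fiw_hom W k n. if f \<in> fix_set W k n \<tau> \<sigma> then \<chi> \<sigma> else 0) = (\<Sum>f\<in>fix_set W k n \<tau> \<sigma>. \<chi> \<sigma>)"
      by (simp add: fix_set_def flip: sum.inter_filter)
    then show "of_nat (card (fix_set W k n \<tau> \<sigma>)) * \<chi> \<sigma> = (\<Sum>f\<in>fiw_hom W k n. if f \<in> fix_set W k n \<tau> \<sigma> then \<chi> \<sigma> else 0)"
      by simp
  qed
  also have "\<dots> = (\<Sum>f\<in>fiw_hom W k n. \<Sum>\<sigma>\<in>{\<sigma> \<in> weyl W n. f \<in> fix_set W k n \<tau> \<sigma>}. \<chi> \<sigma>)"
    by (subst sum.swap) (simp flip: sum.inter_filter)
  also have "\<dots> = of_nat (card (fiw_hom W k n)) * (\<Sum>h\<in>stab W k n. \<chi> (?c ?\<tau> h))"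
    using fibre by simp
  finally show ?thesis .
qed

context vspace
begin

lemma linear_map_on_sum:
  assumes "vspace t" "subspace V" "linear_map_on scale t V f" "\<And>i. i \<in> I \<Longrightarrow> g i \<in> V"
  shows "f (\<Sum>i\<in>I. g i) = (\<Sum>i\<in>I. f (g i))"
proof -
  interpret P: vector_space_pair scale t
    by (intro vector_space_pair.intro vector_space_axioms assms(1)[unfolded vspace_def])
  obtain f' where f': "Vector_Spaces.linear scale t f'" "\<And>x. x \<in> V \<Longrightarrow> f' x = f x"
    using linear_map_on_extend[OF assms(1,2,3)] by metis
  have "(\<Sum>i\<in>I. g i) \<in> V" by (rule subspace_sum[OF assms(2)]) (rule assms(4))
  then have "f (\<Sum>i\<in>I. g i) = f' (\<Sum>i\<in>I. g i)" using f'(2) by simp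
  then show ?thesis using f'(2)[OF assms(4)] by (simp add: P.linear_sum[OF f'(1)])
qed

lemma linear_map_on_image:
  assumes t: "vspace t" and U: "subspace U" and f: "linear_map_on scale t U f" and S: "finite S" "U \<subseteq> span S"
  obtains S' where "finite S'" "card S' \<le> card S" "f ` U \<subseteq> module.span t S'" "module.subspace t (f ` U)"
proof -
  interpret t: vspace t by fact
  interpret P: vector_space_pair scale t by unfold_locales
  obtain f' where f': "Vector_Spaces.linear scale t f'" "\<And>x. x \<in> U \<Longrightarrow> f' x = f x"
    using linear_map_on_extend[OF t U f] by metis
  have im: "f ` U = f' ` U" using f'(2) by auto
  obtain C where C: "basis_of U C" using basis_of_exists[OF U] .
  note card = basis_of_card_le[OF C S]
  have "f' ` U = t.span (f' ` C)" using C P.linear_span_image[OF f'(1), of C] by (simp add: basis_of_def)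
  moreover have "card (f' ` C) \<le> card S" using card card_image_le le_trans by blast
  ultimately show ?thesis using that[of "f' ` C"] card(1) by (simp add: im)
qed

end

lemma stab_compose:
  assumes "g \<in> stab W k n" "h \<in> stab W k n" "k \<le> n"
  shows "compose (fiw_obj W n) g h \<in> stab W k n"
proof -
  have "compose (fiw_obj W n) g h a = a" if "a \<in> fiw_obj W k" for a
    using that assms fiw_obj_mono[OF assms(3), of W] by (auto simp: stab_def compose_def)
  then show ?thesis using assms compose_weyl by (auto simp: stab_def)
qed

lemma stab_inv:
  assumes "g \<in> stab W k n" "k \<le> n" shows "weyl_inv W n g \<in> stab W k n"
proof -
  have "weyl_inv W n g a = a" if "a \<in> fiw_obj W k" for a
  proof -
    have "a \<in> fiw_obj W n" using that fiw_obj_mono[OF assms(2), of W] by auto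
    from weyl_inv(2)[OF stab_weyl[OF assms(1)] this] show ?thesis using assms(1) that by (simp add: stab_def)
  qed
  then show ?thesis using weyl_inv(1)[OF stab_weyl[OF assms(1)]] by (simp add: stab_def)
qed

lemma stab_reindex:
  fixes F :: "(int \<Rightarrow> int) \<Rightarrow> 'c::comm_monoid_add"
  assumes g: "g \<in> stab W k n" and kn: "k \<le> n"
  shows "(\<Sum>h\<in>stab W k n. F (compose (fiw_obj W n) g h)) = (\<Sum>h\<in>stab W k n. F h)"
proof (rule sum.reindex_bij_witness[where j = "compose (fiw_obj W n) g" and i = "compose (fiw_obj W n) (weyl_inv W n g)"])
  note g' = stab_weyl[OF g] note gi = weyl_inv[OF g'] note gs = stab_inv[OF g kn]
  fix h assume h: "h \<in> stab W k n"
  note h' = stab_weyl[OF h]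
  show "compose (fiw_obj W n) (weyl_inv W n g) (compose (fiw_obj W n) g h) = h"
    by (rule weyl_eqI[OF _ h'], intro compose_weyl gi(1) g' h') (simp add: compose_def gi(2,3) weylD(1)[OF h'] weylD(1)[OF g'])
  show "compose (fiw_obj W n) g (compose (fiw_obj W n) (weyl_inv W n g) h) = h"
    by (rule weyl_eqI[OF _ h'], intro compose_weyl gi(1) g' h') (simp add: compose_def gi(2,3) weylD(1)[OF h'] weylD(1)[OF gi(1)])
  show "compose (fiw_obj W n) g h \<in> stab W k n" "compose (fiw_obj W n) (weyl_inv W n g) h \<in> stab W k n"
    using stab_compose[OF g h kn] stab_compose[OF gs h kn] by auto
qed simp

section \<open>Invariants of a representation and the traces on them\<close>

locale weyl_module = vspace scale
  for scale :: "'k::field \<Rightarrow> 'v::ab_group_add \<Rightarrow> 'v" +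
  fixes W :: family and n :: nat and V :: "'v set" and \<rho> :: "(int \<Rightarrow> int) \<Rightarrow> 'v \<Rightarrow> 'v"
  assumes rep: "weyl_rep W n scale V \<rho>"
begin

lemma subspace_V: "subspace V"
  and rho_in: "\<sigma> \<in> weyl W n \<Longrightarrow> x \<in> V \<Longrightarrow> \<rho> \<sigma> x \<in> V"
  and rho_linear: "\<sigma> \<in> weyl W n \<Longrightarrow> linear_map_on scale scale V (\<rho> \<sigma>)"
  and rho_id: "x \<in> V \<Longrightarrow> \<rho> (fiw_id W n) x = x"
  and rho_compose: "\<sigma> \<in> weyl W n \<Longrightarrow> \<tau> \<in> weyl W n \<Longrightarrow> x \<in> V \<Longrightarrow> \<rho> (compose (fiw_obj W n) \<sigma> \<tau>) x = \<rho> \<sigma> (\<rho> \<tau> x)"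
  using rep by (auto simp: weyl_rep_def)

lemma rho_sum: "\<sigma> \<in> weyl W n \<Longrightarrow> (\<And>i. i \<in> I \<Longrightarrow> g i \<in> V) \<Longrightarrow> \<rho> \<sigma> (\<Sum>i\<in>I. g i) = (\<Sum>i\<in>I. \<rho> \<sigma> (g i))"
  by (rule linear_map_on_sum[OF vspace_axioms subspace_V rho_linear])

definition invs :: "nat \<Rightarrow> 'v set" where
  "invs k = {x \<in> V. \<forall>h\<in>stab W k n. \<rho> h x = x}"

text \<open>The Reynolds operator of the stabiliser.\<close>

definition avg :: "nat \<Rightarrow> 'v \<Rightarrow> 'v" where
  "avg k x = (\<Sum>h\<in>stab W k n. scale (inverse (of_nat (card (stab W k n)))) (\<rho> h x))"

lemma invs_subset: "invs k \<subseteq> V" by (auto simp: invs_def)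

lemma subspace_invs: "subspace (invs k)"
proof (rule subspaceI)
  show "0 \<in> invs k"
    using rho_sum[of _ "{}" "\<lambda>_. 0"] subspace_0[OF subspace_V] stab_weyl by (auto simp: invs_def)
qed (use subspace_add[OF subspace_V] subspace_scale[OF subspace_V] rho_linear[OF stab_weyl] in
    \<open>auto simp: invs_def linear_map_on_def\<close>)

context
  fixes k :: nat
  assumes kn: "k \<le> n" and char: "of_nat (card (stab W k n)) \<noteq> (0 :: 'k)"
begin

lemma avg_invs:
  assumes "x \<in> invs k" shows "avg k x = x"
proof -
  have "avg k x = scale (\<Sum>h\<in>stab W k n. inverse (of_nat (card (stab W k n)))) x"
    using assms by (simp only: scale_sum_left) (simp add: avg_def invs_def)
  also have "(\<Sum>h\<in>stab W k n. inverse (of_nat (card (stab W k n)))) = (1 :: 'k)" using char by simp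
  finally show ?thesis by simp
qed

lemma avg_in_V: "x \<in> V \<Longrightarrow> avg k x \<in> V"
  unfolding avg_def using rho_in[OF stab_weyl]
  by (intro subspace_sum[OF subspace_V] subspace_scale[OF subspace_V])

lemma avg_in_invs:
  assumes x: "x \<in> V" shows "avg k x \<in> invs k"
proof -
  have "\<rho> g (avg k x) = avg k x" if g: "g \<in> stab W k n" for g
  proof -
    note g' = stab_weyl[OF g]
    have "\<rho> g (avg k x) = (\<Sum>h\<in>stab W k n. \<rho> g (scale (inverse (of_nat (card (stab W k n)))) (\<rho> h x)))"
      unfolding avg_def using rho_in[OF stab_weyl x] by (intro rho_sum[OF g'] subspace_scale[OF subspace_V])
    also have "\<dots> = (\<Sum>h\<in>stab W k n. scale (inverse (of_nat (card (stab W k n)))) (\<rho> (compose (fiw_obj W n) g h) x))"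
      using rho_linear[OF g'] rho_in[OF stab_weyl x] rho_compose[OF g' stab_weyl x]
      by (intro sum.cong) (auto simp: linear_map_on_def)
    also have "\<dots> = avg k x" unfolding avg_def by (rule stab_reindex[OF g kn])
    finally show ?thesis .
  qed
  then show ?thesis using avg_in_V[OF x] by (simp add: invs_def)
qed

lemma avg_linear: "linear_map_on scale scale V (avg k)"
  unfolding linear_map_on_def
proof (intro conjI ballI allI)
  note l = rho_linear[OF stab_weyl, unfolded linear_map_on_def]
  show "avg k (x + y) = avg k x + avg k y" if "x \<in> V" "y \<in> V" for x y
    using l that by (simp add: avg_def scale_right_distrib sum.distrib)
  show "avg k (scale r x) = scale r (avg k x)" if "x \<in> V" for x r
    using l that by (simp add: avg_def scale_sum_right mult.commute)
qed

text \<open>The extension of \<open>\<tau>\<close> maps \<open>k\<close> onto itself, hence it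
  normalises the pointwise stabiliser of \<open>k\<close>.\<close>

lemma rho_extend_id_invs:
  assumes \<tau>: "\<tau> \<in> weyl W k" and x: "x \<in> invs k"
  shows "\<rho> (extend_id W k n \<tau>) x \<in> invs k"
proof -
  let ?\<tau> = "extend_id W k n \<tau>"
  let ?c = "compose (fiw_obj W n)"
  note \<tau>' = extend_id[OF \<tau> kn] note ti = weyl_inv[OF \<tau>'(1)]
  have xV: "x \<in> V" using x invs_subset by auto
  have "\<rho> h (\<rho> ?\<tau> x) = \<rho> ?\<tau> x" if h: "h \<in> stab W k n" for h
  proof -
    note h' = stab_weyl[OF h]
    define h2 where "h2 = ?c (weyl_inv W n ?\<tau>) (?c h ?\<tau>)"
    have h2w: "h2 \<in> weyl W n" unfolding h2_def by (intro compose_weyl ti(1) h' \<tau>'(1))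
    have "h2 a = a" if a: "a \<in> fiw_obj W k" for a
    proof -
      have an: "a \<in> fiw_obj W n" using a fiw_obj_mono[OF kn] by auto
      have "h (\<tau> a) = \<tau> a" using h weylD(1)[OF \<tau> a] by (simp add: stab_def)
      then show ?thesis using an \<tau>'(2)[OF a] ti(2)[OF an] by (simp add: h2_def compose_def)
    qed
    then have h2: "h2 \<in> stab W k n" using h2w by (simp add: stab_def)
    have "?c h ?\<tau> = ?c ?\<tau> h2"
      unfolding h2_def
      by (rule weyl_eqI[where W = W and n = n], (intro compose_weyl ti(1) h' \<tau>'(1))+)
         (simp add: compose_def ti(3) weylD(1)[OF h'] weylD(1)[OF \<tau>'(1)])
    then have "\<rho> h (\<rho> ?\<tau> x) = \<rho> ?\<tau> (\<rho> h2 x)"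
      using rho_compose[OF h' \<tau>'(1) xV] rho_compose[OF \<tau>'(1) h2w xV] by simp
    then show ?thesis using h2 x by (simp add: invs_def)
  qed
  then show ?thesis using rho_in[OF \<tau>'(1) xV] by (simp add: invs_def)
qed

text \<open>\<open>avg\<close> is a retraction onto the invariants. By cyclicity the trace there
  equals the trace on all of \<open>V\<close> of \<open>avg\<close> followed by the action of
  \<open>\<tau>\<close>, and expanding the average gives the sum.\<close>

lemma trace_invs:
  assumes \<tau>: "\<tau> \<in> weyl W k" and V: "findim V"
  shows "trace_on scale (invs k) (\<rho> (extend_id W k n \<tau>)) =
    (\<Sum>h\<in>stab W k n. inverse (of_nat (card (stab W k n))) * trace_on scale V (\<rho> (compose (fiw_obj W n) (extend_id W k n \<tau>) h)))"
proof -
  let ?\<tau> = "extend_id W k n \<tau>"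
  note \<tau>' = extend_id(1)[OF \<tau> kn]
  have fi: "findim (invs k)" by (rule findim_subset[OF V subspace_invs invs_subset])
  have lin: "linear_map_on scale scale (invs k) (\<rho> ?\<tau>)"
    using rho_linear[OF \<tau>'] invs_subset by (auto simp: linear_map_on_def subset_iff)
  have "trace_on scale V (\<lambda>x. \<rho> ?\<tau> (avg k x)) = trace_on scale (invs k) (\<lambda>x. avg k (\<rho> ?\<tau> x))"
    by (rule trace_on_cyclic[OF vspace_axioms V fi avg_linear _ lin])
       (use avg_in_invs rho_in[OF \<tau>'] invs_subset in auto)
  also have "\<dots> = trace_on scale (invs k) (\<rho> ?\<tau>)"
    by (rule trace_on_cong[OF subspace_invs]) (use avg_invs rho_extend_id_invs[OF \<tau>] in auto)
  finally have 1: "trace_on scale (invs k) (\<rho> ?\<tau>) = trace_on scale V (\<lambda>x. \<rho> ?\<tau> (avg k x))" by simp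
  also have "\<dots> = trace_on scale V (\<lambda>x. \<Sum>h\<in>stab W k n. scale (inverse (of_nat (card (stab W k n)))) (\<rho> (compose (fiw_obj W n) ?\<tau> h) x))"
  proof (rule trace_on_cong[OF subspace_V])
    fix x assume x: "x \<in> V"
    have "\<rho> ?\<tau> (avg k x) = (\<Sum>h\<in>stab W k n. \<rho> ?\<tau> (scale (inverse (of_nat (card (stab W k n)))) (\<rho> h x)))"
      unfolding avg_def using rho_in[OF stab_weyl x] by (intro rho_sum[OF \<tau>'] subspace_scale[OF subspace_V])
    then show "\<rho> ?\<tau> (avg k x) = (\<Sum>h\<in>stab W k n. scale (inverse (of_nat (card (stab W k n)))) (\<rho> (compose (fiw_obj W n) ?\<tau> h) x))"
      using rho_linear[OF \<tau>'] rho_in[OF stab_weyl x] rho_compose[OF \<tau>' stab_weyl x] by (simp add: linear_map_on_def)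
  qed
  also have "\<dots> = (\<Sum>h\<in>stab W k n. inverse (of_nat (card (stab W k n))) * trace_on scale V (\<rho> (compose (fiw_obj W n) ?\<tau> h)))"
    using compose_weyl[OF \<tau>' stab_weyl] rho_linear rho_in by (intro trace_on_sum[OF V]) auto
  finally show ?thesis .
qed

end

lemma trace_conjugate:
  assumes V: "findim V" and g: "g \<in> weyl W n" and \<sigma>: "\<sigma> \<in> weyl W n"
  shows "trace_on scale V (\<rho> (compose (fiw_obj W n) g (compose (fiw_obj W n) \<sigma> (weyl_inv W n g)))) = trace_on scale V (\<rho> \<sigma>)"
proof -
  let ?c = "compose (fiw_obj W n)"
  note gi = weyl_inv[OF g]
  have "trace_on scale V (\<rho> (?c g (?c \<sigma> (weyl_inv W n g)))) = trace_on scale V (\<lambda>x. \<rho> g (\<rho> (?c \<sigma> (weyl_inv W n g)) x))"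
    by (rule trace_on_cong[OF subspace_V]) (use rho_compose[OF g compose_weyl[OF \<sigma> gi(1)]] in auto)
  also have "\<dots> = trace_on scale V (\<lambda>x. \<rho> (?c \<sigma> (weyl_inv W n g)) (\<rho> g x))"
    by (rule trace_on_cyclic[OF vspace_axioms V V]) (use rho_linear rho_in compose_weyl[OF \<sigma> gi(1)] g in auto)
  also have "\<dots> = trace_on scale V (\<rho> \<sigma>)"
  proof (rule trace_on_cong[OF subspace_V])
    fix x assume x: "x \<in> V"
    have "?c (?c \<sigma> (weyl_inv W n g)) g = \<sigma>"
      by (rule weyl_eqI[OF _ \<sigma>], intro compose_weyl gi(1) g \<sigma>) (simp add: compose_def gi(2) weylD(1)[OF g])
    then show "\<rho> (?c \<sigma> (weyl_inv W n g)) (\<rho> g x) = \<rho> \<sigma> x"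
      using rho_compose[OF compose_weyl[OF \<sigma> gi(1)] g x] by simp
  qed
  finally show ?thesis .
qed

text \<open>\<open>sum_fix_set\<close> produces the number of morphisms times a sum over the
  stabiliser. By \<open>card_hom_stab\<close> that number cancels against the order of the group,
  leaving the average of \<open>trace_invs\<close>. The conjugation is the one in the second
  argument of \<open>inner_weyl\<close>.\<close>

lemma inner_fix_set:
  assumes \<iota>: "field_embedding (\<iota> :: 'k \<Rightarrow> complex)" and \<tau>: "\<tau> \<in> weyl W k" and kn: "k \<le> n" and V: "findim V"
  shows "inner_weyl W n (\<lambda>\<sigma>. of_nat (card (fix_set W k n \<tau> \<sigma>))) (\<lambda>\<sigma>. \<iota> (trace_on scale V (\<rho> \<sigma>))) =
    cnj (\<iota> (trace_on scale (invs k) (\<rho> (extend_id W k n \<tau>))))"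
proof -
  note \<iota>s = field_embedding_simps[OF \<iota>]
  have char: "of_nat (card (stab W k n)) \<noteq> (0 :: 'k)"
    using field_embedding_of_nat_neq_0[OF \<iota>] card_stab_pos[OF kn] by blast
  define N where "N = (of_nat (card (stab W k n)) :: complex)"
  have N: "N \<noteq> 0" using card_stab_pos[OF kn, of W] unfolding N_def by (metis less_irrefl of_nat_eq_0_iff)
  have inv: "\<iota> (inverse (of_nat (card (stab W k n)))) = inverse N"
  proof -
    have "\<iota> (inverse (of_nat (card (stab W k n)))) * N = \<iota> (inverse (of_nat (card (stab W k n))) * of_nat (card (stab W k n)))"
      by (simp only: \<iota>s N_def)
    then show ?thesis using char N by (simp add: \<iota>s field_simps)
  qed
  define X where "X = (\<Sum>h\<in>stab W k n. \<iota> (trace_on scale V (\<rho> (compose (fiw_obj W n) (extend_id W k n \<tau>) h))))"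
  have tr: "\<iota> (trace_on scale (invs k) (\<rho> (extend_id W k n \<tau>))) = X / N"
    unfolding trace_invs[OF kn char \<tau> V] X_def
    by (simp only: \<iota>s(2,5) inv sum_divide_distrib) (simp add: field_simps)
  have "(\<Sum>\<sigma>\<in>weyl W n. of_nat (card (fix_set W k n \<tau> \<sigma>)) * \<iota> (trace_on scale V (\<rho> \<sigma>))) = of_nat (card (fiw_hom W k n)) * X"
    unfolding X_def by (rule sum_fix_set[OF \<tau> kn]) (simp add: trace_conjugate[OF V])
  then have sum: "(\<Sum>\<sigma>\<in>weyl W n. of_nat (card (fix_set W k n \<tau> \<sigma>)) * cnj (\<iota> (trace_on scale V (\<rho> \<sigma>)))) = of_nat (card (fiw_hom W k n)) * cnj X"
    by (metis (no_types, lifting) cnj_sum complex_cnj_mult complex_cnj_of_nat sum.cong)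
  have card: "(of_nat (card (weyl W n)) :: complex) = of_nat (card (fiw_hom W k n)) * N"
    unfolding N_def card_hom_stab[OF kn, of W, symmetric] by simp
  have "card (weyl W n) \<noteq> 0" using fiw_id_weyl[of W n] by auto
  then have "(of_nat (card (fiw_hom W k n)) :: complex) \<noteq> 0" using card_hom_stab[OF kn, of W] by (metis mult_0 of_nat_eq_0_iff)
  then show ?thesis unfolding inner_weyl_def sum card tr using N by (simp add: N_def)
qed

lemma norm_trace_invs:
  assumes \<iota>: "field_embedding (\<iota> :: 'k \<Rightarrow> complex)" and \<tau>: "\<tau> \<in> weyl W k" and kn: "k \<le> n"
    and S: "finite S" "invs k \<subseteq> span S"
  shows "norm (\<iota> (trace_on scale (invs k) (\<rho> (extend_id W k n \<tau>)))) \<le> card S"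
proof -
  let ?\<tau> = "extend_id W k n \<tau>"
  note \<tau>' = extend_id(1)[OF \<tau> kn]
  \<comment> \<open>Powers of the extension, restricted so as to be extensional and thus elements of
    the group. As the group is finite, two of them coincide, and the operator has finite order on
    the invariants.\<close>
  define p where "p i = restrict (?\<tau> ^^ i) (fiw_obj W n)" for i
  have p_weyl: "p i \<in> weyl W n" and p_Suc: "p (Suc i) = compose (fiw_obj W n) ?\<tau> (p i)" for i
  proof -
    show "p i \<in> weyl W n"
    proof (rule weylI)
      show "inj_on (p i) (fiw_obj W n)" unfolding p_def using weyl_funpow_inj[OF \<tau>'] by (auto simp: inj_on_def)
      show "p i (- a) = - p i a" if "W = TypeBC" "a \<in> fiw_obj W n" for a
      proof -
        have "- a \<in> fiw_obj W n" using that by (auto simp: in_fiw_obj_iff)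
        then show ?thesis unfolding p_def using that weyl_funpow_neg[OF \<tau>'] by simp
      qed
    qed (use weyl_funpow_in[OF \<tau>'] in \<open>auto simp: p_def\<close>)
    show "p (Suc i) = compose (fiw_obj W n) ?\<tau> (p i)" by (auto simp: p_def compose_def)
  qed
  have p_rho: "\<rho> (p i) x = (\<rho> ?\<tau> ^^ i) x" if x: "x \<in> V" for x i
  proof (induction i)
    case 0
    have "p 0 = fiw_id W n" by (auto simp: p_def fiw_id_def)
    then show ?case using rho_id[OF x] by simp
  next
    case (Suc i)
    then show ?case using rho_compose[OF \<tau>' p_weyl x] by (simp add: p_Suc)
  qed
  have "\<not> inj p"
  proof
    assume "inj p"
    moreover have "range p \<subseteq> weyl W n" using p_weyl by auto
    ultimately show False using finite_weyl by (meson finite_imageD finite_subset infinite_UNIV_nat)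
  qed
  then obtain i j where ij: "i < j" "p i = p j" unfolding inj_def by (metis linorder_neqE_nat)
  have "p (j - i) = fiw_id W n"
  proof (rule weyl_eqI[OF p_weyl fiw_id_weyl])
    fix a assume a: "a \<in> fiw_obj W n"
    have "(?\<tau> ^^ i) a = (?\<tau> ^^ j) a" using ij(2) a unfolding p_def by (metis restrict_apply')
    then show "p (j - i) a = fiw_id W n a" using weyl_funpow_cancel[OF \<tau>' a, of i j] ij(1) a by (simp add: p_def fiw_id_def)
  qed
  then have ord: "(\<rho> ?\<tau> ^^ (j - i)) x = x" if "x \<in> invs k" for x
    using p_rho[OF subsetD[OF invs_subset that], of "j - i"] rho_id[OF subsetD[OF invs_subset that]] by simp
  have char: "of_nat (card (stab W k n)) \<noteq> (0 :: 'k)"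
    using field_embedding_of_nat_neq_0[OF \<iota>] card_stab_pos[OF kn] by blast
  have lin: "linear_map_on scale scale (invs k) (\<rho> ?\<tau>)"
    using rho_linear[OF \<tau>'] invs_subset by (auto simp: linear_map_on_def subset_iff)
  have im: "\<rho> ?\<tau> ` invs k \<subseteq> invs k" using rho_extend_id_invs[OF kn char \<tau>] by auto
  have fi: "findim (invs k)" using S subspace_invs unfolding findim_def by blast
  obtain B where B: "basis_of (invs k) B" using basis_of_exists[OF subspace_invs] .
  have "norm (\<iota> (trace_on scale (invs k) (\<rho> ?\<tau>))) \<le> card B"
    using norm_trace_on_finite_order[OF \<iota> fi B lin im _ ord] ij(1) by simp
  also have "\<dots> \<le> card S" using basis_of_card_le(2)[OF B S] by simp
  finally show ?thesis by simp
qed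

end

lemma weyl_module_iff: "weyl_module s W n V \<rho> \<longleftrightarrow> weyl_rep W n s V \<rho>"
  by (auto simp: weyl_module_def weyl_module_axioms_def vspace_def weyl_rep_def)

text \<open>Averaging turns a preimage of an invariant into an invariant preimage.\<close>

lemma invs_image:
  assumes U: "weyl_module t W n U \<gamma>" and V: "weyl_module s W n V \<rho>"
    and \<phi>: "linear_map_on t s U \<phi>" "\<phi> ` U = V" "\<And>\<sigma> x. \<sigma> \<in> weyl W n \<Longrightarrow> x \<in> U \<Longrightarrow> \<phi> (\<gamma> \<sigma> x) = \<rho> \<sigma> (\<phi> x)"
    and kn: "k \<le> n" and char: "of_nat (card (stab W k n)) \<noteq> (0 :: 'k::field)"
  shows "\<phi> ` weyl_module.invs W n U \<gamma> k = weyl_module.invs W n V \<rho> k"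
    and "\<And>x. x \<in> U \<Longrightarrow> \<phi> (weyl_module.avg (t :: 'k \<Rightarrow> _) W n \<gamma> k x) = weyl_module.avg s W n \<rho> k (\<phi> x)"
proof -
  interpret U: weyl_module t W n U \<gamma> by fact
  interpret V: weyl_module s W n V \<rho> by fact
  show avg: "\<phi> (U.avg k x) = V.avg k (\<phi> x)" if x: "x \<in> U" for x
  proof -
    have "\<phi> (U.avg k x) = (\<Sum>h\<in>stab W k n. \<phi> (t (inverse (of_nat (card (stab W k n)))) (\<gamma> h x)))"
      unfolding U.avg_def using U.rho_in[OF stab_weyl x]
      by (intro U.linear_map_on_sum[OF V.vspace_axioms U.subspace_V \<phi>(1)] U.subspace_scale[OF U.subspace_V])
    then show ?thesis
      unfolding V.avg_def
      using \<phi>(1) \<phi>(3)[OF stab_weyl x] U.rho_in[OF stab_weyl x] by (auto simp: linear_map_on_def intro!: sum.cong)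
  qed
  show "\<phi> ` U.invs k = V.invs k"
  proof (intro equalityI subsetI)
    fix y assume "y \<in> \<phi> ` U.invs k"
    then obtain x where x: "x \<in> U.invs k" "y = \<phi> x" by auto
    have "\<rho> h (\<phi> x) = \<phi> x" if "h \<in> stab W k n" for h
      using \<phi>(3)[OF stab_weyl[OF that], of x] x(1) that by (auto simp: U.invs_def)
    then show "y \<in> V.invs k" using x \<phi>(2) by (auto simp: U.invs_def V.invs_def)
  next
    fix y assume y: "y \<in> V.invs k"
    then obtain x where x: "x \<in> U" "y = \<phi> x" using \<phi>(2) V.invs_subset by blast
    then have "y = \<phi> (U.avg k x)" using V.avg_invs[OF kn char y] avg by simp
    then show "y \<in> \<phi> ` U.invs k" using U.avg_in_invs[OF kn char x(1)] by blast
  qed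
qed

text \<open>Invariants of the subobject lie among those of \<open>G\<close>, and averaging makes
  them map onto the invariants of the quotient. A spanning set for the invariants of
  \<open>G\<close> therefore bounds those of the subquotient. Finite dimensionality is transferred
  as well because traces rely on it.\<close>

lemma weyl_subquotient_invs:
  assumes sub: "weyl_subquotient W n s V \<rho> t G \<gamma>" and G: "weyl_module t W n G \<gamma>"
    and kn: "k \<le> n" and char: "of_nat (card (stab W k n)) \<noteq> (0 :: 'k::field)"
    and S: "finite S" "weyl_module.invs W n G \<gamma> k \<subseteq> module.span (t :: 'k \<Rightarrow> 'b \<Rightarrow> 'b::ab_group_add) S"
    and fin: "vspace.findim t G"
  obtains S' where "finite S'" "card S' \<le> card S" "weyl_module.invs W n V \<rho> k \<subseteq> module.span s S'" "vspace.findim s V"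
proof -
  from sub have V: "weyl_module s W n V \<rho>" by (simp add: weyl_subquotient_def weyl_module_iff)
  then interpret V: weyl_module s W n V \<rho> .
  interpret G: weyl_module t W n G \<gamma> by fact
  from sub obtain U \<phi> where U: "U \<subseteq> G" "G.subspace U" "\<And>\<sigma>. \<sigma> \<in> weyl W n \<Longrightarrow> \<gamma> \<sigma> ` U \<subseteq> U"
      and \<phi>: "linear_map_on t s U \<phi>" "\<phi> ` U = V" "\<And>\<sigma> x. \<sigma> \<in> weyl W n \<Longrightarrow> x \<in> U \<Longrightarrow> \<phi> (\<gamma> \<sigma> x) = \<rho> \<sigma> (\<phi> x)"
    unfolding weyl_subquotient_def by blast
  have "weyl_rep W n t U \<gamma>"
    using G.rep U unfolding weyl_rep_def linear_map_on_def by (meson subsetD)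
  then have Um: "weyl_module t W n U \<gamma>" by (simp add: weyl_module_iff)
  then interpret U: weyl_module t W n U \<gamma> .
  have UG: "U.invs k \<subseteq> G.invs k" using U(1) by (auto simp: U.invs_def G.invs_def)
  have image: "\<phi> ` U.invs k = V.invs k"
    by (rule invs_image(1)[OF Um V \<phi>(1,2) _ kn char]) (rule \<phi>(3))
  have "linear_map_on t s (U.invs k) \<phi>" using \<phi>(1) U.invs_subset by (auto simp: linear_map_on_def subset_iff)
  from G.linear_map_on_image[OF V.vspace_axioms U.subspace_invs this S(1)] UG S(2)
  obtain S' where S': "finite S'" "card S' \<le> card S" "\<phi> ` U.invs k \<subseteq> V.span S'" by (metis order_trans)
  obtain B where "finite B" "G \<subseteq> G.span B" using fin by (auto simp: G.findim_def)
  then have "finite B" "U \<subseteq> G.span B" using U(1) by auto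
  from G.linear_map_on_image[OF V.vspace_axioms U(2) \<phi>(1) this]
  have "V.findim V" unfolding V.findim_def using \<phi>(2) by metis
  then show ?thesis using that S' image by simp
qed

lemma stab_conj:
  assumes g: "g \<in> weyl W n" "\<And>a. a \<in> fiw_obj W k \<Longrightarrow> g a \<in> fiw_obj W k" and h: "h \<in> stab W k n" and kn: "k \<le> n"
  shows "compose (fiw_obj W n) (weyl_inv W n g) (compose (fiw_obj W n) h g) \<in> stab W k n"
proof -
  have "compose (fiw_obj W n) (weyl_inv W n g) (compose (fiw_obj W n) h g) a = a" if a: "a \<in> fiw_obj W k" for a
  proof -
    have an: "a \<in> fiw_obj W n" using a fiw_obj_mono[OF kn] by auto
    have "h (g a) = g a" using h g(2)[OF a] by (simp add: stab_def)
    then show ?thesis using an weyl_inv(2)[OF g(1) an] by (simp add: compose_def)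
  qed
  then show ?thesis using compose_weyl[OF weyl_inv(1)[OF g(1)] compose_weyl[OF stab_weyl[OF h] g(1)]] by (simp add: stab_def)
qed

lemma stab_conj_reindex:
  fixes F :: "(int \<Rightarrow> int) \<Rightarrow> 'c::comm_monoid_add"
  assumes g: "g \<in> weyl W n" "\<And>a. a \<in> fiw_obj W k \<Longrightarrow> g a \<in> fiw_obj W k" and kn: "k \<le> n"
  shows "(\<Sum>h\<in>stab W k n. F (compose (fiw_obj W n) (weyl_inv W n g) (compose (fiw_obj W n) h g))) = (\<Sum>h\<in>stab W k n. F h)"
proof -
  define j where "j h = compose (fiw_obj W n) (weyl_inv W n g) (compose (fiw_obj W n) h g)" for h
  have "inj_on j (stab W k n)"
  proof (rule inj_on_inverseI)
    fix h assume h: "h \<in> stab W k n"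
    note h' = stab_weyl[OF h] note gi = weyl_inv[OF g(1)]
    show "compose (fiw_obj W n) g (compose (fiw_obj W n) (j h) (weyl_inv W n g)) = h"
      unfolding j_def
      by (rule weyl_eqI[OF _ h'], intro compose_weyl gi(1) g(1) h')
         (simp add: compose_def gi(2,3) weylD(1)[OF h'] weylD(1)[OF g(1)] weylD(1)[OF gi(1)])
  qed
  moreover have "j ` stab W k n \<subseteq> stab W k n" using stab_conj[OF g _ kn] by (auto simp: j_def)
  ultimately have "bij_betw j (stab W k n) (stab W k n)"
    by (simp add: bij_betw_def endo_inj_surj)
  from sum.reindex_bij_betw[OF this, of F] show ?thesis by (simp add: j_def)
qed

text \<open>Conjugation by an element that maps \<open>k\<close> to itself permutes the stabiliser.
  This will make the maps from \<open>n\<close> to \<open>n + 1\<close> compatible with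
  \<open>\<tau>\<close>.\<close>

lemma (in weyl_module) avg_commute:
  assumes kn: "k \<le> n" and g: "g \<in> weyl W n" "\<And>a. a \<in> fiw_obj W k \<Longrightarrow> g a \<in> fiw_obj W k" and x: "x \<in> V"
  shows "avg k (\<rho> g x) = \<rho> g (avg k x)"
proof -
  let ?c = "compose (fiw_obj W n)"
  let ?r = "inverse (of_nat (card (stab W k n)))"
  note gi = weyl_inv[OF g(1)]
  have "\<rho> g (avg k x) = (\<Sum>h\<in>stab W k n. \<rho> g (scale ?r (\<rho> h x)))"
    unfolding avg_def using rho_in[OF stab_weyl x] by (intro rho_sum[OF g(1)] subspace_scale[OF subspace_V])
  also have "\<dots> = (\<Sum>h\<in>stab W k n. scale ?r (\<rho> g (\<rho> h x)))"
    using rho_linear[OF g(1)] rho_in[OF stab_weyl x] by (simp add: linear_map_on_def)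
  also have "\<dots> = (\<Sum>h\<in>stab W k n. scale ?r (\<rho> g (\<rho> (?c (weyl_inv W n g) (?c h g)) x)))"
    by (rule stab_conj_reindex[OF g kn, symmetric])
  also have "\<dots> = avg k (\<rho> g x)"
    unfolding avg_def
  proof (rule sum.cong[OF refl])
    fix h assume "h \<in> stab W k n"
    then have h: "h \<in> weyl W n" by (rule stab_weyl)
    have cw: "?c (weyl_inv W n g) (?c h g) \<in> weyl W n" by (intro compose_weyl gi(1) h g(1))
    have "?c g (?c (weyl_inv W n g) (?c h g)) = ?c h g"
      by (rule weyl_eqI[OF _ compose_weyl[OF h g(1)]], intro compose_weyl gi(1) h g(1))
         (simp add: compose_def gi(3) weylD(1)[OF h] weylD(1)[OF g(1)])
    then show "scale ?r (\<rho> g (\<rho> (?c (weyl_inv W n g) (?c h g)) x)) = scale ?r (\<rho> h (\<rho> g x))"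
      using rho_compose[OF g(1) cw x] rho_compose[OF h g(1) x] by simp
  qed
  finally show ?thesis by simp
qed

section \<open>Invariants of the free algebra\<close>

text \<open>One fixed degree of an algebra, as a functor. Subobjects and kernels taken in that
  degree are of this form too, so the stabilisation argument can be applied to each of them.\<close>

locale fiw_module = vspace scale
  for scale :: "'k::field \<Rightarrow> 'v::ab_group_add \<Rightarrow> 'v" +
  fixes W :: family and V :: "nat \<Rightarrow> 'v set" and mp :: "nat \<Rightarrow> nat \<Rightarrow> (int \<Rightarrow> int) \<Rightarrow> 'v \<Rightarrow> 'v"
  assumes sub: "subspace (V n)"
    and mp_in: "f \<in> fiw_hom W m n \<Longrightarrow> x \<in> V m \<Longrightarrow> mp m n f x \<in> V n"
    and mp_linear: "f \<in> fiw_hom W m n \<Longrightarrow> linear_map_on scale scale (V m) (mp m n f)"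
    and mp_id: "x \<in> V n \<Longrightarrow> mp n n (fiw_id W n) x = x"
    and mp_compose: "f \<in> fiw_hom W l m \<Longrightarrow> g \<in> fiw_hom W m n \<Longrightarrow> x \<in> V l \<Longrightarrow>
      mp l n (compose (fiw_obj W l) g f) x = mp m n g (mp l m f x)"
begin

lemma weyl_module: "weyl_module scale W n (V n) (mp n n)"
  unfolding weyl_module_iff weyl_rep_def
  by (intro conjI ballI image_subsetI)
    (simp_all add: weyl_iff_hom vector_space_axioms sub mp_in mp_linear mp_id mp_compose[where l = n and m = n and n = n])

end

lemma fiw_module_of_algebra:
  assumes "fiw_algebra W A"
  shows "fiw_module (alg_scale A) W (\<lambda>n. alg_piece A n d) (alg_map A d)"
proof -
  interpret fiw_algebra W A by fact
  show ?thesis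
    by (rule fiw_module.intro, simp add: vspace_def vector_space_axioms, rule fiw_module_axioms.intro)
      (rule subspace_piece | erule (1) map_closed | erule map_linear | erule map_id | erule (2) map_compose)+
qed

lemma fiw_module_sub:
  assumes "fiw_module s W V mp" "\<And>n. module.subspace s (U n)" "\<And>n. U n \<subseteq> V n"
    and "\<And>m n f x. f \<in> fiw_hom W m n \<Longrightarrow> x \<in> U m \<Longrightarrow> mp m n f x \<in> U n"
  shows "fiw_module s W U mp"
proof -
  interpret fiw_module s W V mp by fact
  show ?thesis
  proof unfold_locales
    show "linear_map_on s s (U m) (mp m n f)" if "f \<in> fiw_hom W m n" for m n f
      using mp_linear[OF that] assms(3)[of m] by (auto simp: linear_map_on_def subset_iff)
    show "mp n n (fiw_id W n) x = x" if "x \<in> U n" for n x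
      using that assms(3)[of n] by (intro mp_id) auto
    show "mp l n (compose (fiw_obj W l) g f) x = mp m n g (mp l m f x)"
      if "f \<in> fiw_hom W l m" "g \<in> fiw_hom W m n" "x \<in> U l" for f l m g n x
      using that assms(3)[of l] by (intro mp_compose) auto
  qed (fact assms(2) | erule (1) assms(4))+
qed

lemma stab_reindex_right:
  fixes F :: "(int \<Rightarrow> int) \<Rightarrow> 'c::comm_monoid_add"
  assumes g: "g \<in> stab W k n" and kn: "k \<le> n"
  shows "(\<Sum>h\<in>stab W k n. F (compose (fiw_obj W n) h g)) = (\<Sum>h\<in>stab W k n. F h)"
proof (rule sum.reindex_bij_witness[where j = "\<lambda>h. compose (fiw_obj W n) h g" and i = "\<lambda>h. compose (fiw_obj W n) h (weyl_inv W n g)"])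
  note g' = stab_weyl[OF g] note gi = weyl_inv[OF g'] note gs = stab_inv[OF g kn]
  fix h assume h: "h \<in> stab W k n"
  note h' = stab_weyl[OF h]
  show "compose (fiw_obj W n) (compose (fiw_obj W n) h g) (weyl_inv W n g) = h"
    by (rule weyl_eqI[OF _ h'], intro compose_weyl gi(1) g' h') (simp add: compose_def gi(2,3) weylD(1)[OF gi(1)])
  show "compose (fiw_obj W n) (compose (fiw_obj W n) h (weyl_inv W n g)) g = h"
    by (rule weyl_eqI[OF _ h'], intro compose_weyl gi(1) g' h') (simp add: compose_def gi(2,3) weylD(1)[OF g'])
  show "compose (fiw_obj W n) h g \<in> stab W k n" "compose (fiw_obj W n) h (weyl_inv W n g) \<in> stab W k n"
    using stab_compose[OF h g kn] stab_compose[OF h gs kn] by auto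
qed simp

lemma (in weyl_module) avg_rho:
  assumes "g \<in> stab W k n" "k \<le> n" "x \<in> V"
  shows "avg k (\<rho> g x) = avg k x"
  unfolding avg_def
  using rho_compose[OF stab_weyl stab_weyl[OF assms(1)] assms(3)]
    stab_reindex_right[OF assms(1,2), of "\<lambda>h. scale (inverse (of_nat (card (stab W k n)))) (\<rho> h x)"] by simp

section \<open>Invariants in the monomial basis\<close>

lemma sort_key_eq_if_sorted:
  assumes "sorted (map (to_nat :: gen \<Rightarrow> nat) v)" "mset u = mset v"
  shows "sort_key to_nat u = v"
proof -
  have "map (to_nat :: gen \<Rightarrow> nat) (sort_key to_nat u) = sort (map to_nat v)"
    by (rule properties_for_sort[symmetric]) (use assms(2) in simp_all)
  also have "\<dots> = map to_nat v" using assms(1) by (simp add: sort_key_id_if_sorted)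
  finally show ?thesis by (simp add: inj_map_eq_map[OF inj_to_nat])
qed

text \<open>Reordering the letters of a reduced word changes its product only by a sign, so it
  remains a single basis vector up to that sign.\<close>

lemma monomial_of_mset:
  assumes "sorted (map to_nat v)" "reduced od v" "mset u = mset v"
  shows "monomial od u = Poly_Mapping.single v ((-1) ^ inversions od u)"
proof -
  have "mset (filter od u) = mset (filter od v)" using assms(3) by simp
  then have "reduced od u" using assms(2) unfolding reduced_def by (metis mset_eq_imp_distinct_iff)
  then show ?thesis by (simp add: monomial_def sort_key_eq_if_sorted[OF assms(1,3)])
qed

lemma lookup_monomial_eq_0: "mset u \<noteq> mset v \<Longrightarrow> Poly_Mapping.lookup (monomial od u) v = 0"
  by (auto simp: monomial_def lookup_single when_def)

context
  fixes W \<kappa> b c dy dx dg od and G :: "('k::field, gen list \<Rightarrow>\<^sub>0 'k) fiw_alg"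
  assumes dg_def: "dg = gen_deg dy dx" and od_def: "od = odd_gen \<kappa> dg"
    and G_def: "G = free_fiw_algebra W \<kappa> b c dy dx"
begin

lemmas free_algebra_simps = G_simps[OF dg_def od_def G_def]

interpretation V: vspace "pm_scale :: 'k \<Rightarrow> (gen list \<Rightarrow>\<^sub>0 'k) \<Rightarrow> _"
  by (simp add: vspace_def vector_space_pm_scale)

lemma fiw_module_G: "fiw_module pm_scale W (\<lambda>n. alg_piece G n d) (alg_map G d)"
  using fiw_module_of_algebra[OF fiw_algebra_G[OF dg_def od_def G_def], of d] by (simp add: free_algebra_simps(1))

lemma weyl_module_G: "weyl_module pm_scale W n (alg_piece G n d) (alg_map G d n n)"
  using fiw_module.weyl_module[OF fiw_module_G[of d], of n] by simp

text \<open>The index set of the monomial basis of the degree \<open>d\<close> piece.\<close>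

definition "nwords n d = {w \<in> words W b c dy dx n d. sorted (map to_nat w) \<and> reduced od w}"

lemma keys_piece: "x \<in> alg_piece G n d \<longleftrightarrow> Poly_Mapping.keys x \<subseteq> nwords n d"
  by (auto simp: free_algebra_simps(2) nwords_def words_def dg_def)

lemma single_piece: "w \<in> nwords n d \<Longrightarrow> Poly_Mapping.single w r \<in> alg_piece G n d"
  by (simp add: keys_piece)

lemma expand_keys: "x = (\<Sum>w\<in>Poly_Mapping.keys x. pm_scale (Poly_Mapping.lookup x w) (Poly_Mapping.single w 1))"
  by (rule poly_mapping_eqI) (simp add: lookup_sum lookup_single when_def in_keys_iff)

lemma piece_span: "alg_piece G n d \<subseteq> V.span ((\<lambda>w. Poly_Mapping.single w 1) ` nwords n d)"
proof
  fix x assume x: "x \<in> alg_piece G n d"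
  have "(\<Sum>w\<in>Poly_Mapping.keys x. pm_scale (Poly_Mapping.lookup x w) (Poly_Mapping.single w 1)) \<in> V.span ((\<lambda>w. Poly_Mapping.single w 1) ` nwords n d)"
    using x by (intro V.span_sum V.span_scale V.span_base) (auto simp: keys_piece)
  then show "x \<in> V.span ((\<lambda>w. Poly_Mapping.single w 1) ` nwords n d)" using expand_keys[of x] by simp
qed

lemma map_single: "alg_map G d m n f (Poly_Mapping.single w 1) = monomial od (map (gen_map f) w)"
  by (simp add: free_algebra_simps(5) lin_ext_single[OF vector_space_pm_scale] pm_scale_1)

context
  fixes k :: nat
  assumes deg: "\<forall>j<b. dy j > 0" "\<forall>j<c. dx j > 0"
begin

lemma findim_piece: "V.findim (alg_piece G n d)"
proof -
  have "finite (nwords n d)" using finite_words[OF deg] by (simp add: nwords_def)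
  then show ?thesis
    unfolding V.findim_def using piece_span fiw_module.sub[OF fiw_module_G] by blast
qed

text \<open>Averaging is onto the invariants, so averages of monomials span them. Monomials with
  equal labels are related up to sign by the stabiliser, which the average does not see; one
  representative per label is enough. Some averages may vanish, which is harmless for an upper
  bound.\<close>

lemma invs_span:
  assumes kn: "k \<le> n" and char: "of_nat (card (stab W k n)) \<noteq> (0 :: 'k)"
  obtains S where "finite S" "card S \<le> card (label k n ` words W b c dy dx n d)"
    "weyl_module.invs W n (alg_piece G n d) (alg_map G d n n) k \<subseteq> V.span S"
proof -
  interpret M: weyl_module pm_scale W n "alg_piece G n d" "alg_map G d n n" by (rule weyl_module_G)
  have fin: "finite (nwords n d)" using finite_words[OF deg] by (simp add: nwords_def)
  define r where "r l = (SOME w. w \<in> nwords n d \<and> label k n w = l)" for l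
  have r: "r (label k n w) \<in> nwords n d" "label k n (r (label k n w)) = label k n w" if "w \<in> nwords n d" for w
    using someI[of "\<lambda>w'. w' \<in> nwords n d \<and> label k n w' = label k n w" w] that by (auto simp: r_def)
  define e where "e w = M.avg k (Poly_Mapping.single w 1)" for w
  define S where "S = (\<lambda>l. e (r l)) ` label k n ` nwords n d"
  have eS: "e w \<in> V.span S" if w: "w \<in> nwords n d" for w
  proof -
    define v where "v = r (label k n w)"
    have v: "v \<in> nwords n d" "label k n w = label k n v" using r[OF w] by (auto simp: v_def)
    have wv: "set w \<subseteq> gens W b c n" "set v \<subseteq> gens W b c n" using w v(1) by (auto simp: nwords_def words_def)
    obtain h where h: "h \<in> weyl W n" "\<And>a. a \<in> fiw_obj W k \<Longrightarrow> h a = a" "mset (map (gen_map h) w) = mset v"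
      using same_label[OF kn wv v(2)] by blast
    have hs: "h \<in> stab W k n" using h by (simp add: stab_def)
    define u where "u = (-1 :: 'k) ^ inversions od (map (gen_map h) w)"
    have "e w = M.avg k (alg_map G d n n h (Poly_Mapping.single w 1))"
      unfolding e_def by (rule M.avg_rho[OF hs kn single_piece[OF w], symmetric])
    also have "alg_map G d n n h (Poly_Mapping.single w 1) = pm_scale u (Poly_Mapping.single v 1)"
      using monomial_of_mset[of v od, OF _ _ h(3)] v(1) by (simp add: map_single nwords_def u_def)
    also have "M.avg k (pm_scale u (Poly_Mapping.single v 1)) = pm_scale u (e v)"
      using M.avg_linear[OF kn char] single_piece[OF v(1)] by (simp add: linear_map_on_def e_def del: pm_scale_single)
    also have "\<dots> \<in> V.span S" using w unfolding S_def v_def by (intro V.span_scale V.span_base imageI)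
    finally show ?thesis .
  qed
  have "M.invs k \<subseteq> V.span S"
  proof
    fix x assume x: "x \<in> M.invs k"
    then have xV: "x \<in> alg_piece G n d" using M.invs_subset by auto
    have keys: "w \<in> nwords n d" if "w \<in> Poly_Mapping.keys x" for w using xV that by (auto simp: keys_piece)
    have "x = M.avg k (\<Sum>w\<in>Poly_Mapping.keys x. pm_scale (Poly_Mapping.lookup x w) (Poly_Mapping.single w 1))"
      using M.avg_invs[OF kn char x] expand_keys[of x] by simp
    also have "\<dots> = (\<Sum>w\<in>Poly_Mapping.keys x. M.avg k (pm_scale (Poly_Mapping.lookup x w) (Poly_Mapping.single w 1)))"
      by (intro V.linear_map_on_sum[OF V.vspace_axioms M.subspace_V M.avg_linear[OF kn char]]
          V.subspace_scale[OF M.subspace_V] single_piece keys)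
    also have "\<dots> = (\<Sum>w\<in>Poly_Mapping.keys x. pm_scale (Poly_Mapping.lookup x w) (e w))"
      using M.avg_linear[OF kn char] single_piece keys by (intro sum.cong) (auto simp: linear_map_on_def e_def simp del: pm_scale_single)
    finally show "x \<in> V.span S" using eS keys by (metis (no_types, lifting) V.span_scale V.span_sum)
  qed
  moreover have "card S \<le> card (label k n ` nwords n d)" unfolding S_def using fin by (intro card_image_le) simp
  moreover have "card (label k n ` nwords n d) \<le> card (label k n ` words W b c dy dx n d)"
    using finite_words[OF deg] by (intro card_mono image_mono) (auto simp: nwords_def)
  ultimately show ?thesis using that[of S] fin by (simp add: S_def)
qed

end

text \<open>On the subscripts that \<open>f\<close> does not move out of \<open>fiw_obj W n\<close>, it agrees with an element of the
  stabiliser; so it does not change the coefficients of an invariant.\<close>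

lemma lookup_map_invs:
  assumes f: "f \<in> fiw_hom W n (Suc n)" "\<And>a. a \<in> fiw_obj W k \<Longrightarrow> f a = a" and kn: "k \<le> n"
    and v: "v \<in> weyl_module.invs W n (alg_piece G n d) (alg_map G d n n) k" and w0: "set w0 \<subseteq> gens W b c n"
  shows "Poly_Mapping.lookup (alg_map G d n (Suc n) f v) w0 =
    (if set w0 \<subseteq> gen_map f ` gens W b c n then Poly_Mapping.lookup v w0 else 0)"
proof -
  interpret M: weyl_module pm_scale W n "alg_piece G n d" "alg_map G d n n" by (rule weyl_module_G)
  \<comment> \<open>\<open>f\<close> may send subscripts to \<open>n + 1\<close>. On those that stay
    inside \<open>n\<close> it is a partial injection compatible with negation, and this extends to
    a group element \<open>h\<close>.\<close>
  define S where "S = {a \<in> fiw_obj W n. f a \<in> fiw_obj W n}"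
  obtain h where h: "h \<in> weyl W n" "\<And>a. a \<in> S \<Longrightarrow> h a = f a"
  proof (rule extend_to_weyl[of S W n f])
    show "- a \<in> S" if "a \<in> S" "W = TypeBC" for a
    proof -
      have "- a \<in> fiw_obj W n" "- f a \<in> fiw_obj W n" using that by (auto simp: S_def in_fiw_obj_iff)
      then show ?thesis using that fiw_hom_neg[OF f(1), of a] by (simp add: S_def)
    qed
    show "f (- a) = - f a" if "a \<in> S" "W = TypeBC" for a
      using that fiw_hom_neg[OF f(1), of a] by (auto simp: S_def in_fiw_obj_iff)
    show "inj_on f S" by (rule inj_on_subset[OF fiw_hom_inj[OF f(1)]]) (auto simp: S_def)
  qed (auto simp: S_def)
  have hs: "h \<in> stab W k n"
    using h f(2) fiw_obj_mono[OF kn, of W] by (auto simp: stab_def S_def)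
  have vV: "v \<in> alg_piece G n d" using v M.invs_subset by auto
  have keys: "set w \<subseteq> gens W b c n" if "w \<in> Poly_Mapping.keys v" for w
    using vV that by (auto simp: keys_piece nwords_def words_def)
  have lookup: "Poly_Mapping.lookup (alg_map G d n m g v) w0 =
      (\<Sum>w\<in>Poly_Mapping.keys v. Poly_Mapping.lookup v w * Poly_Mapping.lookup (monomial od (map (gen_map g) w)) w0)" for m g
    by (simp add: free_algebra_simps(5) lin_ext_def lookup_sum)
  have fh: "map (gen_map f) w = map (gen_map h) w" if w: "w \<in> Poly_Mapping.keys v" "mset (map (gen_map f) w) = mset w0" for w
  proof (rule map_cong[OF refl])
    fix g assume g: "g \<in> set w"
    have "gen_map f g \<in> set (map (gen_map f) w)" using g by simp
    also have "set (map (gen_map f) w) = set w0" using w(2) by (rule mset_eq_setD)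
    finally have "gen_map f g \<in> gens W b c n" using w0 by auto
    moreover have "g \<in> gens W b c n" using keys[OF w(1)] g by auto
    ultimately show "gen_map f g = gen_map h g" using h(2) by (cases g) (auto simp: gens_def S_def)
  qed
  show ?thesis
  proof (cases "set w0 \<subseteq> gen_map f ` gens W b c n")
    case True
    \<comment> \<open>Conversely, suppose that \<open>h\<close> carries a word onto the letters of
      \<open>w0\<close>. Each image letter is then also an \<open>f\<close>-image of some letter
      with subscript in \<open>S\<close>, where \<open>f\<close> and \<open>h\<close> agree;
      injectivity of \<open>h\<close> identifies the two preimages.\<close>
    have hf: "map (gen_map f) w = map (gen_map h) w" if w: "w \<in> Poly_Mapping.keys v" "mset (map (gen_map h) w) = mset w0" for w
    proof (rule map_cong[OF refl])
      fix g assume g: "g \<in> set w"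
      have "gen_map h g \<in> set (map (gen_map h) w)" using g by simp
      also have "set (map (gen_map h) w) = set w0" using w(2) by (rule mset_eq_setD)
      finally have hg: "gen_map h g \<in> gens W b c n" "gen_map h g \<in> gen_map f ` gens W b c n" using w0 True by auto
      then obtain g' where g': "g' \<in> gens W b c n" "gen_map h g = gen_map f g'" by auto
      have gg: "g \<in> gens W b c n" using keys[OF w(1)] g by auto
      show "gen_map f g = gen_map h g"
      proof (cases g)
        case (Xvar j a)
        with g' obtain a' where a': "g' = Xvar j a'" "a' \<in> fiw_obj W n" "h a = f a'"
          by (cases g') (auto simp: gens_def)
        have "a \<in> fiw_obj W n" "h a \<in> fiw_obj W n" using gg hg(1) Xvar by (auto simp: gens_def)
        then have "a' \<in> S" using a' by (simp add: S_def)
        then have "a = a'"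
          using h(2)[of a'] a' inj_onD[OF weylD(2)[OF h(1)], of a a'] \<open>a \<in> fiw_obj W n\<close> by simp
        then show ?thesis using a' Xvar by simp
      qed simp
    qed
    have "Poly_Mapping.lookup (alg_map G d n (Suc n) f v) w0 = Poly_Mapping.lookup (alg_map G d n n h v) w0"
      unfolding lookup
    proof (rule sum.cong[OF refl])
      fix w assume w: "w \<in> Poly_Mapping.keys v"
      show "Poly_Mapping.lookup v w * Poly_Mapping.lookup (monomial od (map (gen_map f) w)) w0 =
         Poly_Mapping.lookup v w * Poly_Mapping.lookup (monomial od (map (gen_map h) w)) w0"
      proof (cases "mset (map (gen_map f) w) = mset w0 \<or> mset (map (gen_map h) w) = mset w0")
        case True
        then have "map (gen_map f) w = map (gen_map h) w" using fh[OF w] hf[OF w] by blast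
        then show ?thesis by (simp only:)
      next
        case False
        then show ?thesis by (simp add: lookup_monomial_eq_0 del: mset_map)
      qed
    qed
    also have "alg_map G d n n h v = v" using v hs by (simp add: M.invs_def)
    finally show ?thesis using True by simp
  next
    case False
    \<comment> \<open>Some letter of \<open>w0\<close> is missed by \<open>f\<close>, so no image of
      a word can have the letters of \<open>w0\<close>.\<close>
    have "Poly_Mapping.lookup (monomial od (map (gen_map f) w) :: _ \<Rightarrow>\<^sub>0 'k) w0 = 0" if w: "w \<in> Poly_Mapping.keys v" for w
    proof (rule lookup_monomial_eq_0)
      show "mset (map (gen_map f) w) \<noteq> mset w0"
      proof
        assume "mset (map (gen_map f) w) = mset w0"
        then have "set (map (gen_map f) w) = set w0" by (rule mset_eq_setD)
        then show False using False keys[OF w] by auto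
      qed
    qed
    then have "Poly_Mapping.lookup (alg_map G d n (Suc n) f v) w0 = 0"
      unfolding lookup by (intro sum.neutral ballI) simp
    then show ?thesis using False by simp
  qed
qed

end

section \<open>Stabilisation of the invariants\<close>

definition fiw_incl :: "family \<Rightarrow> nat \<Rightarrow> int \<Rightarrow> int" where
  "fiw_incl W n = (\<lambda>a\<in>fiw_obj W n. a)"

lemma fiw_incl_hom: "fiw_incl W n \<in> fiw_hom W n (Suc n)"
  using fiw_obj_mono[of n "Suc n" W] by (auto simp: fiw_incl_def fiw_hom_iff inj_on_def)

lemma (in vspace) linear_inj_image_basis:
  assumes t: "vspace t" and f: "linear_map_on scale t V f" "inj_on f V" and B: "basis_of V B"
  shows "\<not> module.dependent t (f ` B)"
proof -
  interpret t: vspace t by fact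
  interpret P: vector_space_pair scale t by unfold_locales
  have sV: "subspace V" and B': "B \<subseteq> V" "independent B" "span B = V"
    using B subspace_span[of B] by (auto simp: basis_of_def)
  obtain f' where f': "Vector_Spaces.linear scale t f'" "\<And>x. x \<in> V \<Longrightarrow> f' x = f x"
    using linear_map_on_extend[OF t sV f(1)] by metis
  have "inj_on f' (span B)" using f(2) f'(2) by (simp add: B'(3) inj_on_def)
  from P.linear_independent_injective_image[OF f'(1) B'(2) this]
  show ?thesis using f'(2) B'(1) by (metis image_cong subsetD)
qed

context fiw_module
begin

abbreviation invs_at :: "nat \<Rightarrow> nat \<Rightarrow> 'v set" where
  "invs_at n k \<equiv> weyl_module.invs W n (V n) (mp n n) k"

text \<open>Inclusion alone does not preserve invariance, because the larger stabiliser can exchange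
  positions beyond \<open>k\<close> with the new position \<open>n + 1\<close>. The average restores
  it.\<close>

definition step :: "nat \<Rightarrow> nat \<Rightarrow> 'v \<Rightarrow> 'v" where
  "step k n x = weyl_module.avg scale W (Suc n) (mp (Suc n) (Suc n)) k (mp n (Suc n) (fiw_incl W n) x)"

lemma invs_at_subset: "invs_at n k \<subseteq> V n"
proof -
  interpret M: weyl_module scale W n "V n" "mp n n" by (rule weyl_module)
  show ?thesis by (rule M.invs_subset)
qed

lemma subspace_invs_at: "subspace (invs_at n k)"
proof -
  interpret M: weyl_module scale W n "V n" "mp n n" by (rule weyl_module)
  show ?thesis by (rule M.subspace_invs)
qed

context
  fixes k :: nat
  assumes char: "\<And>n. k \<le> n \<Longrightarrow> of_nat (card (stab W k n)) \<noteq> (0 :: 'k)"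
begin

lemma step_in:
  assumes "k \<le> n" "x \<in> V n" shows "step k n x \<in> invs_at (Suc n) k"
proof -
  interpret M: weyl_module scale W "Suc n" "V (Suc n)" "mp (Suc n) (Suc n)" by (rule weyl_module)
  show ?thesis unfolding step_def
    using assms by (intro M.avg_in_invs char mp_in[OF fiw_incl_hom]) auto
qed

lemma step_linear:
  assumes "k \<le> n" shows "linear_map_on scale scale (V n) (step k n)"
proof -
  interpret M: weyl_module scale W "Suc n" "V (Suc n)" "mp (Suc n) (Suc n)" by (rule weyl_module)
  have "k \<le> Suc n" using assms by simp
  from M.avg_linear[OF this char[OF this]] mp_linear[OF fiw_incl_hom, of n] mp_in[OF fiw_incl_hom, of _ n]
  show ?thesis unfolding step_def linear_map_on_def by simp
qed

lemma step_linear_invs: "k \<le> n \<Longrightarrow> linear_map_on scale scale (invs_at n k) (step k n)"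
  using step_linear[of n] invs_at_subset[of n] by (auto simp: linear_map_on_def subset_iff)

text \<open>The two extensions of \<open>\<tau>\<close> are compatible with the inclusion because
  both are the identity beyond \<open>k\<close>. The larger one also preserves \<open>k\<close>, so
  it commutes with the average.\<close>

lemma step_equivariant:
  assumes kn: "k \<le> n" and \<tau>: "\<tau> \<in> weyl W k" and x: "x \<in> V n"
  shows "step k n (mp n n (extend_id W k n \<tau>) x) = mp (Suc n) (Suc n) (extend_id W k (Suc n) \<tau>) (step k n x)"
proof -
  interpret M: weyl_module scale W "Suc n" "V (Suc n)" "mp (Suc n) (Suc n)" by (rule weyl_module)
  let ?t = "extend_id W k n \<tau>" and ?t' = "extend_id W k (Suc n) \<tau>" and ?i = "fiw_incl W n"
  have kn': "k \<le> Suc n" using kn by simp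
  note t = extend_id[OF \<tau> kn] note t' = extend_id[OF \<tau> kn']
  have th: "?t \<in> fiw_hom W n n" "?t' \<in> fiw_hom W (Suc n) (Suc n)" using t(1) t'(1) by (simp_all add: weyl_iff_hom)
  have obj: "fiw_obj W n \<subseteq> fiw_obj W (Suc n)" by (rule fiw_obj_mono) simp
  have "compose (fiw_obj W n) ?i ?t = compose (fiw_obj W n) ?t' ?i"
    using weylD(1)[OF t(1)] obj by (auto simp: compose_def fiw_incl_def extend_id_def fun_eq_iff)
  then have "mp n (Suc n) ?i (mp n n ?t x) = mp (Suc n) (Suc n) ?t' (mp n (Suc n) ?i x)"
    using mp_compose[OF th(1) fiw_incl_hom x] mp_compose[OF fiw_incl_hom th(2) x] by simp
  moreover have "?t' a \<in> fiw_obj W k" if "a \<in> fiw_obj W k" for a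
    using that t'(2) weylD(1)[OF \<tau>] by simp
  ultimately show ?thesis unfolding step_def
    using M.avg_commute[OF kn' t'(1) _ mp_in[OF fiw_incl_hom x]] by simp
qed

text \<open>A linear bijection compatible with \<open>\<tau>\<close> conjugates one action into the
  other. Cyclicity with its inverse \<open>J\<close> transports the trace.\<close>

lemma trace_step:
  assumes kn: "k \<le> n" and \<tau>: "\<tau> \<in> weyl W k" and bij: "bij_betw (step k n) (invs_at n k) (invs_at (Suc n) k)"
    and fin: "findim (invs_at n k)" "findim (invs_at (Suc n) k)"
  shows "trace_on scale (invs_at n k) (mp n n (extend_id W k n \<tau>)) =
    trace_on scale (invs_at (Suc n) k) (mp (Suc n) (Suc n) (extend_id W k (Suc n) \<tau>))"
proof -
  interpret M: weyl_module scale W n "V n" "mp n n" by (rule weyl_module)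
  define T where "T = mp n n (extend_id W k n \<tau>)"
  define J where "J = inv_into (invs_at n k) (step k n)"
  have T: "T x \<in> invs_at n k" if "x \<in> invs_at n k" for x
    unfolding T_def by (rule M.rho_extend_id_invs[OF kn char[OF kn] \<tau> that])
  have J: "J y \<in> invs_at n k" "step k n (J y) = y" if "y \<in> invs_at (Suc n) k" for y
    using that bij unfolding J_def by (auto simp: bij_betw_def inv_into_into f_inv_into_f)
  have Js: "J (step k n x) = x" if "x \<in> invs_at n k" for x
    using that bij unfolding J_def by (simp add: bij_betw_def)
  note lin = step_linear_invs[OF kn]
  have Tlin: "linear_map_on scale scale (invs_at n k) T"
    unfolding T_def using mp_linear extend_id(1)[OF \<tau> kn] invs_at_subset[of n]
    by (auto simp: linear_map_on_def weyl_iff_hom subset_iff)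
  have Jlin: "linear_map_on scale scale (invs_at (Suc n) k) J"
    unfolding linear_map_on_def
  proof (intro conjI ballI allI)
    fix x y assume xy: "x \<in> invs_at (Suc n) k" "y \<in> invs_at (Suc n) k"
    have "x + y = step k n (J x + J y)" using J xy lin by (simp add: linear_map_on_def)
    then show "J (x + y) = J x + J y" using Js J xy subspace_add[OF subspace_invs_at] by simp
  next
    fix r x assume x: "x \<in> invs_at (Suc n) k"
    have "scale r x = step k n (scale r (J x))" using J x lin by (simp add: linear_map_on_def)
    then show "J (scale r x) = scale r (J x)" using Js J x subspace_scale[OF subspace_invs_at] by simp
  qed
  have "trace_on scale (invs_at n k) T = trace_on scale (invs_at n k) (\<lambda>x. T (J (step k n x)))"
    by (rule trace_on_cong[OF subspace_invs_at]) (simp add: Js)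
  also have "\<dots> = trace_on scale (invs_at (Suc n) k) (\<lambda>y. step k n (T (J y)))"
  proof (rule trace_on_cyclic[OF vspace_axioms fin lin])
    show "step k n ` invs_at n k \<subseteq> invs_at (Suc n) k" using bij by (simp add: bij_betw_def)
    show "linear_map_on scale scale (invs_at (Suc n) k) (\<lambda>y. T (J y))"
      using Jlin Tlin J(1) by (simp add: linear_map_on_def)
    show "(\<lambda>y. T (J y)) ` invs_at (Suc n) k \<subseteq> invs_at n k" using T J(1) by auto
  qed
  also have "\<dots> = trace_on scale (invs_at (Suc n) k) (mp (Suc n) (Suc n) (extend_id W k (Suc n) \<tau>))"
  proof (rule trace_on_cong[OF subspace_invs_at])
    fix y assume y: "y \<in> invs_at (Suc n) k"
    have "J y \<in> V n" using J(1)[OF y] invs_at_subset by auto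
    then show "step k n (T (J y)) = mp (Suc n) (Suc n) (extend_id W k (Suc n) \<tau>) y"
      using step_equivariant[OF kn \<tau>] J(2)[OF y] by (simp add: T_def)
  qed
  finally show ?thesis by (simp add: T_def)
qed

text \<open>The dimensions of the invariants are bounded and, as the steps are injective, nondecreasing.\<close>

lemma step_eventually_surj:
  assumes inj: "\<And>n. k \<le> n \<Longrightarrow> inj_on (step k n) (invs_at n k)"
    and S: "\<And>n. k \<le> n \<Longrightarrow> \<exists>S. finite S \<and> card S \<le> D \<and> invs_at n k \<subseteq> span S"
  shows "\<exists>N\<ge>k. \<forall>n\<ge>N. step k n ` invs_at n k = invs_at (Suc n) k"
proof -
  have "\<exists>B. basis_of (invs_at n k) B" for n using basis_of_exists[OF subspace_invs_at] by blast
  then obtain B where B: "basis_of (invs_at n k) (B n)" for n by metis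
  have fin: "finite (B n)" and bound: "card (B n) \<le> D" if n: "k \<le> n" for n
    using S[OF n] basis_of_card_le[OF B] by (metis order_trans)+
  have ind: "independent (step k n ` B n)" and inB: "step k n ` B n \<subseteq> invs_at (Suc n) k"
      and card: "card (step k n ` B n) = card (B n)" if n: "k \<le> n" for n
  proof -
    have Bn: "B n \<subseteq> invs_at n k" using B[of n] by (simp add: basis_of_def)
    show "independent (step k n ` B n)"
      by (rule linear_inj_image_basis[OF vspace_axioms step_linear_invs[OF n] inj[OF n] B])
    show "step k n ` B n \<subseteq> invs_at (Suc n) k" using Bn invs_at_subset[of n] step_in[OF n] by blast
    show "card (step k n ` B n) = card (B n)" by (rule card_image[OF inj_on_subset[OF inj[OF n] Bn]])
  qed
  have le: "card C \<le> card (B n)" if n: "k \<le> n" and C: "independent C" "C \<subseteq> invs_at n k" for n C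
    using independent_span_bound[OF fin[OF n] C(1)] C(2) B[of n] by (auto simp: basis_of_def)
  have mono: "card (B n) \<le> card (B (Suc n))" if "k \<le> n" for n
    using le[OF _ ind[OF that] inB[OF that]] card[OF that] that by simp
  \<comment> \<open>A bounded family of dimensions attains its maximum, and monotonicity freezes the
    dimension from that index on.\<close>
  obtain N where N: "k \<le> N" "\<And>n. k \<le> n \<Longrightarrow> card (B n) \<le> card (B N)"
    using ex_has_greatest_nat[of "\<lambda>n. k \<le> n" k "\<lambda>n. card (B n)" "Suc D"] bound by (auto simp: less_Suc_eq_le)
  have const: "card (B n) = card (B N)" if "N \<le> n" for n
    using that
  proof (induction n rule: dec_induct)
    case (step n)
    then have "card (B N) \<le> card (B (Suc n))" using mono[of n] N(1) by simp
    then show ?case using N(2)[of "Suc n"] N(1) step by simp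
  qed simp
  have "step k n ` invs_at n k = invs_at (Suc n) k" if n: "N \<le> n" for n
  proof
    have kn: "k \<le> n" using N(1) n by simp
    show "step k n ` invs_at n k \<subseteq> invs_at (Suc n) k" using invs_at_subset[of n] step_in[OF kn] by blast
    have "invs_at (Suc n) k \<subseteq> span (step k n ` B n)"
    proof (rule ccontr)
      assume "\<not> ?thesis"
      then obtain y where y: "y \<in> invs_at (Suc n) k" "y \<notin> span (step k n ` B n)" by auto
      have "independent (insert y (step k n ` B n))" using ind[OF kn] y(2) by (simp add: independent_insert span_base)
      moreover have "insert y (step k n ` B n) \<subseteq> invs_at (Suc n) k" using y(1) inB[OF kn] by simp
      ultimately have "card (insert y (step k n ` B n)) \<le> card (B (Suc n))" using le[of "Suc n"] kn by simp
      moreover have "y \<notin> step k n ` B n" using y(2) span_base by blast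
      ultimately show False using fin[OF kn] card[OF kn] const[OF n] const[of "Suc n"] n by simp
    qed
    moreover have "span (step k n ` B n) \<subseteq> step k n ` invs_at n k"
    proof (rule span_minimal)
      show "step k n ` B n \<subseteq> step k n ` invs_at n k" using B[of n] by (auto simp: basis_of_def)
      have "invs_at n k \<subseteq> span (B n)" using B[of n] by (simp add: basis_of_def)
      from linear_map_on_image[OF vspace_axioms subspace_invs_at step_linear_invs[OF kn] fin[OF kn] this]
      show "subspace (step k n ` invs_at n k)" by blast
    qed
    ultimately show "invs_at (Suc n) k \<subseteq> step k n ` invs_at n k" by blast
  qed
  then show ?thesis using N(1) by blast
qed

end

end

section \<open>Limits and convergence\<close>

lemma (in vspace) linear_map_on_inj:
  assumes t: "vspace t" and V: "subspace V" and f: "linear_map_on scale t V f"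
    and kernel: "\<And>x. x \<in> V \<Longrightarrow> f x = 0 \<Longrightarrow> x = 0"
  shows "inj_on f V"
proof (rule inj_onI)
  interpret t: vspace t by fact
  interpret P: vector_space_pair scale t by unfold_locales
  obtain f' where f': "Vector_Spaces.linear scale t f'" "\<And>x. x \<in> V \<Longrightarrow> f' x = f x"
    using linear_map_on_extend[OF t V f] by metis
  fix x y assume xy: "x \<in> V" "y \<in> V" "f x = f y"
  have "x - y \<in> V" by (rule subspace_diff[OF V xy(1,2)])
  moreover have "f (x - y) = 0"
    using f'(2)[OF \<open>x - y \<in> V\<close>] f'(2)[OF xy(1)] f'(2)[OF xy(2)] xy(3) P.linear_diff[OF f'(1), of x y] by simp
  ultimately show "x = y" using kernel by fastforce
qed

text \<open>Take a monomial \<open>w0\<close> occurring in \<open>v\<close>. By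
  \<open>lookup_map_invs\<close> each term of the average contributes to its coefficient either the
  coefficient in \<open>v\<close> or zero, and the identity contributes the former. Hence the
  coefficient is multiplied by a positive rational number and cannot vanish.\<close>

lemma step_inj_free:
  fixes G :: "('k::field, gen list \<Rightarrow>\<^sub>0 'k) fiw_alg"
  assumes G: "G = free_fiw_algebra W \<kappa> b c dy dx"
    and char: "\<And>m. m > 0 \<Longrightarrow> of_nat m \<noteq> (0 :: 'k)" and kn: "k \<le> n"
  shows "inj_on (fiw_module.step pm_scale W (alg_map G d) k n) (weyl_module.invs W n (alg_piece G n d) (alg_map G d n n) k)"
proof -
  interpret F: fiw_module pm_scale W "\<lambda>n. alg_piece G n d" "alg_map G d"
    by (rule fiw_module_G[OF refl refl G])
  interpret M: weyl_module pm_scale W "Suc n" "alg_piece G (Suc n) d" "alg_map G d (Suc n) (Suc n)"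
    by (rule weyl_module_G[OF refl refl G])
  have ch: "of_nat (card (stab W k n)) \<noteq> (0 :: 'k)" if "k \<le> n" for n
    using char card_stab_pos[OF that] by blast
  let ?I = "F.invs_at n k" and ?i = "fiw_incl W n" and ?N = "inverse (of_nat (card (stab W k (Suc n)))) :: 'k"
  have lin: "linear_map_on pm_scale pm_scale ?I (F.step k n)" by (rule F.step_linear_invs[OF ch kn])
  have sub: "F.subspace ?I" by (rule F.subspace_invs_at)
  have kernel: "v = 0" if v: "v \<in> ?I" "F.step k n v = 0" for v
  proof (rule ccontr)
    assume "v \<noteq> 0"
    then obtain w0 where w0: "w0 \<in> Poly_Mapping.keys v" by (metis keys_eq_empty ex_in_conv)
    have vV: "v \<in> alg_piece G n d" using v(1) F.invs_at_subset by auto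
    have w0n: "set w0 \<subseteq> gens W b c n" using vV w0 by (auto simp: G_simps(2)[OF refl refl G])
    \<comment> \<open>The group elements that contribute: those for which every letter of
      \<open>w0\<close> comes from a letter at level \<open>n\<close> under inclusion followed by
      \<open>h\<close>.\<close>
    define H where "H = {h \<in> stab W k (Suc n). set w0 \<subseteq> gen_map (compose (fiw_obj W n) h ?i) ` gens W b c n}"
    have coeff: "Poly_Mapping.lookup (alg_map G d (Suc n) (Suc n) h (alg_map G d n (Suc n) ?i v)) w0 =
        (if h \<in> H then Poly_Mapping.lookup v w0 else 0)" if h: "h \<in> stab W k (Suc n)" for h
    proof -
      have hh: "h \<in> fiw_hom W (Suc n) (Suc n)" using stab_weyl[OF h] by (simp add: weyl_iff_hom)
      have "compose (fiw_obj W n) h ?i a = a" if "a \<in> fiw_obj W k" for a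
        using that h fiw_obj_mono[OF kn, of W] by (auto simp: compose_def fiw_incl_def stab_def)
      from lookup_map_invs[OF refl refl G compose_hom[OF fiw_incl_hom hh] this kn v(1) w0n]
      show ?thesis using F.mp_compose[OF fiw_incl_hom hh vV] h by (simp add: H_def)
    qed
    have "0 = Poly_Mapping.lookup (F.step k n v) w0" using v(2) by simp
    also have "\<dots> = (\<Sum>h\<in>stab W k (Suc n). ?N * (if h \<in> H then Poly_Mapping.lookup v w0 else 0))"
      using coeff unfolding F.step_def M.avg_def by (simp add: lookup_sum)
    also have "\<dots> = (\<Sum>h\<in>H. ?N * Poly_Mapping.lookup v w0)"
      by (rule sum.mono_neutral_cong_right) (auto simp: H_def)
    also have "\<dots> = of_nat (card H) * (?N * Poly_Mapping.lookup v w0)" by simp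
    finally have "of_nat (card H) * (?N * Poly_Mapping.lookup v w0) = 0" by simp
    moreover have "fiw_id W (Suc n) \<in> H"
    proof -
      have "gen_map (compose (fiw_obj W n) (fiw_id W (Suc n)) ?i) g = g" if "g \<in> gens W b c n" for g
        using that fiw_obj_mono[of n "Suc n" W] by (auto simp: gens_def compose_def fiw_id_def fiw_incl_def)
      then have "w \<in> gen_map (compose (fiw_obj W n) (fiw_id W (Suc n)) ?i) ` gens W b c n" if "w \<in> set w0" for w
        using w0n that by (metis image_eqI subsetD)
      then show ?thesis using fiw_id_stab[of k "Suc n" W] kn by (auto simp: H_def)
    qed
    then have "card H > 0" by (auto simp: card_gt_0_iff H_def)
    ultimately have "Poly_Mapping.lookup v w0 = 0" using char[of "card H"] ch[of "Suc n"] kn by simp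
    then show False using w0 by (simp add: in_keys_iff)
  qed
  show ?thesis by (rule F.linear_map_on_inj[OF F.vspace_axioms sub lin kernel])
qed

lemma fiw_subquotientE:
  assumes "fiw_subquotient W A G"
  obtains U \<phi> where "fiw_subalgebra W G U"
    "\<And>n d. linear_map_on (alg_scale G) (alg_scale A) (U n d) (\<phi> n d)" "\<And>n d. \<phi> n d ` U n d = alg_piece A n d"
    "\<And>m n d f x. f \<in> fiw_hom W m n \<Longrightarrow> x \<in> U m d \<Longrightarrow> \<phi> n d (alg_map G d m n f x) = alg_map A d m n f (\<phi> m d x)"
  using assms unfolding fiw_subquotient_def
proof (elim conjE exE, goal_cases)
  case (1 U \<phi>)
  from 1(4,7) show ?thesis by (intro 1(1)[of U \<phi>] 1(3)) auto
qed

lemma fiw_subquotient_weyl_subquotient: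
  assumes "fiw_subquotient W A G"
  shows "weyl_subquotient W n (alg_scale A) (alg_piece A n d) (alg_map A d n n) (alg_scale G) (alg_piece G n d) (alg_map G d n n)"
proof -
  from assms have A: "fiw_algebra W A" by (simp add: fiw_subquotient_def)
  from fiw_module.weyl_module[OF fiw_module_of_algebra[OF A, of d], of n]
  have rep: "weyl_rep W n (alg_scale A) (alg_piece A n d) (alg_map A d n n)" by (simp add: weyl_module_iff)
  obtain U \<phi> where U: "fiw_subalgebra W G U"
    and \<phi>: "linear_map_on (alg_scale G) (alg_scale A) (U n d) (\<phi> n d)" "\<phi> n d ` U n d = alg_piece A n d"
      "\<And>f x. f \<in> fiw_hom W n n \<Longrightarrow> x \<in> U n d \<Longrightarrow> \<phi> n d (alg_map G d n n f x) = alg_map A d n n f (\<phi> n d x)"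
    by (rule fiw_subquotientE[OF assms]) blast
  have U': "U n d \<subseteq> alg_piece G n d" "module.subspace (alg_scale G) (U n d)"
    "\<And>f x. f \<in> fiw_hom W n n \<Longrightarrow> x \<in> U n d \<Longrightarrow> alg_map G d n n f x \<in> U n d"
    using U unfolding fiw_subalgebra_def by blast+
  show ?thesis
    unfolding weyl_subquotient_def
    by (intro conjI rep exI[of _ "U n d"] exI[of _ "\<phi> n d"] U'(1,2) \<phi>(1,2) ballI image_subsetI U'(3) \<phi>(3))
       (simp_all add: weyl_iff_hom)
qed

lemma inner_weyl_add: "inner_weyl W n (\<lambda>\<sigma>. Q \<sigma> + Q' \<sigma>) \<chi> = inner_weyl W n Q \<chi> + inner_weyl W n Q' \<chi>"
  by (simp add: inner_weyl_def distrib_right sum.distrib add_divide_distrib)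

lemma inner_weyl_scale: "inner_weyl W n (\<lambda>\<sigma>. c * Q \<sigma>) \<chi> = c * inner_weyl W n Q \<chi>"
  by (simp add: inner_weyl_def sum_distrib_left mult.assoc)

lemma inner_weyl_cong: "(\<And>\<sigma>. \<sigma> \<in> weyl W n \<Longrightarrow> Q \<sigma> = Q' \<sigma>) \<Longrightarrow> inner_weyl W n Q \<chi> = inner_weyl W n Q' \<chi>"
  by (simp add: inner_weyl_def)

text \<open>The constant \<open>C\<close> serves all degrees and all large \<open>n\<close> at once,
  so it survives the limit in \<open>n\<close> and leaves an estimate in \<open>d\<close>
  alone.\<close>

lemma inner_bound:
  fixes \<iota> :: "'k::field \<Rightarrow> complex" and G :: "('k, gen list \<Rightarrow>\<^sub>0 'k) fiw_alg"
  assumes G: "G = free_fiw_algebra W \<kappa> b c dy dx" and \<iota>: "field_embedding \<iota>"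
    and deg: "\<forall>j<b. dy j > 0" "\<forall>j<c. dx j > 0"
    and sub: "\<And>n d. weyl_subquotient W n s (R n d) (\<rho> n d) (alg_scale G) (alg_piece G n d) (alg_map G d n n)"
    and z: "0 < z" "z < 1" and Q: "Q \<in> pattern_span W"
  shows "\<exists>C N. \<forall>n\<ge>N. \<forall>d. norm (inner_weyl W n (Q n) (\<lambda>\<sigma>. \<iota> (trace_on s (R n d) (\<rho> n d \<sigma>)))) \<le> C / z ^ d"
  using Q
proof (induction rule: pattern_span.induct)
  case (pattern \<tau> k)
  obtain C where C: "\<And>n d. card (label k n ` words W b c dy dx n d) \<le> C / z ^ d"
    using card_label_le[OF deg z] by metis
  have "norm (inner_weyl W n (\<lambda>\<sigma>. of_nat (card (fix_set W k n \<tau> \<sigma>))) (\<lambda>\<sigma>. \<iota> (trace_on s (R n d) (\<rho> n d \<sigma>)))) \<le> C / z ^ d"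
    if kn: "k \<le> n" for n d
  proof -
    have char: "of_nat (card (stab W k n)) \<noteq> (0 :: 'k)"
      using field_embedding_of_nat_neq_0[OF \<iota>] card_stab_pos[OF kn] by blast
    have Gs: "alg_scale G = pm_scale" by (rule G_simps(1)[OF refl refl G])
    obtain S where S: "finite S" "card S \<le> card (label k n ` words W b c dy dx n d)"
      "weyl_module.invs W n (alg_piece G n d) (alg_map G d n n) k \<subseteq> module.span pm_scale S"
      using invs_span[OF refl refl G deg kn char] by metis
    obtain S' where S': "finite S'" "card S' \<le> card S" "weyl_module.invs W n (R n d) (\<rho> n d) k \<subseteq> module.span s S'" "vspace.findim s (R n d)"
      using weyl_subquotient_invs[OF sub[of n d, unfolded Gs] weyl_module_G[OF refl refl G] kn char S(1,3) findim_piece[OF refl refl G deg]]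
      by metis
    have "weyl_module s W n (R n d) (\<rho> n d)" using sub[of n d] by (simp add: weyl_subquotient_def weyl_module_iff)
    then interpret M: weyl_module s W n "R n d" "\<rho> n d" .
    have "norm (inner_weyl W n (\<lambda>\<sigma>. of_nat (card (fix_set W k n \<tau> \<sigma>))) (\<lambda>\<sigma>. \<iota> (trace_on s (R n d) (\<rho> n d \<sigma>)))) \<le> card S'"
      unfolding M.inner_fix_set[OF \<iota> pattern kn S'(4)]
      using M.norm_trace_invs[OF \<iota> pattern kn S'(1,3)] by simp
    also have "\<dots> \<le> card (label k n ` words W b c dy dx n d)" using S(2) S'(2) by simp
    also have "\<dots> \<le> C / z ^ d" by (rule C)
    finally show ?thesis .
  qed
  then show ?case by blast
next
  case (add Q Q')
  then obtain C N C' N' where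
    "\<forall>n\<ge>N. \<forall>d. norm (inner_weyl W n (Q n) (\<lambda>\<sigma>. \<iota> (trace_on s (R n d) (\<rho> n d \<sigma>)))) \<le> C / z ^ d"
    "\<forall>n\<ge>N'. \<forall>d. norm (inner_weyl W n (Q' n) (\<lambda>\<sigma>. \<iota> (trace_on s (R n d) (\<rho> n d \<sigma>)))) \<le> C' / z ^ d" by blast
  then have "\<forall>n\<ge>max N N'. \<forall>d. norm (inner_weyl W n (\<lambda>\<sigma>. Q n \<sigma> + Q' n \<sigma>) (\<lambda>\<sigma>. \<iota> (trace_on s (R n d) (\<rho> n d \<sigma>)))) \<le> (C + C') / z ^ d"
    unfolding inner_weyl_add add_divide_distrib by (auto intro!: order_trans[OF norm_triangle_ineq] add_mono)
  then show ?case by blast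
next
  case (scale Q a)
  then obtain C N where
    "\<forall>n\<ge>N. \<forall>d. norm (inner_weyl W n (Q n) (\<lambda>\<sigma>. \<iota> (trace_on s (R n d) (\<rho> n d \<sigma>)))) \<le> C / z ^ d" by blast
  then have "\<forall>n\<ge>N. \<forall>d. norm (inner_weyl W n (\<lambda>\<sigma>. a * Q n \<sigma>) (\<lambda>\<sigma>. \<iota> (trace_on s (R n d) (\<rho> n d \<sigma>)))) \<le> (norm a * C) / z ^ d"
    unfolding inner_weyl_scale norm_mult by (auto intro!: mult_left_mono simp flip: times_divide_eq_right)
  then show ?case by blast
next
  case (cong Q Q')
  have "inner_weyl W n (Q' n) \<chi> = inner_weyl W n (Q n) \<chi>" for n \<chi> by (rule inner_weyl_cong) (rule cong.hyps)
  then show ?case using cong.IH by simp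
qed

lemma summable_lim:
  fixes \<iota> :: "'k::field \<Rightarrow> complex" and G :: "('k, gen list \<Rightarrow>\<^sub>0 'k) fiw_alg"
  assumes G: "G = free_fiw_algebra W \<kappa> b c dy dx" and \<iota>: "field_embedding \<iota>"
    and deg: "\<forall>j<b. dy j > 0" "\<forall>j<c. dx j > 0" and P: "is_char_poly W P" and q: "(q :: real) > 1"
    and sub: "\<And>n d. weyl_subquotient W n s (R n d) (\<rho> n d) (alg_scale G) (alg_piece G n d) (alg_map G d n n)"
    and conv: "\<And>d. convergent (\<lambda>n. char_poly_inner \<iota> W P n s (R n d) (\<rho> n d))"
  shows "summable (\<lambda>d. norm (lim (\<lambda>n. char_poly_inner \<iota> W P n s (R n d) (\<rho> n d)) / of_real q ^ d))"
proof -
  \<comment> \<open>The midpoint of \<open>1 / q\<close> and 1: it is below 1, as the growth bound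
    requires, while \<open>z * q > 1\<close> makes the comparison series a convergent geometric
    one.\<close>
  define z where "z = (1 + 1 / q) / 2"
  have z: "0 < z" "z < 1" and zq: "z * q > 1" using q by (auto simp: z_def field_simps)
  obtain C N where C: "\<And>n d. n \<ge> N \<Longrightarrow> norm (char_poly_inner \<iota> W P n s (R n d) (\<rho> n d)) \<le> C / z ^ d"
    using inner_bound[OF G \<iota> deg sub z char_poly_in_pattern_span[OF \<iota> P]] unfolding char_poly_inner_def by blast
  have le: "norm (lim (\<lambda>n. char_poly_inner \<iota> W P n s (R n d) (\<rho> n d))) \<le> C / z ^ d" for d
  proof (rule LIMSEQ_le_const2)
    show "(\<lambda>n. norm (char_poly_inner \<iota> W P n s (R n d) (\<rho> n d))) \<longlonglongrightarrow> norm (lim (\<lambda>n. char_poly_inner \<iota> W P n s (R n d) (\<rho> n d)))"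
      by (rule tendsto_norm) (use conv convergent_LIMSEQ_iff in blast)
  qed (use C in blast)
  show ?thesis
  proof (rule summable_comparison_test'[where N = 0])
    show "summable (\<lambda>d. C * (1 / (z * q)) ^ d)" using zq by (intro summable_mult summable_geometric) simp
    fix d
    have "norm (lim (\<lambda>n. char_poly_inner \<iota> W P n s (R n d) (\<rho> n d)) / of_real q ^ d) \<le> (C / z ^ d) / q ^ d"
      using divide_right_mono[OF le[of d], of "q ^ d"] q by (simp add: norm_divide norm_power)
    then show "norm (norm (lim (\<lambda>n. char_poly_inner \<iota> W P n s (R n d) (\<rho> n d)) / of_real q ^ d)) \<le> C * (1 / (z * q)) ^ d"
      by (simp add: power_mult_distrib power_one_over field_simps)
  qed
qed

text \<open>For a quotient \<open>A = U / K\<close> with \<open>U\<close> and \<open>K\<close> inside the free algebra, the steps are eventually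
  bijective on the invariants of \<open>U\<close> and of \<open>K\<close>, hence on those of \<open>A\<close>.\<close>

lemma step_eventually_bij:
  fixes \<iota> :: "'k::field \<Rightarrow> complex" and G :: "('k, gen list \<Rightarrow>\<^sub>0 'k) fiw_alg"
  assumes G: "G = free_fiw_algebra W \<kappa> b c dy dx" and \<iota>: "field_embedding \<iota>"
    and deg: "\<forall>j<b. dy j > 0" "\<forall>j<c. dx j > 0" and A: "fiw_subquotient W A G"
  shows "\<exists>N\<ge>k. \<forall>n\<ge>N. bij_betw (fiw_module.step (alg_scale A) W (alg_map A d) k n)
    (weyl_module.invs W n (alg_piece A n d) (alg_map A d n n) k)
    (weyl_module.invs W (Suc n) (alg_piece A (Suc n) d) (alg_map A d (Suc n) (Suc n)) k)"
proof -
  have Gs: "alg_scale G = pm_scale" by (rule G_simps(1)[OF refl refl G])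
  have ch: "of_nat m \<noteq> (0 :: 'k)" if "m > 0" for m using field_embedding_of_nat_neq_0[OF \<iota> that] .
  have char: "of_nat (card (stab W k n)) \<noteq> (0 :: 'k)" if "k \<le> n" for n using ch card_stab_pos[OF that] by blast
  have Gmod: "fiw_module pm_scale W (\<lambda>n. alg_piece G n d) (alg_map G d)" by (rule fiw_module_G[OF refl refl G])
  have Amod: "fiw_module (alg_scale A) W (\<lambda>n. alg_piece A n d) (alg_map A d)"
    using A by (intro fiw_module_of_algebra) (simp add: fiw_subquotient_def)
  interpret G: fiw_module pm_scale W "\<lambda>n. alg_piece G n d" "alg_map G d" by (rule Gmod)
  interpret A: fiw_module "alg_scale A" W "\<lambda>n. alg_piece A n d" "alg_map A d" by (rule Amod)
  obtain U' \<phi>' where U': "fiw_subalgebra W G U'"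
    and \<phi>': "\<And>n. linear_map_on pm_scale (alg_scale A) (U' n d) (\<phi>' n d)" "\<And>n. \<phi>' n d ` U' n d = alg_piece A n d"
      "\<And>m n f x. f \<in> fiw_hom W m n \<Longrightarrow> x \<in> U' m d \<Longrightarrow> \<phi>' n d (alg_map G d m n f x) = alg_map A d m n f (\<phi>' m d x)"
    by (rule fiw_subquotientE[OF A, unfolded Gs]) blast
  define U where "U n = U' n d" for n
  define \<phi> where "\<phi> n = \<phi>' n d" for n
  note \<phi> = \<phi>'[folded U_def \<phi>_def]
  have U: "U n \<subseteq> alg_piece G n d" "G.subspace (U n)" "\<And>m f x. f \<in> fiw_hom W m n \<Longrightarrow> x \<in> U m \<Longrightarrow> alg_map G d m n f x \<in> U n" for n
    using U' unfolding fiw_subalgebra_def Gs U_def by blast+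
  have Umod: "fiw_module pm_scale W U (alg_map G d)" by (rule fiw_module_sub[OF Gmod U(2,1,3)])
  interpret U: fiw_module pm_scale W U "alg_map G d" by (rule Umod)
  define K where "K n = {x \<in> U n. \<phi> n x = 0}" for n
  have \<phi>add: "\<phi> n (x + y) = \<phi> n x + \<phi> n y" and \<phi>scale: "\<phi> n (pm_scale r x) = alg_scale A r (\<phi> n x)"
    if "x \<in> U n" "y \<in> U n" for n x y r using \<phi>(1)[of n] that by (auto simp: linear_map_on_def)
  have U0: "0 \<in> U n" for n by (rule G.subspace_0[OF U(2)])
  have \<phi>0: "\<phi> n 0 = 0" for n using \<phi>add[of 0 n 0] U0 by simp
  have A0: "alg_map A d m n f 0 = 0" if "f \<in> fiw_hom W m n" for m n f
    using A.linear_map_on_sum[OF A.vspace_axioms A.sub A.mp_linear[OF that], of "{}"] by simp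
  have Kmod: "fiw_module pm_scale W K (alg_map G d)"
  proof (rule fiw_module_sub[OF Umod])
    show "G.subspace (K n)" for n
      using G.subspace_add[OF U(2)] G.subspace_scale[OF U(2)] U0
      by (intro G.subspaceI) (auto simp: K_def \<phi>add \<phi>0 \<phi>scale)
  qed (use U(3) \<phi>(3) A0 in \<open>auto simp: K_def\<close>)
  interpret K: fiw_module pm_scale W K "alg_map G d" by (rule Kmod)
  have invs_mono: "weyl_module.invs W n X \<rho> k \<subseteq> weyl_module.invs W n Y \<rho> k"
    if "weyl_module s W n X \<rho>" "weyl_module s W n Y \<rho>" "X \<subseteq> Y" for n s and X Y :: "(gen list \<Rightarrow>\<^sub>0 'k) set" and \<rho>
    using that(3) unfolding weyl_module.invs_def[OF that(1)] weyl_module.invs_def[OF that(2)] by auto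
  have Kmem: "K.invs_at n k = {x \<in> U.invs_at n k. \<phi> n x = 0}" for n
    unfolding weyl_module.invs_def[OF K.weyl_module] weyl_module.invs_def[OF U.weyl_module] by (auto simp: K_def)
  have UG: "U.invs_at n k \<subseteq> G.invs_at n k" for n by (rule invs_mono[OF U.weyl_module G.weyl_module U(1)])
  have KU: "K.invs_at n k \<subseteq> U.invs_at n k" for n by (auto simp: Kmem)
  have injG: "inj_on (G.step k n) (G.invs_at n k)" if "k \<le> n" for n by (rule step_inj_free[OF G ch that])
  \<comment> \<open>One dimension bound for the free algebra serves both \<open>U\<close> and
    \<open>K\<close>. The degree is fixed here, so \<open>1/2\<close> is just some number below
    1.\<close>
  have "\<exists>D. \<forall>n\<ge>k. \<exists>S. finite S \<and> card S \<le> D \<and> G.invs_at n k \<subseteq> G.span S"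
  proof -
    have half: "0 < (1/2 :: real)" "(1/2 :: real) < 1" by simp_all
    obtain C where C: "\<And>n d. card (label k n ` words W b c dy dx n d) \<le> C / (1/2) ^ d"
      using card_label_le[OF deg half] by metis
    have "\<exists>S. finite S \<and> card S \<le> nat \<lceil>C / (1/2) ^ d\<rceil> \<and> G.invs_at n k \<subseteq> G.span S" if kn: "k \<le> n" for n
    proof -
      obtain S where S: "finite S" "card S \<le> card (label k n ` words W b c dy dx n d)" "G.invs_at n k \<subseteq> G.span S"
        using invs_span[OF refl refl G deg kn char[OF kn]] by metis
      have "real (card S) \<le> C / (1/2) ^ d" using S(2) C[of n d] by linarith
      then have "card S \<le> nat \<lceil>C / (1/2) ^ d\<rceil>" by linarith
      then show ?thesis using S by blast
    qed
    then show ?thesis by blast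
  qed
  then obtain D where D: "\<And>n. k \<le> n \<Longrightarrow> \<exists>S. finite S \<and> card S \<le> D \<and> G.invs_at n k \<subseteq> G.span S" by blast
  have "\<exists>N\<ge>k. \<forall>n\<ge>N. G.step k n ` U.invs_at n k = U.invs_at (Suc n) k"
  proof (rule U.step_eventually_surj[where D = D])
    show "inj_on (G.step k n) (U.invs_at n k)" if "k \<le> n" for n
      by (rule inj_on_subset[OF injG[OF that] UG])
    show "\<exists>S. finite S \<and> card S \<le> D \<and> U.invs_at n k \<subseteq> G.span S" if "k \<le> n" for n
      using D[OF that] UG[of n] by blast
  qed (rule char)
  then obtain N1 where N1: "N1 \<ge> k" "\<And>n. n \<ge> N1 \<Longrightarrow> G.step k n ` U.invs_at n k = U.invs_at (Suc n) k" by blast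
  have "\<exists>N\<ge>k. \<forall>n\<ge>N. G.step k n ` K.invs_at n k = K.invs_at (Suc n) k"
  proof (rule K.step_eventually_surj[where D = D])
    show "inj_on (G.step k n) (K.invs_at n k)" if "k \<le> n" for n
      by (rule inj_on_subset[OF injG[OF that] order_trans[OF KU UG]])
    show "\<exists>S. finite S \<and> card S \<le> D \<and> K.invs_at n k \<subseteq> G.span S" if "k \<le> n" for n
      using D[OF that] UG[of n] KU[of n] by blast
  qed (rule char)
  then obtain N2 where N2: "N2 \<ge> k" "\<And>n. n \<ge> N2 \<Longrightarrow> G.step k n ` K.invs_at n k = K.invs_at (Suc n) k" by blast
  have image: "\<phi> n ` U.invs_at n k = A.invs_at n k" if "k \<le> n" for n
    by (rule invs_image(1)[OF U.weyl_module A.weyl_module \<phi>(1,2) _ that char[OF that]])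
       (use \<phi>(3) in \<open>simp add: weyl_iff_hom\<close>)
  have step: "A.step k n (\<phi> n x) = \<phi> (Suc n) (G.step k n x)" if kn: "k \<le> n" and x: "x \<in> U n" for n x
  proof -
    have kn': "k \<le> Suc n" using kn by simp
    show ?thesis
      unfolding A.step_def G.step_def \<phi>(3)[OF fiw_incl_hom x, symmetric]
      by (rule invs_image(2)[OF U.weyl_module A.weyl_module \<phi>(1,2) _ kn' char[OF kn'], symmetric])
         (use \<phi>(3) U.mp_in[OF fiw_incl_hom x] in \<open>auto simp: weyl_iff_hom\<close>)
  qed
  have "bij_betw (A.step k n) (A.invs_at n k) (A.invs_at (Suc n) k)" if n: "n \<ge> max N1 N2" for n
  proof -
    have kn: "k \<le> n" "k \<le> Suc n" using n N1(1) by auto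
    note surjU = N1(2)[of n] and surjK = N2(2)[of n]
    have "A.step k n ` A.invs_at n k = \<phi> (Suc n) ` G.step k n ` U.invs_at n k"
      unfolding image[OF kn(1), symmetric] image_image
      using step[OF kn(1)] U.invs_at_subset[of n k] by (intro image_cong) auto
    also have "\<dots> = A.invs_at (Suc n) k" using surjU n image[OF kn(2)] by simp
    finally have surj: "A.step k n ` A.invs_at n k = A.invs_at (Suc n) k" .
    \<comment> \<open>Diagram chase: the step of \<open>u\<close> is an invariant of
      \<open>K\<close> at level \<open>n + 1\<close>, hence the step of an invariant of
      \<open>K\<close> at level \<open>n\<close>. Injectivity in the free algebra identifies that
      invariant with \<open>u\<close>.\<close>
    have kernel: "\<phi> n u = 0" if u: "u \<in> U.invs_at n k" "A.step k n (\<phi> n u) = 0" for u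
    proof -
      have uU: "u \<in> U n" using u(1) U.invs_at_subset by auto
      have "G.step k n u \<in> U.invs_at (Suc n) k" using surjU n u(1) by auto
      moreover have "\<phi> (Suc n) (G.step k n u) = 0" using step[OF kn(1) uU] u(2) by simp
      ultimately have "G.step k n u \<in> K.invs_at (Suc n) k"
        by (simp add: Kmem)
      then have "G.step k n u \<in> G.step k n ` K.invs_at n k" using surjK n by simp
      then obtain k' where k': "k' \<in> K.invs_at n k" "G.step k n k' = G.step k n u" by (metis imageE)
      then have "k' = u" using inj_onD[OF injG[OF kn(1)]] KU UG u(1) by blast
      then show ?thesis using k'(1) by (simp add: Kmem)
    qed
    have "inj_on (A.step k n) (A.invs_at n k)"
    proof (rule A.linear_map_on_inj[OF A.vspace_axioms A.subspace_invs_at A.step_linear_invs[OF char kn(1)]])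
      fix x assume x: "x \<in> A.invs_at n k" "A.step k n x = 0"
      then have "x \<in> \<phi> n ` U.invs_at n k" using image[OF kn(1)] by simp
      then obtain u where "u \<in> U.invs_at n k" "x = \<phi> n u" by (metis imageE)
      then show "x = 0" using kernel x(2) by simp
    qed
    then show ?thesis using surj by (simp add: bij_betw_def)
  qed
  then show ?thesis using N1(1) by (meson max.cobounded1 order_trans)
qed

lemma convergent_inner:
  fixes \<iota> :: "'k::field \<Rightarrow> complex" and G :: "('k, gen list \<Rightarrow>\<^sub>0 'k) fiw_alg"
  assumes G: "G = free_fiw_algebra W \<kappa> b c dy dx" and \<iota>: "field_embedding \<iota>"
    and deg: "\<forall>j<b. dy j > 0" "\<forall>j<c. dx j > 0" and A: "fiw_subquotient W A G" and Q: "Q \<in> pattern_span W"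
  shows "convergent (\<lambda>n. inner_weyl W n (Q n) (\<lambda>\<sigma>. \<iota> (trace_on (alg_scale A) (alg_piece A n d) (alg_map A d n n \<sigma>))))"
  using Q
proof (induction rule: pattern_span.induct)
  case (pattern \<tau> k)
  interpret A: fiw_module "alg_scale A" W "\<lambda>n. alg_piece A n d" "alg_map A d"
    using A by (intro fiw_module_of_algebra) (simp add: fiw_subquotient_def)
  have Gs: "alg_scale G = pm_scale" by (rule G_simps(1)[OF refl refl G])
  have char: "of_nat (card (stab W k n)) \<noteq> (0 :: 'k)" if "k \<le> n" for n
    using field_embedding_of_nat_neq_0[OF \<iota>] card_stab_pos[OF that] by blast
  obtain N where N: "N \<ge> k" "\<And>n. n \<ge> N \<Longrightarrow> bij_betw (A.step k n) (A.invs_at n k) (A.invs_at (Suc n) k)"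
    using step_eventually_bij[OF G \<iota> deg A, of k d] by blast
  have fin: "A.findim (alg_piece A n d)" if kn: "k \<le> n" for n
  proof -
    obtain S where S: "finite S" "weyl_module.invs W n (alg_piece G n d) (alg_map G d n n) k \<subseteq> module.span pm_scale S"
      using invs_span[OF refl refl G deg kn char[OF kn]] by metis
    show ?thesis
      using weyl_subquotient_invs[OF fiw_subquotient_weyl_subquotient[OF A, of n d, unfolded Gs] weyl_module_G[OF refl refl G] kn char[OF kn] S
          findim_piece[OF refl refl G deg]] by metis
  qed
  have fini: "A.findim (A.invs_at n k)" if "k \<le> n" for n
    by (rule A.findim_subset[OF fin[OF that] A.subspace_invs_at A.invs_at_subset])
  define t where "t n = trace_on (alg_scale A) (A.invs_at n k) (alg_map A d n n (extend_id W k n \<tau>))" for n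
  have inner: "inner_weyl W n (\<lambda>\<sigma>. of_nat (card (fix_set W k n \<tau> \<sigma>)))
      (\<lambda>\<sigma>. \<iota> (trace_on (alg_scale A) (alg_piece A n d) (alg_map A d n n \<sigma>))) = cnj (\<iota> (t n))" if "k \<le> n" for n
    unfolding t_def by (rule weyl_module.inner_fix_set[OF A.weyl_module \<iota> pattern that fin[OF that]])
  have const: "t n = t N" if "N \<le> n" for n
    using that
  proof (induction n rule: dec_induct)
    case (step n)
    then have "k \<le> n" "k \<le> Suc n" using N(1) by auto
    then have "t n = t (Suc n)"
      unfolding t_def using A.trace_step[OF char _ pattern N(2)[OF step(1)] fini fini] by blast
    then show ?case using step by simp
  qed simp
  have "eventually (\<lambda>n. inner_weyl W n (\<lambda>\<sigma>. of_nat (card (fix_set W k n \<tau> \<sigma>)))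
      (\<lambda>\<sigma>. \<iota> (trace_on (alg_scale A) (alg_piece A n d) (alg_map A d n n \<sigma>))) = cnj (\<iota> (t N))) sequentially"
    using eventually_ge_at_top[of N]
  proof eventually_elim
    case (elim n)
    then show ?case using inner[of n] const[of n] N(1) by simp
  qed
  then show ?case unfolding convergent_def by (blast intro: tendsto_eventually)
next
  case (add Q Q')
  then show ?case unfolding inner_weyl_add by (intro convergent_add)
next
  case (scale Q c)
  then show ?case unfolding inner_weyl_scale by (intro convergent_mult convergent_const)
next
  case (cong Q Q')
  have "inner_weyl W n (Q' n) \<chi> = inner_weyl W n (Q n) \<chi>" for n \<chi> by (rule inner_weyl_cong) (rule cong.hyps)
  then show ?case using cong.IH by simp
qed

theorem theorem3p5:
  fixes W :: family and \<kappa> :: algebra_kind and \<iota> :: "'k::field \<Rightarrow> complex"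
    and b c :: nat and dy dx :: "nat \<Rightarrow> nat"
    and P :: "'k char_poly" and q :: real
    and A :: "('k, 'a::ab_group_add) fiw_alg"
    and s :: "'k \<Rightarrow> 'v \<Rightarrow> 'v::ab_group_add"
    and R :: "nat \<Rightarrow> nat \<Rightarrow> 'v set"
    and \<rho> :: "nat \<Rightarrow> nat \<Rightarrow> (int \<Rightarrow> int) \<Rightarrow> 'v \<Rightarrow> 'v"
  defines "\<Gamma> \<equiv> (free_fiw_algebra W \<kappa> b c dy dx :: ('k, gen list \<Rightarrow>\<^sub>0 'k) fiw_alg)"
  assumes "field_embedding \<iota>"
    and "\<forall>j<b. dy j > 0" and "\<forall>j<c. dx j > 0"
    and "is_char_poly W P" and "q > 1"
  shows
    "(fiw_subquotient W A \<Gamma> \<longrightarrow>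
        (\<forall>d. convergent (\<lambda>n. char_poly_inner \<iota> W P n (alg_scale A) (alg_piece A n d) (alg_map A d n n))) \<and>
        summable (\<lambda>d. norm (lim (\<lambda>n. char_poly_inner \<iota> W P n (alg_scale A) (alg_piece A n d) (alg_map A d n n))
                             / of_real q ^ d)))
     \<and>
     ((\<forall>n d. weyl_subquotient W n s (R n d) (\<rho> n d)
                (alg_scale \<Gamma>) (alg_piece \<Gamma> n d) (alg_map \<Gamma> d n n)) \<and>
        (\<forall>d. convergent (\<lambda>n. char_poly_inner \<iota> W P n s (R n d) (\<rho> n d))) \<longrightarrow>
        summable (\<lambda>d. norm (lim (\<lambda>n. char_poly_inner \<iota> W P n s (R n d) (\<rho> n d)) / of_real q ^ d)))"
proof -
  have \<Gamma>: "\<Gamma> = free_fiw_algebra W \<kappa> b c dy dx" by (simp add: \<Gamma>_def)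
  note \<iota> = assms(2) and deg = assms(3,4) and P = assms(5) and q = assms(6)
  have conv: "convergent (\<lambda>n. char_poly_inner \<iota> W P n (alg_scale A) (alg_piece A n d) (alg_map A d n n))"
    if "fiw_subquotient W A \<Gamma>" for d
    unfolding char_poly_inner_def by (rule convergent_inner[OF \<Gamma> \<iota> deg that char_poly_in_pattern_span[OF \<iota> P]])
  show ?thesis
  proof (intro conjI impI allI)
    assume A: "fiw_subquotient W A \<Gamma>"
    show "convergent (\<lambda>n. char_poly_inner \<iota> W P n (alg_scale A) (alg_piece A n d) (alg_map A d n n))" for d
      by (rule conv[OF A])
    \<comment> \<open>The pieces of \<open>A\<close> form a family of equivariant subquotients whose
      limits have just been shown to exist, so the general summability statement applies.\<close>
    show "summable (\<lambda>d. norm (lim (\<lambda>n. char_poly_inner \<iota> W P n (alg_scale A) (alg_piece A n d) (alg_map A d n n))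
        / of_real q ^ d))"
      by (rule summable_lim[OF \<Gamma> \<iota> deg P q fiw_subquotient_weyl_subquotient[OF A] conv[OF A]])
  next
    assume R: "(\<forall>n d. weyl_subquotient W n s (R n d) (\<rho> n d)
        (alg_scale \<Gamma>) (alg_piece \<Gamma> n d) (alg_map \<Gamma> d n n)) \<and>
      (\<forall>d. convergent (\<lambda>n. char_poly_inner \<iota> W P n s (R n d) (\<rho> n d)))"
    show "summable (\<lambda>d. norm (lim (\<lambda>n. char_poly_inner \<iota> W P n s (R n d) (\<rho> n d)) / of_real q ^ d))"
      using R by (intro summable_lim[OF \<Gamma> \<iota> deg P q]) blast+
  qed
qed

end
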